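(* Let $(M,\mathcal D,\langle\cdot,\cdot\rangle)$ be an equiregular sub-Riemannian manifold with Popp's volume $\mathcal P\in\Omega^n(M)$. Then sub-Riemannian (local) isometries are volume preserving transformations for Popp's volume: if $\phi:M\to M$ is a sub-Riemannian isometry or, more generally, a sub-Riemannian local isometry, then $\phi^*\mathcal P=\mathcal P$.
   Context: Sub-Riemannian manifold: a triple $(M,\mathcal D,\langle\cdot,\cdot\rangle)$ where $M$ is a connected orientable smooth manifold of dimension $n\ge 3$, $\mathcal D\subset TM$ is a smooth distribution of constant rank $k<n$, and $\langle\cdot,\cdot\rangle_q$ is an inner product on $\mathcal D_q$ depending smoothly on $q$. $\mathcal D$ is assumed bracket-generating: iterated Lie brackets of smooth sections of $\mathcal D$ span $T_qM$ at every $q$. Flag: $\mathcal D^0_q=\{0\}$, $\mathcal D^1=\mathcal D$, $\mathcal D^{i+1}_q=\mathcal D^i_q+[\mathcal D^i,\mathcal D]_q$. $\mathcal D$ is equiregular if $k_i:=\dim\mathcal D^i_q$ does not depend on $q$ for every $i$ (with $k_0=0$, $k_1=k$); the step is the minimal $m$ with $\mathcal D^m=TM$. Then each $\mathcal D^i$ is a distribution. Popp's volume: for $q\in M$ and $1\le i\le m$, the linear map $$\pi_i:\otimes^i\mathcal D_q\to\mathcal D^i_q/\mathcal D^{i-1}_q,\qquad \pi_i(v_1\otimes\cdots\otimes v_i)=[V_1,[V_2,\dots,[V_{i-1},V_i]]]_q \bmod \mathcal D^{i-1}_q,$$ where $V_j$ is any local section of $\mathcal D$ with $V_j(q)=v_j$,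 is well defined and surjective ($\pi_1$ is the identity). Give $\otimes^i\mathcal D_q$ the inner product induced by that of $\mathcal D_q$, and $\mathcal D^i_q/\mathcal D^{i-1}_q$ the inner product whose norm is $\|Y\|=\min\{\|Z\| : \pi_i(Z)=Y\}$. Let $\mathrm{gr}_q(\mathcal D)=\bigoplus_{i=1}^m\mathcal D^i_q/\mathcal D^{i-1}_q$ be the orthogonal direct sum, and let $\mu_q\in\wedge^n\mathrm{gr}_q(\mathcal D)^*$ be the wedge of the elements of an orthonormal dual basis (defined up to sign). Let $\theta_q:\wedge^nT_qM\to\wedge^n\mathrm{gr}_q(\mathcal D)$ be the canonical isomorphism sending $v_1\wedge\cdots\wedge v_n$ to $\widehat\theta(v_1)\wedge\cdots\wedge\widehat\theta(v_n)$, where $v_1,\dots,v_n$ is any basis of $T_qM$ such that $v_1,\dots,v_{k_i}$ is a basis of $\mathcal D^i_q$ for all $i$, and $\widehat\theta(v_l)$ is the class of $v_l$ in $\mathcal D^{i}_q/\mathcal D^{i-1}_q$ for $k_{i-1}<l\le k_{i}$ ($\theta_q$ does not depend on the basis). Popp's volume is the smooth $n$-form $\mathcal P\in\Omega^n(M)$ with $\mathcal P_q=\mu_q\circ\theta_q$, these local $n$-forms being glued together using the orientability of $M$. Isometry: a (local) diffeomorphism $\phi:M\to M$ is a (local) isometry if $\phi_*(\mathcal D_q)=\mathcal D_{\phi(q)}$ for all $q\in M$ and $\langle\phi_*X,\phi_*Y\rangle_{\phi(q)}=\langle X,Y\rangle_q$ for all $q\in M$ and $X,Y\in\mathcal D_q$.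 Volume preserving transformation: for a volume form $\mu\in\Omega^n(M)$, a (local) diffeomorphism $\phi:M\to M$ is a (local) volume preserving transformation for $\mu$ if $\phi^*\mu=\mu$.
   Formalization: The identity φ*P = P is proved for (local) isometries that preserve orientation; for all others φ*P = −P is proved, since the claim fails there, e.g. for (h,t) ↦ (h,−t) on the Heisenberg group times a line. *)

theory Defs
  imports
    "HOL-Analysis.Analysis"
    "HOL-Library.Function_Algebras"
    "HOL-Combinatorics.Permutations"
begin

section \<open>Pointwise vector space structure on functions\<close>

instantiation "fun" :: (type, real_vector) real_vector
begin

definition scaleR_fun :: "real \<Rightarrow> ('a \<Rightarrow> 'b) \<Rightarrow> 'a \<Rightarrow> 'b"
  where "scaleR_fun c f = (\<lambda>x. c *\<^sub>R f x)"

instance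
  by standard (simp_all add: scaleR_fun_def fun_eq_iff scaleR_add_right scaleR_add_left)

end


section \<open>Smooth manifolds\<close>

text \<open>\<open>k\<close>-fold continuous differentiability, for open \<open>S\<close>.\<close>

fun Ck_on :: "nat \<Rightarrow> 'a::real_normed_vector set \<Rightarrow> ('a \<Rightarrow> 'b::real_normed_vector) \<Rightarrow> bool" where
  "Ck_on 0 S f \<longleftrightarrow> continuous_on S f"
| "Ck_on (Suc k) S f \<longleftrightarrow>
     (\<forall>x\<in>S. f differentiable (at x)) \<and> (\<forall>v. Ck_on k S (\<lambda>x. frechet_derivative f (at x) v))"

definition smooth_on :: "'a::real_normed_vector set \<Rightarrow> ('a \<Rightarrow> 'b::real_normed_vector) \<Rightarrow> bool" where
  "smooth_on S f \<longleftrightarrow> open S \<and> (\<forall>k. Ck_on k S f)"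

text \<open>A chart \<open>(U, x)\<close> consists of its domain and its coordinate map; the latter is
  only relevant on \<open>U\<close>. The manifold is the whole type \<open>'m\<close>, and its dimension is \<open>DIM('e)\<close>.\<close>

type_synonym ('m, 'e) chart = "'m set \<times> ('m \<Rightarrow> 'e)"

definition smooth_atlas :: "('m::topological_space, 'e::euclidean_space) chart set \<Rightarrow> bool" where
  "smooth_atlas A \<longleftrightarrow>
     (\<forall>(U, x)\<in>A. open U \<and> open (x ` U) \<and> homeomorphism U (x ` U) x (inv_into U x)) \<and>
     (\<Union>(U, x)\<in>A. U) = UNIV \<and>
     (\<forall>(U, x)\<in>A. \<forall>(V, y)\<in>A. smooth_on (x ` (U \<inter> V)) (y \<circ> inv_into U x))"

definition smooth_fun_on ::
  "('m::topological_space, 'e::euclidean_space) chart set \<Rightarrow> 'm set \<Rightarrow> ('m \<Rightarrow> real) \<Rightarrow> bool" where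
  "smooth_fun_on A S f \<longleftrightarrow>
     open S \<and> (\<forall>(U, x)\<in>A. smooth_on (x ` (U \<inter> S)) (f \<circ> inv_into U x))"

definition smooth_near ::
  "('m::topological_space, 'e::euclidean_space) chart set \<Rightarrow> 'm \<Rightarrow> ('m \<Rightarrow> real) \<Rightarrow> bool" where
  "smooth_near A q f \<longleftrightarrow> (\<exists>S. q \<in> S \<and> smooth_fun_on A S f)"

definition smooth_map_on ::
  "('m::topological_space, 'e::euclidean_space) chart set \<Rightarrow> 'm set \<Rightarrow> ('m \<Rightarrow> 'm) \<Rightarrow> bool" where
  "smooth_map_on A S \<phi> \<longleftrightarrow>
     open S \<and> continuous_on S \<phi> \<and>
     (\<forall>(U, x)\<in>A. \<forall>(V, y)\<in>A.
        smooth_on (x ` (S \<inter> U \<inter> \<phi> -` V)) (y \<circ> \<phi> \<circ> inv_into U x))"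

definition diffeo :: "('m::topological_space, 'e::euclidean_space) chart set \<Rightarrow> ('m \<Rightarrow> 'm) \<Rightarrow> bool" where
  "diffeo A \<phi> \<longleftrightarrow> bij \<phi> \<and> smooth_map_on A UNIV \<phi> \<and> smooth_map_on A UNIV (inv \<phi>)"

definition local_diffeo ::
  "('m::topological_space, 'e::euclidean_space) chart set \<Rightarrow> ('m \<Rightarrow> 'm) \<Rightarrow> bool" where
  "local_diffeo A \<phi> \<longleftrightarrow>
     (\<forall>q. \<exists>U. q \<in> U \<and> inj_on \<phi> U \<and> smooth_map_on A U \<phi> \<and>
        smooth_map_on A (\<phi> ` U) (inv_into U \<phi>))"


section \<open>Tangent vectors, vector fields, and differential forms\<close>

text \<open>Tangent vectors at \<open>q\<close> are the directional derivatives in charts around \<open>q\<close>, acting on the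
  functions which are smooth near \<open>q\<close>; they take the value \<open>0\<close> on all other functions, so that
  equality of tangent vectors is equality of functionals.\<close>

type_synonym 'm tvec = "('m \<Rightarrow> real) \<Rightarrow> real"

definition tangent_space ::
  "('m::topological_space, 'e::euclidean_space) chart set \<Rightarrow> 'm \<Rightarrow> 'm tvec set" where
  "tangent_space A q =
     {v. \<exists>(U, x)\<in>A. q \<in> U \<and> (\<exists>w. v = (\<lambda>f. if smooth_near A q f
           then frechet_derivative (f \<circ> inv_into U x) (at (x q)) w else 0))}"

type_synonym 'm vfield = "'m \<Rightarrow> 'm tvec"

definition smooth_vfield_on ::
  "('m::topological_space, 'e::euclidean_space) chart set \<Rightarrow> 'm set \<Rightarrow> 'm vfield \<Rightarrow> bool" where
  "smooth_vfield_on A S X \<longleftrightarrow>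
     open S \<and> (\<forall>p\<in>S. X p \<in> tangent_space A p) \<and>
     (\<forall>V f. V \<subseteq> S \<and> smooth_fun_on A V f \<longrightarrow> smooth_fun_on A V (\<lambda>p. X p f))"

definition lie_bracket ::
  "('m::topological_space, 'e::euclidean_space) chart set \<Rightarrow> 'm vfield \<Rightarrow> 'm vfield \<Rightarrow> 'm vfield" where
  "lie_bracket A X Y q =
     (\<lambda>f. if smooth_near A q f then X q (\<lambda>p. Y p f) - Y q (\<lambda>p. X p f) else 0)"

text \<open>The differential of \<open>\<phi>\<close> at \<open>q\<close>.\<close>

definition pushforward ::
  "('m::topological_space, 'e::euclidean_space) chart set \<Rightarrow> ('m \<Rightarrow> 'm) \<Rightarrow> 'm \<Rightarrow> 'm tvec \<Rightarrow> 'm tvec" where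
  "pushforward A \<phi> q v = (\<lambda>f. if smooth_near A (\<phi> q) f then v (f \<circ> \<phi>) else 0)"

text \<open>\<open>n\<close>-forms, \<open>n = DIM('e)\<close>, are evaluated on lists of \<open>n\<close> tangent vectors; values on
  other lists are irrelevant.\<close>

type_synonym 'm form = "'m \<Rightarrow> 'm tvec list \<Rightarrow> real"

definition tangent_tuples ::
  "('m::topological_space, 'e::euclidean_space) chart set \<Rightarrow> 'm \<Rightarrow> 'm tvec list set" where
  "tangent_tuples A q = {vs. length vs = DIM('e) \<and> set vs \<subseteq> tangent_space A q}"

definition smooth_form ::
  "('m::topological_space, 'e::euclidean_space) chart set \<Rightarrow> 'm form \<Rightarrow> bool" where
  "smooth_form A \<omega> \<longleftrightarrow>
     (\<forall>q. \<forall>vs\<in>tangent_tuples A q. \<forall>i<DIM('e). \<forall>u\<in>tangent_space A q. \<forall>w\<in>tangent_space A q. \<forall>a b.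
        \<omega> q (vs[i := a *\<^sub>R u + b *\<^sub>R w]) = a * \<omega> q (vs[i := u]) + b * \<omega> q (vs[i := w])) \<and>
     (\<forall>q. \<forall>vs\<in>tangent_tuples A q. \<forall>i<DIM('e). \<forall>j<DIM('e).
        i \<noteq> j \<and> vs ! i = vs ! j \<longrightarrow> \<omega> q vs = 0) \<and>
     (\<forall>S Xs. open S \<and> length Xs = DIM('e) \<and> (\<forall>X\<in>set Xs. smooth_vfield_on A S X) \<longrightarrow>
        smooth_fun_on A S (\<lambda>p. \<omega> p (map (\<lambda>X. X p) Xs)))"

definition volume_form ::
  "('m::topological_space, 'e::euclidean_space) chart set \<Rightarrow> 'm form \<Rightarrow> bool" where
  "volume_form A \<omega> \<longleftrightarrow> smooth_form A \<omega> \<and> (\<forall>q. \<exists>vs\<in>tangent_tuples A q. \<omega> q vs \<noteq> 0)"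

definition pullback ::
  "('m::topological_space, 'e::euclidean_space) chart set \<Rightarrow> ('m \<Rightarrow> 'm) \<Rightarrow> 'm form \<Rightarrow> 'm form" where
  "pullback A \<phi> \<omega> q vs = \<omega> (\<phi> q) (map (pushforward A \<phi> q) vs)"

definition same_form ::
  "('m::topological_space, 'e::euclidean_space) chart set \<Rightarrow> 'm form \<Rightarrow> 'm form \<Rightarrow> bool" where
  "same_form A \<omega> \<eta> \<longleftrightarrow> (\<forall>q. \<forall>vs\<in>tangent_tuples A q. \<omega> q vs = \<eta> q vs)"

definition volume_preserving ::
  "('m::topological_space, 'e::euclidean_space) chart set \<Rightarrow> 'm form \<Rightarrow> ('m \<Rightarrow> 'm) \<Rightarrow> bool" where
  "volume_preserving A \<mu> \<phi> \<longleftrightarrow> local_diffeo A \<phi> \<and> same_form A (pullback A \<phi> \<mu>) \<mu>"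

text \<open>Orientations are given by volume forms, up to multiplication by positive functions. On a
  connected manifold it does not matter which volume form is used to test whether a map
  preserves orientation. Isometries of sub-Riemannian manifolds may reverse the orientation, for
  example \<open>(h, t) \<mapsto> (h, -t)\<close> on the product of the Heisenberg group with the line, where
  \<open>\<phi>\<^sup>*\<P> = -\<P>\<close>. Thus \<open>\<phi>\<^sup>*\<P> = \<P>\<close> is meant up to the sign ambiguity of \<open>\<P>\<close>.\<close>

definition orientable :: "('m::topological_space, 'e::euclidean_space) chart set \<Rightarrow> bool" where
  "orientable A \<longleftrightarrow> (\<exists>\<omega>. volume_form A \<omega>)"

definition orientation_preserving ::
  "('m::topological_space, 'e::euclidean_space) chart set \<Rightarrow> ('m \<Rightarrow> 'm) \<Rightarrow> bool" where
  "orientation_preserving A \<phi> \<longleftrightarrow>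
     (\<exists>\<omega>. volume_form A \<omega> \<and>
        (\<forall>q. \<exists>c>0. \<forall>vs\<in>tangent_tuples A q. pullback A \<phi> \<omega> q vs = c * \<omega> q vs))"


section \<open>Sub-Riemannian manifolds\<close>

definition local_section ::
  "('m::topological_space, 'e::euclidean_space) chart set \<Rightarrow> ('m \<Rightarrow> 'm tvec set) \<Rightarrow> 'm set \<Rightarrow> 'm vfield \<Rightarrow> bool"
where
  "local_section A D S X \<longleftrightarrow> smooth_vfield_on A S X \<and> (\<forall>p\<in>S. X p \<in> D p)"

definition distribution ::
  "('m::topological_space, 'e::euclidean_space) chart set \<Rightarrow> nat \<Rightarrow> ('m \<Rightarrow> 'm tvec set) \<Rightarrow> bool" where
  "distribution A k D \<longleftrightarrow>
     (\<forall>q. subspace (D q) \<and> D q \<subseteq> tangent_space A q \<and> dim (D q) = k) \<and>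
     (\<forall>q. \<exists>S Xs. open S \<and> q \<in> S \<and> length Xs = k \<and> (\<forall>X\<in>set Xs. smooth_vfield_on A S X) \<and>
        (\<forall>p\<in>S. D p = span ((\<lambda>X. X p) ` set Xs)))"

definition inner_product_on :: "'v::real_vector set \<Rightarrow> ('v \<Rightarrow> 'v \<Rightarrow> real) \<Rightarrow> bool" where
  "inner_product_on V B \<longleftrightarrow>
     (\<forall>u\<in>V. \<forall>v\<in>V. B u v = B v u) \<and>
     (\<forall>u\<in>V. \<forall>v\<in>V. \<forall>w\<in>V. \<forall>a b. B (a *\<^sub>R u + b *\<^sub>R v) w = a * B u w + b * B v w) \<and>
     (\<forall>v\<in>V. v \<noteq> 0 \<longrightarrow> B v v > 0)"

definition sub_riemannian_metric ::
  "('m::topological_space, 'e::euclidean_space) chart set \<Rightarrow> ('m \<Rightarrow> 'm tvec set) \<Rightarrow>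
   ('m \<Rightarrow> 'm tvec \<Rightarrow> 'm tvec \<Rightarrow> real) \<Rightarrow> bool" where
  "sub_riemannian_metric A D g \<longleftrightarrow>
     (\<forall>q. inner_product_on (D q) (g q)) \<and>
     (\<forall>S X Y. local_section A D S X \<and> local_section A D S Y \<longrightarrow>
        smooth_fun_on A S (\<lambda>p. g p (X p) (Y p)))"

text \<open>\<open>iter_bracket A [V\<^sub>1, \<dots>, V\<^sub>i] = [V\<^sub>1, [V\<^sub>2, \<dots>, [V\<^sub>i\<^sub>-\<^sub>1, V\<^sub>i]]]\<close>; the empty list does not matter.\<close>

fun iter_bracket ::
  "('m::topological_space, 'e::euclidean_space) chart set \<Rightarrow> 'm vfield list \<Rightarrow> 'm vfield" where
  "iter_bracket A [] = 0"
| "iter_bracket A [X] = X"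
| "iter_bracket A (X # Y # Xs) = lie_bracket A X (iter_bracket A (Y # Xs))"

definition sections_near ::
  "('m::topological_space, 'e::euclidean_space) chart set \<Rightarrow> ('m \<Rightarrow> 'm tvec set) \<Rightarrow> 'm \<Rightarrow> 'm vfield set" where
  "sections_near A D q = {X. \<exists>S. q \<in> S \<and> local_section A D S X}"

definition bracket_generating ::
  "('m::topological_space, 'e::euclidean_space) chart set \<Rightarrow> ('m \<Rightarrow> 'm tvec set) \<Rightarrow> bool" where
  "bracket_generating A D \<longleftrightarrow>
     (\<forall>q. span {iter_bracket A Vs q | Vs. Vs \<noteq> [] \<and> set Vs \<subseteq> sections_near A D q} = tangent_space A q)"

definition sub_riemannian_manifold ::
  "('m::{t2_space,second_countable_topology}, 'e::euclidean_space) chart set \<Rightarrow> nat \<Rightarrow>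
   ('m \<Rightarrow> 'm tvec set) \<Rightarrow> ('m \<Rightarrow> 'm tvec \<Rightarrow> 'm tvec \<Rightarrow> real) \<Rightarrow> bool" where
  "sub_riemannian_manifold A k D g \<longleftrightarrow>
     smooth_atlas A \<and> connected (UNIV :: 'm set) \<and> orientable A \<and>
     DIM('e) \<ge> 3 \<and> k < DIM('e) \<and>
     distribution A k D \<and> sub_riemannian_metric A D g \<and> bracket_generating A D"

text \<open>\<open>flag A D i q\<close> is \<open>\<D>\<^sup>i\<^sub>q\<close>.\<close>

fun flag ::
  "('m::topological_space, 'e::euclidean_space) chart set \<Rightarrow> ('m \<Rightarrow> 'm tvec set) \<Rightarrow> nat \<Rightarrow> 'm \<Rightarrow> 'm tvec set"
where
  "flag A D 0 = (\<lambda>q. {0})"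
| "flag A D (Suc 0) = D"
| "flag A D (Suc (Suc i)) = (\<lambda>q. span (flag A D (Suc i) q \<union>
     {lie_bracket A X Y q | X Y. X \<in> sections_near A (flag A D (Suc i)) q \<and> Y \<in> sections_near A D q}))"

definition equiregular ::
  "('m::topological_space, 'e::euclidean_space) chart set \<Rightarrow> ('m \<Rightarrow> 'm tvec set) \<Rightarrow> bool" where
  "equiregular A D \<longleftrightarrow> (\<forall>i. \<exists>d. \<forall>q. dim (flag A D i q) = d)"

definition sr_step ::
  "('m::topological_space, 'e::euclidean_space) chart set \<Rightarrow> ('m \<Rightarrow> 'm tvec set) \<Rightarrow> nat" where
  "sr_step A D = (LEAST m. \<forall>q. flag A D m q = tangent_space A q)"

definition sr_isometric ::
  "('m::topological_space, 'e::euclidean_space) chart set \<Rightarrow> ('m \<Rightarrow> 'm tvec set) \<Rightarrow>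
   ('m \<Rightarrow> 'm tvec \<Rightarrow> 'm tvec \<Rightarrow> real) \<Rightarrow> ('m \<Rightarrow> 'm) \<Rightarrow> bool" where
  "sr_isometric A D g \<phi> \<longleftrightarrow>
     (\<forall>q. pushforward A \<phi> q ` D q = D (\<phi> q)) \<and>
     (\<forall>q. \<forall>X\<in>D q. \<forall>Y\<in>D q. g (\<phi> q) (pushforward A \<phi> q X) (pushforward A \<phi> q Y) = g q X Y)"

definition sr_isometry ::
  "('m::topological_space, 'e::euclidean_space) chart set \<Rightarrow> ('m \<Rightarrow> 'm tvec set) \<Rightarrow>
   ('m \<Rightarrow> 'm tvec \<Rightarrow> 'm tvec \<Rightarrow> real) \<Rightarrow> ('m \<Rightarrow> 'm) \<Rightarrow> bool" where
  "sr_isometry A D g \<phi> \<longleftrightarrow> diffeo A \<phi> \<and> sr_isometric A D g \<phi>"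

definition sr_local_isometry ::
  "('m::topological_space, 'e::euclidean_space) chart set \<Rightarrow> ('m \<Rightarrow> 'm tvec set) \<Rightarrow>
   ('m \<Rightarrow> 'm tvec \<Rightarrow> 'm tvec \<Rightarrow> real) \<Rightarrow> ('m \<Rightarrow> 'm) \<Rightarrow> bool" where
  "sr_local_isometry A D g \<phi> \<longleftrightarrow> local_diffeo A \<phi> \<and> sr_isometric A D g \<phi>"


section \<open>Popp's volume\<close>

text \<open>Elements of a quotient \<open>V/W\<close> are cosets. For a list of cosets \<open>[A\<^sub>0, \<dots>]\<close> and scalars
  \<open>[c\<^sub>0, \<dots>]\<close>, this is the linear combination \<open>c\<^sub>0 A\<^sub>0 + \<dots>\<close> in the quotient by \<open>W\<close>; adding \<open>W\<close>
  is only necessary when all the scalars vanish.\<close>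

definition coset :: "'v::real_vector set \<Rightarrow> 'v \<Rightarrow> 'v set" where
  "coset W v = {v + w | w. w \<in> W}"

definition coset_comb :: "'v::real_vector set \<Rightarrow> real list \<Rightarrow> 'v set list \<Rightarrow> 'v set" where
  "coset_comb W cs As =
     {(\<Sum>j<length As. (cs ! j) *\<^sub>R a j) + w | a w. (\<forall>j<length As. a j \<in> As ! j) \<and> w \<in> W}"

text \<open>The quotient \<open>\<D>\<^sup>i\<^sub>q / \<D>\<^sup>i\<^sup>-\<^sup>1\<^sub>q\<close>, for \<open>i \<ge> 1\<close>.\<close>

definition flag_quot ::
  "('m::topological_space, 'e::euclidean_space) chart set \<Rightarrow> ('m \<Rightarrow> 'm tvec set) \<Rightarrow> 'm \<Rightarrow> nat \<Rightarrow> 'm tvec set set"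
where
  "flag_quot A D q i = coset (flag A D (i - 1) q) ` flag A D i q"

text \<open>A tensor \<open>\<Sum>\<^sub>a c\<^sub>a v\<^sub>a\<^sub>1 \<otimes> \<dots> \<otimes> v\<^sub>a\<^sub>i\<close> in \<open>\<otimes>\<^sup>i\<D>\<^sub>q\<close> is represented by the formal linear combination
  \<open>[(c\<^sub>a, [v\<^sub>a\<^sub>1, \<dots>, v\<^sub>a\<^sub>i]), \<dots>]\<close>. The induced inner product is determined by
  \<open>\<langle>v\<^sub>1 \<otimes> \<dots> \<otimes> v\<^sub>i, w\<^sub>1 \<otimes> \<dots> \<otimes> w\<^sub>i\<rangle> = \<Prod>\<^sub>j \<langle>v\<^sub>j, w\<^sub>j\<rangle>\<close>. Two formal combinations represent the same
  tensor iff their difference has norm \<open>0\<close>, so that the minimum in \<open>quot_norm\<close> is the same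
  over tensors and over formal combinations.\<close>

type_synonym 'm tensor = "(real \<times> 'm tvec list) list"

definition tensor_inner ::
  "('m \<Rightarrow> 'm tvec \<Rightarrow> 'm tvec \<Rightarrow> real) \<Rightarrow> 'm \<Rightarrow> nat \<Rightarrow> 'm tensor \<Rightarrow> 'm tensor \<Rightarrow> real" where
  "tensor_inner g q i s t =
     (\<Sum>(c, vs)\<leftarrow>s. \<Sum>(d, ws)\<leftarrow>t. c * d * (\<Prod>j<i. g q (vs ! j) (ws ! j)))"

definition tensor_norm ::
  "('m \<Rightarrow> 'm tvec \<Rightarrow> 'm tvec \<Rightarrow> real) \<Rightarrow> 'm \<Rightarrow> nat \<Rightarrow> 'm tensor \<Rightarrow> real" where
  "tensor_norm g q i s = sqrt (tensor_inner g q i s s)"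

text \<open>\<open>popp_pi A D q i s Y\<close> is the relation \<open>\<pi>\<^sub>i(s) = Y\<close>. The list \<open>Ss\<close> provides arbitrary local
  sections \<open>V\<^sub>a\<^sub>j\<close> of \<open>D\<close> extending the vectors \<open>v\<^sub>a\<^sub>j\<close> which occur in \<open>s\<close>.\<close>

definition popp_pi ::
  "('m::topological_space, 'e::euclidean_space) chart set \<Rightarrow> ('m \<Rightarrow> 'm tvec set) \<Rightarrow> 'm \<Rightarrow> nat \<Rightarrow>
   'm tensor \<Rightarrow> 'm tvec set \<Rightarrow> bool" where
  "popp_pi A D q i s Y \<longleftrightarrow>
     (\<exists>Ss :: (real \<times> 'm vfield list) list.
        (\<forall>(c, Vs)\<in>set Ss. length Vs = i \<and> set Vs \<subseteq> sections_near A D q) \<and>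
        s = map (\<lambda>(c, Vs). (c, map (\<lambda>V. V q) Vs)) Ss \<and>
        Y = coset (flag A D (i - 1) q) (\<Sum>(c, Vs)\<leftarrow>Ss. c *\<^sub>R iter_bracket A Vs q))"

definition quot_norm ::
  "('m::topological_space, 'e::euclidean_space) chart set \<Rightarrow> ('m \<Rightarrow> 'm tvec set) \<Rightarrow>
   ('m \<Rightarrow> 'm tvec \<Rightarrow> 'm tvec \<Rightarrow> real) \<Rightarrow> 'm \<Rightarrow> nat \<Rightarrow> 'm tvec set \<Rightarrow> real" where
  "quot_norm A D g q i Y = (LEAST r. \<exists>s. popp_pi A D q i s Y \<and> r = tensor_norm g q i s)"

text \<open>The inner product with this norm, by polarization.\<close>

definition quot_inner ::
  "('m::topological_space, 'e::euclidean_space) chart set \<Rightarrow> ('m \<Rightarrow> 'm tvec set) \<Rightarrow>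
   ('m \<Rightarrow> 'm tvec \<Rightarrow> 'm tvec \<Rightarrow> real) \<Rightarrow> 'm \<Rightarrow> nat \<Rightarrow> 'm tvec set \<Rightarrow> 'm tvec set \<Rightarrow> real" where
  "quot_inner A D g q i Y Z =
     ((quot_norm A D g q i (coset_comb (flag A D (i - 1) q) [1, 1] [Y, Z]))\<^sup>2 -
      (quot_norm A D g q i (coset_comb (flag A D (i - 1) q) [1, -1] [Y, Z]))\<^sup>2) / 4"

text \<open>An element of the direct sum \<open>gr\<^sub>q(\<D>)\<close> is the family of its components, indexed by
  \<open>1 \<le> i \<le> m\<close>.\<close>

type_synonym 'm gr_elem = "nat \<Rightarrow> 'm tvec set"

definition gr ::
  "('m::topological_space, 'e::euclidean_space) chart set \<Rightarrow> ('m \<Rightarrow> 'm tvec set) \<Rightarrow> 'm \<Rightarrow> 'm gr_elem set" where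
  "gr A D q = (\<Pi>\<^sub>E i\<in>{1..sr_step A D}. flag_quot A D q i)"

definition gr_comb ::
  "('m::topological_space, 'e::euclidean_space) chart set \<Rightarrow> ('m \<Rightarrow> 'm tvec set) \<Rightarrow> 'm \<Rightarrow>
   real list \<Rightarrow> 'm gr_elem list \<Rightarrow> 'm gr_elem" where
  "gr_comb A D q cs Ys =
     (\<lambda>i\<in>{1..sr_step A D}. coset_comb (flag A D (i - 1) q) cs (map (\<lambda>Y. Y i) Ys))"

definition gr_inner ::
  "('m::topological_space, 'e::euclidean_space) chart set \<Rightarrow> ('m \<Rightarrow> 'm tvec set) \<Rightarrow>
   ('m \<Rightarrow> 'm tvec \<Rightarrow> 'm tvec \<Rightarrow> real) \<Rightarrow> 'm \<Rightarrow> 'm gr_elem \<Rightarrow> 'm gr_elem \<Rightarrow> real" where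
  "gr_inner A D g q Y Z = (\<Sum>i=1..sr_step A D. quot_inner A D g q i (Y i) (Z i))"

definition gr_orthonormal_basis ::
  "('m::topological_space, 'e::euclidean_space) chart set \<Rightarrow> ('m \<Rightarrow> 'm tvec set) \<Rightarrow>
   ('m \<Rightarrow> 'm tvec \<Rightarrow> 'm tvec \<Rightarrow> real) \<Rightarrow> 'm \<Rightarrow> 'm gr_elem list \<Rightarrow> bool" where
  "gr_orthonormal_basis A D g q es \<longleftrightarrow>
     length es = DIM('e) \<and> set es \<subseteq> gr A D q \<and>
     (\<forall>Y\<in>gr A D q. \<exists>cs. length cs = DIM('e) \<and> Y = gr_comb A D q cs es) \<and>
     (\<forall>j<DIM('e). \<forall>l<DIM('e). gr_inner A D g q (es ! j) (es ! l) = (if j = l then 1 else 0))"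

definition gr_linear ::
  "('m::topological_space, 'e::euclidean_space) chart set \<Rightarrow> ('m \<Rightarrow> 'm tvec set) \<Rightarrow> 'm \<Rightarrow>
   ('m gr_elem \<Rightarrow> real) \<Rightarrow> bool" where
  "gr_linear A D q \<nu> \<longleftrightarrow>
     (\<forall>Y\<in>gr A D q. \<forall>Z\<in>gr A D q. \<forall>a b. \<nu> (gr_comb A D q [a, b] [Y, Z]) = a * \<nu> Y + b * \<nu> Z)"

definition gr_dual_basis ::
  "('m::topological_space, 'e::euclidean_space) chart set \<Rightarrow> ('m \<Rightarrow> 'm tvec set) \<Rightarrow> 'm \<Rightarrow>
   'm gr_elem list \<Rightarrow> ('m gr_elem \<Rightarrow> real) list \<Rightarrow> bool" where
  "gr_dual_basis A D q es \<nu>s \<longleftrightarrow>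
     length \<nu>s = length es \<and> (\<forall>\<nu>\<in>set \<nu>s. gr_linear A D q \<nu>) \<and>
     (\<forall>j<length es. \<forall>l<length es. (\<nu>s ! j) (es ! l) = (if j = l then 1 else 0))"

text \<open>The wedge product of linear functionals, as an alternating multilinear map.\<close>

definition wedge :: "('v \<Rightarrow> real) list \<Rightarrow> 'v list \<Rightarrow> real" where
  "wedge \<nu>s Ys =
     (\<Sum>\<sigma> | \<sigma> permutes {..<length \<nu>s}. of_int (sign \<sigma>) * (\<Prod>j<length \<nu>s. (\<nu>s ! \<sigma> j) (Ys ! j)))"

text \<open>The possible values of \<open>\<mu>\<^sub>q\<close>, over all choices of an orthonormal basis.\<close>

definition popp_mu ::
  "('m::topological_space, 'e::euclidean_space) chart set \<Rightarrow> ('m \<Rightarrow> 'm tvec set) \<Rightarrow>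
   ('m \<Rightarrow> 'm tvec \<Rightarrow> 'm tvec \<Rightarrow> real) \<Rightarrow> 'm \<Rightarrow> ('m gr_elem list \<Rightarrow> real) \<Rightarrow> bool" where
  "popp_mu A D g q \<mu> \<longleftrightarrow>
     (\<exists>es \<nu>s. gr_orthonormal_basis A D g q es \<and> gr_dual_basis A D q es \<nu>s \<and> \<mu> = wedge \<nu>s)"

definition adapted_basis ::
  "('m::topological_space, 'e::euclidean_space) chart set \<Rightarrow> ('m \<Rightarrow> 'm tvec set) \<Rightarrow> 'm \<Rightarrow> 'm tvec list \<Rightarrow> bool" where
  "adapted_basis A D q vs \<longleftrightarrow>
     length vs = DIM('e) \<and> distinct vs \<and> independent (set vs) \<and> span (set vs) = tangent_space A q \<and>
     (\<forall>i. span (set (take (dim (flag A D i q)) vs)) = flag A D i q)"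

text \<open>The tuple of the classes of \<open>v\<^sub>1, \<dots>, v\<^sub>n\<close> in \<open>gr\<^sub>q(\<D>)\<close>. List indices start at \<open>0\<close>, so \<open>v ! l\<close>
  has its class in degree \<open>i\<close> for \<open>k\<^sub>i\<^sub>-\<^sub>1 \<le> l < k\<^sub>i\<close>; its other components are zero cosets.\<close>

definition theta_hat ::
  "('m::topological_space, 'e::euclidean_space) chart set \<Rightarrow> ('m \<Rightarrow> 'm tvec set) \<Rightarrow> 'm \<Rightarrow>
   'm tvec list \<Rightarrow> 'm gr_elem list" where
  "theta_hat A D q vs =
     map (\<lambda>l. \<lambda>i\<in>{1..sr_step A D}.
            coset (flag A D (i - 1) q)
              (if dim (flag A D (i - 1) q) \<le> l \<and> l < dim (flag A D i q) then vs ! l else 0))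
       [0..<length vs]"

text \<open>\<open>P\<^sub>q = \<plusminus>\<mu>\<^sub>q \<circ> \<theta>\<^sub>q\<close> at every \<open>q\<close>, the sign being left open by the choice of \<open>\<mu>\<^sub>q\<close>. Smoothness
  of \<open>P\<close> makes the signs at different points match; on a connected orientable manifold this
  leaves exactly two forms \<open>P\<close> and \<open>-P\<close>, one for each orientation.\<close>

definition popp_volume ::
  "('m::topological_space, 'e::euclidean_space) chart set \<Rightarrow> ('m \<Rightarrow> 'm tvec set) \<Rightarrow>
   ('m \<Rightarrow> 'm tvec \<Rightarrow> 'm tvec \<Rightarrow> real) \<Rightarrow> 'm form \<Rightarrow> bool" where
  "popp_volume A D g P \<longleftrightarrow>
     smooth_form A P \<and>
     (\<forall>q. (\<exists>\<mu>. popp_mu A D g q \<mu>) \<and>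
          (\<forall>\<mu>. popp_mu A D g q \<mu> \<longrightarrow>
             (\<exists>\<epsilon>\<in>{1, -1}. \<forall>vs. adapted_basis A D q vs \<longrightarrow> P q vs = \<epsilon> * \<mu> (theta_hat A D q vs))))"

end

theory Submission
  imports Defs "Jordan_Normal_Form.Determinant"
begin

text \<open>
  Everything that enters the definition of Popp's volume at a point \<open>q\<close>, namely the flag, the
  maps \<open>\<pi>\<^sub>i\<close>, the quotient norms, the graded space and adapted bases, is built from Lie
  brackets of sections of \<open>D\<close> and from the metric. Lie brackets commute with local
  diffeomorphisms (\<open>pushforward_iter_bracket\<close>), and an isometry carries sections of \<open>D\<close> to
  sections of \<open>D\<close>. So the differential of a local isometry \<open>\<phi>\<close> transports the whole construction
  at \<open>q\<close> to the construction at \<open>\<phi> q\<close>. An orthonormal basis of the graded space goes to an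
  orthonormal basis, an adapted basis goes to an adapted basis, and since the choice of \<open>\<mu>\<close> only
  affects the sign, \<open>\<phi>\<^sup>*P = \<plusminus>P\<close> holds at every point (\<open>popp_volume_push\<close>).

  For the transport, a local diffeomorphism is always considered together with a local inverse.
  Each step is then proved as an inclusion, and the inverse provides the opposite inclusion.

  The remaining question is the sign. The form \<open>P\<close> does not vanish, because the wedge of a dual
  basis does not vanish on the classes of an adapted basis (\<open>popp_mu_nonzero\<close>), and adapted bases
  exist (\<open>adapted_basis_exists\<close>). Hence \<open>\<phi>\<^sup>*P = r P\<close> with a continuous function \<open>r\<close>
  (\<open>smooth_form_ratio\<close>), whose values are \<open>1\<close> and \<open>-1\<close>, so \<open>r\<close> is constant on the connected
  manifold. Comparing \<open>P\<close> with a volume form whose orientation \<open>\<phi>\<close> preserves shows that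
  the constant is \<open>1\<close> if such a volume form exists. Otherwise it is \<open>-1\<close>, since
  \<open>\<phi>\<^sup>*P = P\<close> would make \<open>P\<close> itself such a volume form.

  Analysis enters through the fact that Lie brackets of smooth vector fields are tangent vectors
  (\<open>lie_bracket_tangent\<close>), which comes down to Schwarz's theorem on mixed derivatives. It places
  the flag inside the tangent spaces, without which there would be no adapted bases.
\<close>

(* The bullet denotes the inner product of the model space. *)
no_notation Matrix.scalar_prod (infix "\<bullet>" 70)

section \<open>Differential calculus in normed spaces\<close>

lemma frechet_derivative_eqI:
  "(f has_derivative f') (at x) \<Longrightarrow> frechet_derivative f (at x) = f'"
  using frechet_derivative_at by metis

lemma frechet_derivative_cong_open:
  assumes "open S" "x \<in> S" "\<And>y. y \<in> S \<Longrightarrow> f y = g y"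
  shows "frechet_derivative f (at x) = frechet_derivative g (at x)"
proof -
  have "(f has_derivative D) (at x) \<longleftrightarrow> (g has_derivative D) (at x)" for D
    using has_derivative_transform_within_open[OF _ assms(1,2)] assms(3) by metis
  then show ?thesis unfolding frechet_derivative_def by simp
qed

lemma differentiable_cong_open:
  assumes "open S" "x \<in> S" "\<And>y. y \<in> S \<Longrightarrow> f y = g y" "f differentiable (at x)"
  shows "g differentiable (at x)"
  using has_derivative_transform_within_open[OF _ assms(1,2)] assms(3,4)
  unfolding differentiable_def by metis

lemma Ck_on_cong:
  assumes "open S" "\<And>x. x \<in> S \<Longrightarrow> f x = g x" "Ck_on k S f"
  shows "Ck_on k S g"
  using assms(2,3)
proof (induction k arbitrary: f g)
  case 0
  then show ?case by (metis Ck_on.simps(1) continuous_on_cong)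
next
  case (Suc k)
  have "g differentiable (at x)" if "x \<in> S" for x
    using differentiable_cong_open[OF assms(1) that Suc.prems(1)] Suc.prems(2) that by auto
  moreover have "Ck_on k S (\<lambda>x. frechet_derivative g (at x) v)" for v
  proof (rule Suc.IH)
    show "frechet_derivative f (at x) v = frechet_derivative g (at x) v" if "x \<in> S" for x
      using frechet_derivative_cong_open[OF assms(1) that, of f g] Suc.prems(1) by auto
    show "Ck_on k S (\<lambda>x. frechet_derivative f (at x) v)" using Suc.prems(2) by simp
  qed
  ultimately show ?case by simp
qed

lemma Ck_on_subset: "Ck_on k S f \<Longrightarrow> T \<subseteq> S \<Longrightarrow> Ck_on k T f"
  by (induction k arbitrary: f) (auto intro: continuous_on_subset)

lemma Ck_on_SucD: "Ck_on (Suc k) S f \<Longrightarrow> Ck_on k S f"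
proof (induction k arbitrary: f)
  case 0
  then show ?case
    by (auto simp: intro!: continuous_at_imp_continuous_on differentiable_imp_continuous_within)
next
  case (Suc k)
  then show ?case by (metis Ck_on.simps(2))
qed

lemma Ck_on_locally:
  assumes "\<And>x. x \<in> S \<Longrightarrow> \<exists>T. open T \<and> x \<in> T \<and> Ck_on k T f"
  shows "Ck_on k S f"
  using assms
proof (induction k arbitrary: f)
  case 0
  show ?case unfolding Ck_on.simps
  proof (rule continuous_at_imp_continuous_on, rule ballI)
    fix x assume "x \<in> S"
    then obtain T where "open T" "x \<in> T" "continuous_on T f" using 0 by auto
    then show "isCont f x" by (simp add: continuous_on_eq_continuous_at)
  qed
next
  case (Suc k)
  have "f differentiable (at x)" if "x \<in> S" for x using Suc.prems[OF that] by auto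
  moreover have "Ck_on k S (\<lambda>x. frechet_derivative f (at x) v)" for v
    using Suc.prems by (intro Suc.IH) (metis Ck_on.simps(2))
  ultimately show ?case by simp
qed

lemma Ck_on_const: "Ck_on k S (\<lambda>x. c)"
  by (induction k arbitrary: c) (simp_all add: frechet_derivative_eqI[OF has_derivative_const])

lemma Ck_on_bounded_linear:
  assumes "bounded_linear L" "open S" "Ck_on k S f"
  shows "Ck_on k S (\<lambda>x. L (f x))"
  using assms(3)
proof (induction k arbitrary: f)
  case 0
  then show ?case using assms(1)
    by (simp add: bounded_linear.continuous_on)
next
  case (Suc k)
  have d: "((\<lambda>x. L (f x)) has_derivative (\<lambda>v. L (frechet_derivative f (at x) v))) (at x)" if "x \<in> S" for x
    using Suc.prems that
    by (intro bounded_linear.has_derivative[OF assms(1)]) (simp add: frechet_derivative_works[symmetric])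
  have "Ck_on k S (\<lambda>x. frechet_derivative (\<lambda>x. L (f x)) (at x) v)" for v
  proof (rule Ck_on_cong[OF assms(2)])
    show "L (frechet_derivative f (at x) v) = frechet_derivative (\<lambda>x. L (f x)) (at x) v"
      if "x \<in> S" for x
      by (simp add: frechet_derivative_eqI[OF d[OF that]])
    show "Ck_on k S (\<lambda>x. L (frechet_derivative f (at x) v))"
      using Suc.prems by (intro Suc.IH) simp
  qed
  then show ?case using d by (auto simp: differentiable_def)
qed

lemma Ck_on_add:
  assumes "open S" "Ck_on k S f" "Ck_on k S g"
  shows "Ck_on k S (\<lambda>x. f x + g x)"
  using assms(2,3)
proof (induction k arbitrary: f g)
  case 0
  then show ?case by (simp add: continuous_on_add)
next
  case (Suc k)
  have d: "((\<lambda>x. f x + g x) has_derivative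
      (\<lambda>v. frechet_derivative f (at x) v + frechet_derivative g (at x) v)) (at x)" if "x \<in> S" for x
    using Suc.prems that by (intro has_derivative_add) (simp_all add: frechet_derivative_works[symmetric])
  have "Ck_on k S (\<lambda>x. frechet_derivative (\<lambda>x. f x + g x) (at x) v)" for v
  proof (rule Ck_on_cong[OF assms(1)])
    show "frechet_derivative f (at x) v + frechet_derivative g (at x) v =
      frechet_derivative (\<lambda>x. f x + g x) (at x) v" if "x \<in> S" for x
      by (simp add: frechet_derivative_eqI[OF d[OF that]])
    show "Ck_on k S (\<lambda>x. frechet_derivative f (at x) v + frechet_derivative g (at x) v)"
      by (rule Suc.IH) (use Suc.prems in simp_all)
  qed
  then show ?case using d by (auto simp: differentiable_def)
qed

lemma Ck_on_scaleR:
  assumes "open S" "Ck_on k S f" "Ck_on k S g"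
  shows "Ck_on k S (\<lambda>x. f x *\<^sub>R g x)"
  using assms(2,3)
proof (induction k arbitrary: f g)
  case 0
  then show ?case by (simp add: continuous_on_scaleR)
next
  case (Suc k)
  have d: "((\<lambda>x. f x *\<^sub>R g x) has_derivative
      (\<lambda>v. f x *\<^sub>R frechet_derivative g (at x) v + frechet_derivative f (at x) v *\<^sub>R g x)) (at x)"
    if "x \<in> S" for x
    using Suc.prems that by (intro has_derivative_scaleR) (simp_all add: frechet_derivative_works[symmetric])
  have "Ck_on k S (\<lambda>x. frechet_derivative (\<lambda>x. f x *\<^sub>R g x) (at x) v)" for v
  proof (rule Ck_on_cong[OF assms(1)])
    show "f x *\<^sub>R frechet_derivative g (at x) v + frechet_derivative f (at x) v *\<^sub>R g x =
      frechet_derivative (\<lambda>x. f x *\<^sub>R g x) (at x) v" if "x \<in> S" for x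
      by (simp add: frechet_derivative_eqI[OF d[OF that]])
    show "Ck_on k S (\<lambda>x. f x *\<^sub>R frechet_derivative g (at x) v + frechet_derivative f (at x) v *\<^sub>R g x)"
      using Suc.prems by (intro Ck_on_add[OF assms(1)] Suc.IH) (blast dest: Ck_on_SucD | simp)+
  qed
  then show ?case using d by (auto simp: differentiable_def)
qed

lemma Ck_on_sum:
  assumes "open S" "\<And>i. i \<in> I \<Longrightarrow> Ck_on k S (f i)"
  shows "Ck_on k S (\<lambda>x. \<Sum>i\<in>I. f i x)"
  using assms(2) by (induction I rule: infinite_finite_induct)
    (auto intro: Ck_on_const Ck_on_add[OF assms(1)])

text \<open>By the chain rule the derivative of \<open>g \<circ> f\<close> along \<open>v\<close> is
  \<open>\<Sum>\<^sub>b (Df v \<bullet> b) (\<partial>\<^sub>b g \<circ> f)\<close>, a combination to which the induction hypothesis applies; the sum over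
  a basis is the reason for the Euclidean space in the middle.\<close>

lemma Ck_on_compose:
  fixes f :: "'a::real_normed_vector \<Rightarrow> 'b::euclidean_space"
  assumes "open S" "open T" "f ` S \<subseteq> T" "Ck_on k S f" "Ck_on k T g"
  shows "Ck_on k S (\<lambda>x. g (f x))"
  using assms(4,5)
proof (induction k arbitrary: g)
  case 0
  then show ?case using assms(3) continuous_on_compose2[of T g S f] by simp
next
  case (Suc k)
  let ?D = "\<lambda>x. frechet_derivative f (at x)"
  have d: "((\<lambda>x. g (f x)) has_derivative (\<lambda>v. frechet_derivative g (at (f x)) (?D x v))) (at x)"
    if "x \<in> S" for x
    using Suc.prems that assms(3)
    by (intro has_derivative_compose[of f _ _ _ g]) (auto simp: frechet_derivative_works[symmetric])
  have "Ck_on k S (\<lambda>x. frechet_derivative (\<lambda>x. g (f x)) (at x) v)" for v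
  proof (rule Ck_on_cong[OF assms(1)])
    show "(\<Sum>b\<in>Basis. (?D x v \<bullet> b) *\<^sub>R frechet_derivative g (at (f x)) b) =
      frechet_derivative (\<lambda>x. g (f x)) (at x) v" if "x \<in> S" for x
    proof -
      have "linear (frechet_derivative g (at (f x)))"
        using Suc.prems(2) assms(3) that by (auto intro: linear_frechet_derivative)
      then have "frechet_derivative g (at (f x)) (\<Sum>b\<in>Basis. (?D x v \<bullet> b) *\<^sub>R b) =
          (\<Sum>b\<in>Basis. (?D x v \<bullet> b) *\<^sub>R frechet_derivative g (at (f x)) b)"
        by (simp add: linear_sum linear_cmul)
      then show ?thesis by (simp add: frechet_derivative_eqI[OF d[OF that]] euclidean_representation)
    qed
    show "Ck_on k S (\<lambda>x. \<Sum>b\<in>Basis. (?D x v \<bullet> b) *\<^sub>R frechet_derivative g (at (f x)) b)"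
    proof (intro Ck_on_sum[OF assms(1)] Ck_on_scaleR[OF assms(1)])
      fix b :: 'b
      show "Ck_on k S (\<lambda>x. ?D x v \<bullet> b)"
        using Suc.prems by (intro Ck_on_bounded_linear[OF bounded_linear_inner_left assms(1)]) simp
      show "Ck_on k S (\<lambda>x. frechet_derivative g (at (f x)) b)"
        using Suc.prems by (intro Suc.IH) (blast dest: Ck_on_SucD, simp)
    qed
  qed
  then show ?case using d by (auto simp: differentiable_def)
qed

lemma smooth_on_open: "smooth_on S f \<Longrightarrow> open S" by (simp add: smooth_on_def)

lemma smooth_on_cong:
  "smooth_on S f \<Longrightarrow> (\<And>x. x \<in> S \<Longrightarrow> f x = g x) \<Longrightarrow> smooth_on S g"
  unfolding smooth_on_def using Ck_on_cong by blast

lemma smooth_on_subset: "smooth_on S f \<Longrightarrow> open T \<Longrightarrow> T \<subseteq> S \<Longrightarrow> smooth_on T f"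
  unfolding smooth_on_def using Ck_on_subset by blast

lemma smooth_on_locally:
  assumes "\<And>x. x \<in> S \<Longrightarrow> \<exists>T. x \<in> T \<and> T \<subseteq> S \<and> smooth_on T f"
  shows "smooth_on S f"
proof -
  have "open S" unfolding open_subopen[of S] using assms unfolding smooth_on_def by blast
  moreover have "Ck_on k S f" for k
    by (rule Ck_on_locally) (use assms smooth_on_def in meson)
  ultimately show ?thesis by (simp add: smooth_on_def)
qed

lemma smooth_on_compose:
  fixes f :: "'a::real_normed_vector \<Rightarrow> 'b::euclidean_space"
  assumes "smooth_on S f" "smooth_on T g" "f ` S \<subseteq> T"
  shows "smooth_on S (g \<circ> f)"
  using assms Ck_on_compose[of S T f _ g] by (simp add: smooth_on_def o_def)

lemma smooth_on_inner_left: "smooth_on S f \<Longrightarrow> smooth_on S (\<lambda>x. f x \<bullet> b)"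
  by (simp add: smooth_on_def Ck_on_bounded_linear[OF bounded_linear_inner_left])

lemma smooth_on_differentiable: "smooth_on S f \<Longrightarrow> x \<in> S \<Longrightarrow> f differentiable (at x)"
  unfolding smooth_on_def by (metis Ck_on.simps(2))

lemma smooth_on_frechet_derivative:
  "smooth_on S f \<Longrightarrow> smooth_on S (\<lambda>x. frechet_derivative f (at x) v)"
  unfolding smooth_on_def by (metis Ck_on.simps(2))

lemma smooth_on_continuous: "smooth_on S f \<Longrightarrow> continuous_on S f"
  unfolding smooth_on_def by (metis Ck_on.simps(1))

text \<open>The mean value theorem is applied to the second difference along \<open>u\<close> first and along \<open>v\<close>
  next. The second difference is symmetric in \<open>u\<close> and \<open>v\<close>, so the other order of the directions
  gives the other mixed derivative.\<close>

lemma second_difference_mean_value: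
  fixes F :: "'a::real_normed_vector \<Rightarrow> real"
  assumes S: "\<And>a b. a \<in> {0..t} \<Longrightarrow> b \<in> {0..t} \<Longrightarrow> x + a *\<^sub>R u + b *\<^sub>R v \<in> S" and t: "0 < t"
    and F: "smooth_on S F"
  shows "\<exists>a\<in>{0..t}. \<exists>b\<in>{0..t}. F (x + t *\<^sub>R u + t *\<^sub>R v) - F (x + t *\<^sub>R u) - F (x + t *\<^sub>R v) + F x =
    t\<^sup>2 * frechet_derivative (\<lambda>y. frechet_derivative F (at y) u) (at (x + a *\<^sub>R u + b *\<^sub>R v)) v"
proof -
  let ?p = "\<lambda>a b. x + a *\<^sub>R u + b *\<^sub>R v"
  let ?Fu = "\<lambda>y. frechet_derivative F (at y) u"
  have Fu: "smooth_on S ?Fu" using F by (rule smooth_on_frechet_derivative)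
  have du: "((\<lambda>a. F (?p a b)) has_real_derivative ?Fu (?p a b)) (at a within {0..t})"
    if "a \<in> {0..t}" "b \<in> {0..t}" for a b
  proof -
    have "(F has_derivative frechet_derivative F (at (?p a b))) (at (?p a b))"
      using smooth_on_differentiable[OF F S[OF that]] frechet_derivative_works by blast
    moreover have "((\<lambda>a. ?p a b) has_derivative (\<lambda>h. h *\<^sub>R u)) (at a within {0..t})"
      by (auto intro!: derivative_eq_intros)
    ultimately have "((\<lambda>a. F (?p a b)) has_derivative
        (\<lambda>h. frechet_derivative F (at (?p a b)) (h *\<^sub>R u))) (at a within {0..t})"
      by (rule has_derivative_compose[rotated])
    then show ?thesis
      using linear_frechet_derivative[OF smooth_on_differentiable[OF F S[OF that]]]
      by (simp add: has_field_derivative_def linear_cmul mult_commute_abs)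
  qed
  have dv: "((\<lambda>b. ?Fu (?p a b)) has_real_derivative frechet_derivative ?Fu (at (?p a b)) v) (at b within {0..t})"
    if "a \<in> {0..t}" "b \<in> {0..t}" for a b
  proof -
    have "(?Fu has_derivative frechet_derivative ?Fu (at (?p a b))) (at (?p a b))"
      using smooth_on_differentiable[OF Fu S[OF that]] frechet_derivative_works by blast
    moreover have "((\<lambda>b. ?p a b) has_derivative (\<lambda>h. h *\<^sub>R v)) (at b within {0..t})"
      by (auto intro!: derivative_eq_intros)
    ultimately have "((\<lambda>b. ?Fu (?p a b)) has_derivative
        (\<lambda>h. frechet_derivative ?Fu (at (?p a b)) (h *\<^sub>R v))) (at b within {0..t})"
      by (rule has_derivative_compose[rotated])
    then show ?thesis
      using linear_frechet_derivative[OF smooth_on_differentiable[OF Fu S[OF that]]]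
      by (simp add: has_field_derivative_def linear_cmul mult_commute_abs)
  qed
  have "\<exists>a\<in>{0..t}. (F (?p t t) - F (?p t 0)) - (F (?p 0 t) - F (?p 0 0)) =
      (?Fu (?p a t) - ?Fu (?p a 0)) * (t - 0)"
  proof -
    have "\<exists>a\<in>{0..t}. (F (?p t t) - F (?p t 0)) - (F (?p 0 t) - F (?p 0 0)) =
      ((\<lambda>h. (?Fu (?p a t) - ?Fu (?p a 0)) * h) (t - 0))"
      by (rule mvt_very_simple[of 0 t "\<lambda>a. F (?p a t) - F (?p a 0)"])
         (use t du du[of _ 0] in \<open>auto intro!: has_derivative_diff simp: has_field_derivative_def left_diff_distrib\<close>)
    then show ?thesis by simp
  qed
  then obtain a where a: "a \<in> {0..t}" "(F (?p t t) - F (?p t 0)) - (F (?p 0 t) - F (?p 0 0)) =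
      (?Fu (?p a t) - ?Fu (?p a 0)) * t" by auto
  have "\<exists>b\<in>{0..t}. ?Fu (?p a t) - ?Fu (?p a 0) = ((\<lambda>h. frechet_derivative ?Fu (at (?p a b)) v * h) (t - 0))"
    by (rule mvt_very_simple[of 0 t "\<lambda>b. ?Fu (?p a b)"])
       (use t dv a in \<open>auto simp: has_field_derivative_def\<close>)
  then obtain b where b: "b \<in> {0..t}" "?Fu (?p a t) - ?Fu (?p a 0) = frechet_derivative ?Fu (at (?p a b)) v * t"
    by auto
  show ?thesis
    by (rule bexI[OF _ a(1)], rule bexI[OF _ b(1)]) (use a(2) b(2) in \<open>simp add: power2_eq_square algebra_simps\<close>)
qed

text \<open>Schwarz's theorem: both mixed derivatives are equal at points arbitrarily near to \<open>x\<close>, where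
  they are the same second difference divided by \<open>t\<^sup>2\<close>. Continuity does the rest.\<close>

lemma frechet_derivative_mixed_commute:
  fixes F :: "'a::real_normed_vector \<Rightarrow> real"
  assumes F: "smooth_on S F" and x: "x \<in> S"
  shows "frechet_derivative (\<lambda>y. frechet_derivative F (at y) u) (at x) v =
         frechet_derivative (\<lambda>y. frechet_derivative F (at y) v) (at x) u"
proof (rule ccontr)
  let ?G = "\<lambda>u v y. frechet_derivative (\<lambda>y. frechet_derivative F (at y) u) (at y) v"
  assume "?G u v x \<noteq> ?G v u x"
  then have e: "\<bar>?G u v x - ?G v u x\<bar> / 2 > 0" (is "?e > 0") by simp
  have cont: "continuous_on S (?G u v)" for u v
    using F by (intro smooth_on_continuous smooth_on_frechet_derivative)
  have opn: "open S" using F by (rule smooth_on_open)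
  have "\<exists>d>0. \<forall>y. dist y x < d \<longrightarrow> y \<in> S \<and> dist (?G u v y) (?G u v x) < ?e \<and> dist (?G v u y) (?G v u x) < ?e"
  proof -
    obtain d0 where "d0 > 0" "\<And>y. dist y x < d0 \<Longrightarrow> y \<in> S"
      using opn x unfolding open_dist by blast
    moreover obtain d1 where "d1 > 0" "\<And>y. y \<in> S \<Longrightarrow> dist y x < d1 \<Longrightarrow> dist (?G u v y) (?G u v x) < ?e"
      using cont[of u v] x e unfolding continuous_on_iff by blast
    moreover obtain d2 where "d2 > 0" "\<And>y. y \<in> S \<Longrightarrow> dist y x < d2 \<Longrightarrow> dist (?G v u y) (?G v u x) < ?e"
      using cont[of v u] x e unfolding continuous_on_iff by blast
    ultimately show ?thesis by (intro exI[of _ "min d0 (min d1 d2)"]) auto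
  qed
  then obtain d where d: "d > 0" and
    near: "\<And>y. dist y x < d \<Longrightarrow> y \<in> S \<and> dist (?G u v y) (?G u v x) < ?e \<and> dist (?G v u y) (?G v u x) < ?e"
    by blast
  \<comment> \<open>The parallelogram spanned by \<open>t u\<close> and \<open>t v\<close> at \<open>x\<close> lies in the ball of radius \<open>d\<close>.\<close>
  define t where "t = d / (norm u + norm v + 1) / 2"
  have t: "0 < t" "t * (norm u + norm v) < d"
  proof -
    show "0 < t" unfolding t_def using d by (auto intro!: divide_pos_pos add_nonneg_pos)
    have "t * (norm u + norm v) \<le> t * (norm u + norm v + 1)" using \<open>0 < t\<close> by simp
    also have "\<dots> = d / 2"
      unfolding t_def using add_nonneg_pos[of "norm u + norm v" 1] by (simp add: field_simps)
    finally show "t * (norm u + norm v) < d" using d by simp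
  qed
  have pt: "dist (x + a *\<^sub>R u + b *\<^sub>R v) x < d" if "a \<in> {0..t}" "b \<in> {0..t}" for a b
  proof -
    have "dist (x + a *\<^sub>R u + b *\<^sub>R v) x = norm (a *\<^sub>R u + b *\<^sub>R v)" by (simp add: dist_norm)
    also have "\<dots> \<le> a * norm u + b * norm v" using that norm_triangle_ineq[of "a *\<^sub>R u" "b *\<^sub>R v"] by simp
    also have "\<dots> \<le> t * norm u + t * norm v" using that by (intro add_mono mult_right_mono) auto
    finally show ?thesis using t by (simp add: algebra_simps)
  qed
  obtain a b where ab: "a \<in> {0..t}" "b \<in> {0..t}"
    "F (x + t *\<^sub>R u + t *\<^sub>R v) - F (x + t *\<^sub>R u) - F (x + t *\<^sub>R v) + F x = t\<^sup>2 * ?G u v (x + a *\<^sub>R u + b *\<^sub>R v)"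
    using second_difference_mean_value[of t x u v S F] pt near t(1) F by blast
  have pt': "x + a *\<^sub>R v + b *\<^sub>R u = x + b *\<^sub>R u + a *\<^sub>R v" for a b by (simp add: algebra_simps)
  obtain b' a' where ab': "a' \<in> {0..t}" "b' \<in> {0..t}"
    "F (x + t *\<^sub>R v + t *\<^sub>R u) - F (x + t *\<^sub>R v) - F (x + t *\<^sub>R u) + F x = t\<^sup>2 * ?G v u (x + a' *\<^sub>R u + b' *\<^sub>R v)"
    using second_difference_mean_value[of t x v u S F] pt near t(1) F unfolding pt' by blast
  have "t\<^sup>2 * ?G u v (x + a *\<^sub>R u + b *\<^sub>R v) = t\<^sup>2 * ?G v u (x + a' *\<^sub>R u + b' *\<^sub>R v)"
    using ab(3) ab'(3) unfolding pt'[of t t] by linarith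
  then have "?G u v (x + a *\<^sub>R u + b *\<^sub>R v) = ?G v u (x + a' *\<^sub>R u + b' *\<^sub>R v)" using t(1) by simp
  moreover have "dist (?G u v (x + a *\<^sub>R u + b *\<^sub>R v)) (?G u v x) < ?e"
    "dist (?G v u (x + a' *\<^sub>R u + b' *\<^sub>R v)) (?G v u x) < ?e"
    using near[OF pt[OF ab(1,2)]] near[OF pt[OF ab'(1,2)]] by auto
  ultimately show False unfolding dist_real_def by argo
qed

section \<open>Charts and tangent spaces\<close>

text \<open>The tangent vector with coordinates \<open>w\<close> in the chart \<open>(U, x)\<close>; for a basis vector \<open>w\<close> and
  varying \<open>q\<close> this is a coordinate vector field.\<close>

definition chart_vec ::
  "('m::topological_space, 'e::euclidean_space) chart set \<Rightarrow> 'm set \<Rightarrow> ('m \<Rightarrow> 'e) \<Rightarrow> 'm \<Rightarrow> 'e \<Rightarrow> 'm tvec" where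
  "chart_vec A U x q w = (\<lambda>f. if smooth_near A q f
     then frechet_derivative (f \<circ> inv_into U x) (at (x q)) w else 0)"

locale manifold_atlas =
  fixes A :: "('m::t2_space, 'e::euclidean_space) chart set"
  assumes atlas: "smooth_atlas A"
begin

lemma chart_open: "(U, x) \<in> A \<Longrightarrow> open U"
  and chart_homeomorphism: "(U, x) \<in> A \<Longrightarrow> homeomorphism U (x ` U) x (inv_into U x)"
  and chart_transition: "(U, x) \<in> A \<Longrightarrow> (V, y) \<in> A \<Longrightarrow> smooth_on (x ` (U \<inter> V)) (y \<circ> inv_into U x)"
  using atlas unfolding smooth_atlas_def by fast+

lemma chart_at: obtains U x where "(U, x) \<in> A" "q \<in> U"
proof -
  have "q \<in> (\<Union>(U, x)\<in>A. U)" using atlas unfolding smooth_atlas_def by simp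
  then show ?thesis using that by auto
qed

lemma chart_inv [simp]: "(U, x) \<in> A \<Longrightarrow> p \<in> U \<Longrightarrow> inv_into U x (x p) = p"
  using chart_homeomorphism homeomorphism_apply1 by metis

lemma chart_image_open:
  assumes "(U, x) \<in> A" "open W"
  shows "open (x ` (U \<inter> W))"
proof -
  have "open (x ` U)" using atlas assms(1) unfolding smooth_atlas_def by fast
  moreover have "continuous_on (x ` U) (inv_into U x)"
    using chart_homeomorphism[OF assms(1)] homeomorphism_cont2 by blast
  ultimately have "open (x ` U \<inter> inv_into U x -` W)"
    using continuous_open_preimage[of "x ` U" "inv_into U x" W] assms(2) by simp
  moreover have "x ` U \<inter> inv_into U x -` W = x ` (U \<inter> W)" using assms(1) by force
  ultimately show ?thesis by simp
qed

lemma smooth_fun_on_open: "smooth_fun_on A S f \<Longrightarrow> open S"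
  by (simp add: smooth_fun_on_def)

lemma smooth_fun_onD: "smooth_fun_on A S f \<Longrightarrow> (U, x) \<in> A \<Longrightarrow> smooth_on (x ` (U \<inter> S)) (f \<circ> inv_into U x)"
  unfolding smooth_fun_on_def by fast

text \<open>Transition maps are smooth, so a single chart around each point controls all the others.\<close>

lemma smooth_fun_onI_local:
  assumes "\<And>q. q \<in> S \<Longrightarrow> \<exists>U x W. (U, x) \<in> A \<and> q \<in> U \<and> q \<in> W \<and> open W \<and> W \<subseteq> S \<and>
    smooth_on (x ` (U \<inter> W)) (f \<circ> inv_into U x)"
  shows "smooth_fun_on A S f"
proof -
  have "open S" using assms unfolding open_subopen[of S] by meson
  moreover have "smooth_on (y ` (V \<inter> S)) (f \<circ> inv_into V y)" if V: "(V, y) \<in> A" for V y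
  proof (rule smooth_on_locally)
    fix z assume "z \<in> y ` (V \<inter> S)"
    then obtain p where p: "p \<in> V" "p \<in> S" "z = y p" by blast
    obtain U x W where W: "(U, x) \<in> A" "p \<in> U" "p \<in> W" "open W" "W \<subseteq> S"
      "smooth_on (x ` (U \<inter> W)) (f \<circ> inv_into U x)" using assms[OF p(2)] by blast
    let ?T = "y ` (V \<inter> (U \<inter> W))"
    have T: "open ?T" using chart_image_open[OF V] chart_open[OF W(1)] W(4) by blast
    have "smooth_on ?T (x \<circ> inv_into V y)"
      by (rule smooth_on_subset[OF chart_transition[OF V W(1)] T]) auto
    then have "smooth_on ?T ((f \<circ> inv_into U x) \<circ> (x \<circ> inv_into V y))"
      by (rule smooth_on_compose[OF _ W(6)]) (use V in auto)
    then have "smooth_on ?T (f \<circ> inv_into V y)"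
      by (rule smooth_on_cong) (use V W(1) in auto)
    then show "\<exists>T. z \<in> T \<and> T \<subseteq> y ` (V \<inter> S) \<and> smooth_on T (f \<circ> inv_into V y)"
      using p W by (intro exI[of _ ?T]) auto
  qed
  ultimately show ?thesis unfolding smooth_fun_on_def by auto
qed

lemma smooth_fun_on_subset:
  assumes "smooth_fun_on A S f" "open T" "T \<subseteq> S"
  shows "smooth_fun_on A T f"
  unfolding smooth_fun_on_def
proof (intro conjI ballI, rule assms(2), clarify)
  fix U x assume U: "(U, x) \<in> A"
  show "smooth_on (x ` (U \<inter> T)) (f \<circ> inv_into U x)"
    by (rule smooth_on_subset[OF smooth_fun_onD[OF assms(1) U] chart_image_open[OF U assms(2)]])
       (use assms(3) in auto)
qed

lemma smooth_fun_on_cong: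
  assumes "smooth_fun_on A S f" "\<And>p. p \<in> S \<Longrightarrow> f p = g p"
  shows "smooth_fun_on A S g"
  unfolding smooth_fun_on_def
proof (intro conjI ballI, rule smooth_fun_on_open[OF assms(1)], clarify)
  fix U x assume U: "(U, x) \<in> A"
  show "smooth_on (x ` (U \<inter> S)) (g \<circ> inv_into U x)"
    by (rule smooth_on_cong[OF smooth_fun_onD[OF assms(1) U]]) (use U assms(2) in auto)
qed

lemma smooth_fun_on_locally:
  assumes "\<And>q. q \<in> S \<Longrightarrow> \<exists>W. q \<in> W \<and> W \<subseteq> S \<and> smooth_fun_on A W f"
  shows "smooth_fun_on A S f"
proof (rule smooth_fun_onI_local)
  fix q assume "q \<in> S"
  then obtain W where W: "q \<in> W" "W \<subseteq> S" "smooth_fun_on A W f" using assms by blast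
  obtain U x where "(U, x) \<in> A" "q \<in> U" by (rule chart_at)
  then show "\<exists>U x W. (U, x) \<in> A \<and> q \<in> U \<and> q \<in> W \<and> open W \<and> W \<subseteq> S \<and>
      smooth_on (x ` (U \<inter> W)) (f \<circ> inv_into U x)"
    using W smooth_fun_onD[OF W(3)] smooth_fun_on_open[OF W(3)] by meson
qed

lemma smooth_fun_on_diff:
  assumes "smooth_fun_on A S f" "smooth_fun_on A S g"
  shows "smooth_fun_on A S (\<lambda>p. f p - g p)"
  unfolding smooth_fun_on_def
proof (intro conjI ballI, rule smooth_fun_on_open[OF assms(1)], clarify)
  fix U x assume U: "(U, x) \<in> A"
  note f = smooth_fun_onD[OF assms(1) U] and g = smooth_fun_onD[OF assms(2) U]
  have "Ck_on k (x ` (U \<inter> S)) (\<lambda>z. (f \<circ> inv_into U x) z + - (g \<circ> inv_into U x) z)" for k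
    using f g
    by (intro Ck_on_add Ck_on_bounded_linear[OF bounded_linear_minus[OF bounded_linear_ident]])
       (auto simp: smooth_on_def o_def)
  then show "smooth_on (x ` (U \<inter> S)) ((\<lambda>p. f p - g p) \<circ> inv_into U x)"
    using f by (simp add: smooth_on_def o_def)
qed

lemma smooth_fun_on_continuous:
  assumes "smooth_fun_on A S f"
  shows "continuous_on S f"
proof (rule continuous_at_imp_continuous_on, rule ballI)
  fix q assume q: "q \<in> S"
  obtain U x where U: "(U, x) \<in> A" "q \<in> U" by (rule chart_at)
  have "continuous_on (x ` (U \<inter> S)) (f \<circ> inv_into U x)"
    using smooth_fun_onD[OF assms U(1)] by (rule smooth_on_continuous)
  moreover have "continuous_on (U \<inter> S) x"
    using chart_homeomorphism[OF U(1)] homeomorphism_cont1 continuous_on_subset by blast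
  ultimately have "continuous_on (U \<inter> S) ((f \<circ> inv_into U x) \<circ> x)"
    by (rule continuous_on_compose[rotated])
  then have "continuous_on (U \<inter> S) f"
    by (rule continuous_on_eq) (use U(1) in auto)
  moreover have "open (U \<inter> S)" using chart_open[OF U(1)] smooth_fun_on_open[OF assms] by blast
  ultimately show "isCont f q" using q U(2) by (simp add: continuous_on_eq_continuous_at)
qed

lemma smooth_map_on_open: "smooth_map_on A S \<phi> \<Longrightarrow> open S"
  by (simp add: smooth_map_on_def)

lemma smooth_map_on_preimage_open: "smooth_map_on A S \<phi> \<Longrightarrow> open V \<Longrightarrow> open (S \<inter> \<phi> -` V)"
  unfolding smooth_map_on_def by (simp add: continuous_open_preimage)

lemma smooth_map_onD: "smooth_map_on A S \<phi> \<Longrightarrow> (U, x) \<in> A \<Longrightarrow> (V, y) \<in> A \<Longrightarrow>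
    smooth_on (x ` (S \<inter> U \<inter> \<phi> -` V)) (y \<circ> \<phi> \<circ> inv_into U x)"
  unfolding smooth_map_on_def by fast

lemma smooth_map_on_id: "smooth_map_on A UNIV id"
  unfolding smooth_map_on_def using chart_transition by (auto simp: o_def id_def)

lemma smooth_fun_on_compose:
  assumes "smooth_map_on A S \<phi>" "smooth_fun_on A V f"
  shows "smooth_fun_on A (S \<inter> \<phi> -` V) (f \<circ> \<phi>)"
proof (rule smooth_fun_onI_local)
  fix q assume q: "q \<in> S \<inter> \<phi> -` V"
  obtain U x where U: "(U, x) \<in> A" "q \<in> U" by (rule chart_at)
  obtain Y y where Y: "(Y, y) \<in> A" "\<phi> q \<in> Y" by (rule chart_at)
  let ?W = "S \<inter> \<phi> -` (V \<inter> Y)"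
  have W: "open ?W" using smooth_map_on_preimage_open[OF assms(1)] chart_open[OF Y(1)]
      smooth_fun_on_open[OF assms(2)] by blast
  have "smooth_on (x ` (U \<inter> ?W)) (y \<circ> \<phi> \<circ> inv_into U x)"
    by (rule smooth_on_subset[OF smooth_map_onD[OF assms(1) U(1) Y(1)] chart_image_open[OF U(1) W]]) auto
  then have "smooth_on (x ` (U \<inter> ?W)) ((f \<circ> inv_into Y y) \<circ> (y \<circ> \<phi> \<circ> inv_into U x))"
    by (rule smooth_on_compose[OF _ smooth_fun_onD[OF assms(2) Y(1)]]) (use U Y in auto)
  then have "smooth_on (x ` (U \<inter> ?W)) ((f \<circ> \<phi>) \<circ> inv_into U x)"
    by (rule smooth_on_cong) (use U Y in auto)
  then show "\<exists>U x W. (U, x) \<in> A \<and> q \<in> U \<and> q \<in> W \<and> open W \<and> W \<subseteq> S \<inter> \<phi> -` V \<and>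
      smooth_on (x ` (U \<inter> W)) ((f \<circ> \<phi>) \<circ> inv_into U x)"
    using U Y q W by (intro exI[of _ U] exI[of _ x] exI[of _ ?W]) auto
qed

lemma smooth_nearI: "smooth_fun_on A S f \<Longrightarrow> q \<in> S \<Longrightarrow> smooth_near A q f"
  unfolding smooth_near_def by blast

lemma smooth_near_cong:
  assumes "open W" "q \<in> W" "\<And>p. p \<in> W \<Longrightarrow> f p = g p" "smooth_near A q f"
  shows "smooth_near A q g"
proof -
  obtain S where S: "q \<in> S" "smooth_fun_on A S f" using assms(4) unfolding smooth_near_def by blast
  have "smooth_fun_on A (S \<inter> W) f"
    using S(2) assms(1) smooth_fun_on_open by (intro smooth_fun_on_subset[OF S(2)]) auto
  then have "smooth_fun_on A (S \<inter> W) g" by (rule smooth_fun_on_cong) (use assms(3) in auto)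
  then show ?thesis using S(1) assms(2) by (intro smooth_nearI[of "S \<inter> W"]) auto
qed

lemma smooth_near_compose:
  assumes "smooth_map_on A S \<phi>" "q \<in> S" "smooth_near A (\<phi> q) f"
  shows "smooth_near A q (f \<circ> \<phi>)"
proof -
  obtain V where "\<phi> q \<in> V" "smooth_fun_on A V f" using assms(3) unfolding smooth_near_def by blast
  then show ?thesis
    using smooth_fun_on_compose[OF assms(1)] assms(2) by (intro smooth_nearI[of "S \<inter> \<phi> -` V"]) auto
qed

lemma smooth_near_differentiable:
  assumes "smooth_near A q f" "(U, x) \<in> A" "q \<in> U"
  shows "(f \<circ> inv_into U x) differentiable (at (x q))"
proof -
  obtain S where S: "q \<in> S" "smooth_fun_on A S f" using assms(1) unfolding smooth_near_def by blast
  show ?thesis by (rule smooth_on_differentiable[OF smooth_fun_onD[OF S(2) assms(2)]]) (use S assms in auto)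
qed

lemma mem_tangent_space: "v \<in> tangent_space A q \<longleftrightarrow> (\<exists>U x w. (U, x) \<in> A \<and> q \<in> U \<and> v = chart_vec A U x q w)"
  unfolding tangent_space_def chart_vec_def by blast

lemma chart_vec_cong:
  assumes "(U, x) \<in> A" "q \<in> U" "open W" "q \<in> W" "\<And>p. p \<in> W \<Longrightarrow> f p = g p"
  shows "chart_vec A U x q w f = chart_vec A U x q w g"
proof -
  have "smooth_near A q f \<longleftrightarrow> smooth_near A q g"
    using smooth_near_cong[OF assms(3,4)] assms(5) by metis
  moreover have "frechet_derivative (f \<circ> inv_into U x) (at (x q)) = frechet_derivative (g \<circ> inv_into U x) (at (x q))"
    by (rule frechet_derivative_cong_open[OF chart_image_open[OF assms(1,3)]]) (use assms in auto)
  ultimately show ?thesis unfolding chart_vec_def by simp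
qed

text \<open>Tangent vectors depend on germs only. This is what makes arguments about functions which are
  smooth near a point, but arbitrary elsewhere, work without cut-off functions.\<close>

lemma tangent_local:
  assumes "v \<in> tangent_space A q" "open W" "q \<in> W" "\<And>p. p \<in> W \<Longrightarrow> f p = g p"
  shows "v f = v g"
  using assms chart_vec_cong[OF _ _ assms(2,3)] unfolding mem_tangent_space by blast

lemma tangent_not_smooth: "v \<in> tangent_space A q \<Longrightarrow> \<not> smooth_near A q f \<Longrightarrow> v f = 0"
  unfolding mem_tangent_space chart_vec_def by auto

text \<open>The chain rule in charts. For \<open>\<phi> = id\<close> it is the rule for a change of charts.\<close>

lemma pushforward_chart_vec:
  assumes \<phi>: "smooth_map_on A S \<phi>" "q \<in> S" and U: "(U, x) \<in> A" "q \<in> U" and V: "(V, y) \<in> A" "\<phi> q \<in> V"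
  shows "pushforward A \<phi> q (chart_vec A U x q w) =
    chart_vec A V y (\<phi> q) (frechet_derivative (y \<circ> \<phi> \<circ> inv_into U x) (at (x q)) w)"
proof
  fix f
  show "pushforward A \<phi> q (chart_vec A U x q w) f =
    chart_vec A V y (\<phi> q) (frechet_derivative (y \<circ> \<phi> \<circ> inv_into U x) (at (x q)) w) f"
  proof (cases "smooth_near A (\<phi> q) f")
    case True
    let ?F = "f \<circ> inv_into V y" and ?G = "y \<circ> \<phi> \<circ> inv_into U x"
    let ?W = "S \<inter> \<phi> -` V"
    have "open ?W" using smooth_map_on_preimage_open[OF \<phi>(1) chart_open[OF V(1)]] .
    then have "frechet_derivative ((f \<circ> \<phi>) \<circ> inv_into U x) (at (x q)) = frechet_derivative (?F \<circ> ?G) (at (x q))"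
      by (intro frechet_derivative_cong_open[OF chart_image_open[OF U(1)], of ?W]) (use \<phi> U V in auto)
    also have "\<dots> = frechet_derivative ?F (at (y (\<phi> q))) \<circ> frechet_derivative ?G (at (x q))"
    proof (rule frechet_derivative_eqI, rule diff_chain_at)
      have "?G differentiable (at (x q))"
        by (rule smooth_on_differentiable[OF smooth_map_onD[OF \<phi>(1) U(1) V(1)]]) (use \<phi> U V in auto)
      then show "(?G has_derivative frechet_derivative ?G (at (x q))) (at (x q))"
        by (simp add: frechet_derivative_works)
      have "(?F has_derivative frechet_derivative ?F (at (y (\<phi> q)))) (at (y (\<phi> q)))"
        using smooth_near_differentiable[OF True V] by (simp add: frechet_derivative_works)
      then show "(?F has_derivative frechet_derivative ?F (at (y (\<phi> q)))) (at (?G (x q)))"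
        using U by simp
    qed
    finally show ?thesis
      using True smooth_near_compose[OF \<phi> True] by (simp add: pushforward_def chart_vec_def)
  qed (simp add: pushforward_def chart_vec_def)
qed

lemma linear_pushforward: "linear (pushforward A \<phi> q)"
  by (rule linearI) (auto simp: pushforward_def fun_eq_iff scaleR_fun_def)

lemma pushforward_tangent:
  assumes "smooth_map_on A S \<phi>" "q \<in> S" "v \<in> tangent_space A q"
  shows "pushforward A \<phi> q v \<in> tangent_space A (\<phi> q)"
proof -
  obtain U x w where U: "(U, x) \<in> A" "q \<in> U" "v = chart_vec A U x q w"
    using assms(3) unfolding mem_tangent_space by blast
  obtain V y where V: "(V, y) \<in> A" "\<phi> q \<in> V" by (rule chart_at)
  show ?thesis using pushforward_chart_vec[OF assms(1,2) U(1,2) V] V U(3) unfolding mem_tangent_space by blast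
qed

lemma pushforward_id:
  assumes "v \<in> tangent_space A q"
  shows "pushforward A id q v = v"
  using tangent_not_smooth[OF assms] by (auto simp: pushforward_def fun_eq_iff)

text \<open>A change of charts brings every tangent vector into one fixed chart.\<close>

lemma tangent_space_eq_range:
  assumes "(U, x) \<in> A" "q \<in> U"
  shows "tangent_space A q = range (chart_vec A U x q)"
proof
  show "range (chart_vec A U x q) \<subseteq> tangent_space A q" using assms mem_tangent_space by blast
  show "tangent_space A q \<subseteq> range (chart_vec A U x q)"
  proof
    fix v assume v: "v \<in> tangent_space A q"
    then obtain V y w where V: "(V, y) \<in> A" "q \<in> V" "v = chart_vec A V y q w"
      unfolding mem_tangent_space by blast
    then have "v = pushforward A id q (chart_vec A V y q w)" using pushforward_id[OF v] by simp
    then show "v \<in> range (chart_vec A U x q)"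
      using pushforward_chart_vec[OF smooth_map_on_id _ V(1,2) assms(1)] assms(2) by auto
  qed
qed

lemma linear_chart_vec:
  assumes "(U, x) \<in> A" "q \<in> U"
  shows "linear (chart_vec A U x q)"
proof (rule linearI)
  fix v w :: 'e and c :: real
  have lin: "linear (frechet_derivative (f \<circ> inv_into U x) (at (x q)))" if "smooth_near A q f" for f
    using smooth_near_differentiable[OF that assms] by (rule linear_frechet_derivative)
  show "chart_vec A U x q (v + w) = chart_vec A U x q v + chart_vec A U x q w"
    by (auto simp: chart_vec_def fun_eq_iff linear_add[OF lin])
  show "chart_vec A U x q (c *\<^sub>R v) = c *\<^sub>R chart_vec A U x q v"
    by (auto simp: chart_vec_def fun_eq_iff scaleR_fun_def linear_cmul[OF lin])
qed

lemma subspace_tangent_space: "subspace (tangent_space A q)"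
  using chart_at[of q] tangent_space_eq_range linear_chart_vec linear_subspace_image subspace_UNIV
  by metis

lemma smooth_fun_on_coordinate:
  assumes U: "(U, x) \<in> A"
  shows "smooth_fun_on A U (\<lambda>p. x p \<bullet> b)"
  unfolding smooth_fun_on_def
proof (intro conjI ballI, rule chart_open[OF U], clarify)
  fix V y assume V: "(V, y) \<in> A"
  show "smooth_on (y ` (V \<inter> U)) ((\<lambda>p. x p \<bullet> b) \<circ> inv_into V y)"
    using smooth_on_inner_left[OF chart_transition[OF V U], of b] by (simp add: o_def)
qed

text \<open>The coordinate functions recover \<open>w\<close>. Hence \<open>w\<close> is determined by the tangent vector, and the
  tangent space has the dimension of the model space.\<close>

lemma chart_vec_coordinate:
  assumes U: "(U, x) \<in> A" "q \<in> U"
  shows "chart_vec A U x q w (\<lambda>p. x p \<bullet> b) = w \<bullet> b"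
proof -
  have "frechet_derivative ((\<lambda>p. x p \<bullet> b) \<circ> inv_into U x) (at (x q)) = frechet_derivative (\<lambda>z. z \<bullet> b) (at (x q))"
    by (rule frechet_derivative_cong_open[OF chart_image_open[OF U(1) chart_open[OF U(1)]]]) (use U in auto)
  also have "\<dots> = (\<lambda>z. z \<bullet> b)"
    by (rule frechet_derivative_eqI) (auto intro!: derivative_eq_intros)
  finally show ?thesis
    using smooth_nearI[OF smooth_fun_on_coordinate[OF U(1)] U(2)] by (simp add: chart_vec_def)
qed

lemma inj_chart_vec:
  assumes "(U, x) \<in> A" "q \<in> U"
  shows "inj (chart_vec A U x q)"
  by (rule injI, rule euclidean_eqI) (metis chart_vec_coordinate[OF assms])

lemma chart_vec_basis:
  assumes "(U, x) \<in> A" "q \<in> U"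
  shows "independent (chart_vec A U x q ` Basis)" "span (chart_vec A U x q ` Basis) = tangent_space A q"
    "inj_on (chart_vec A U x q) Basis"
proof -
  note lin = linear_chart_vec[OF assms]
  show "independent (chart_vec A U x q ` Basis)"
    using linear_independent_injective_image[OF lin independent_Basis] inj_chart_vec[OF assms] by simp
  show "span (chart_vec A U x q ` Basis) = tangent_space A q"
    by (simp add: linear_span_image[OF lin] tangent_space_eq_range[OF assms])
  show "inj_on (chart_vec A U x q) Basis" using inj_chart_vec[OF assms] inj_on_subset by blast
qed

lemma dim_tangent_space: "dim (tangent_space A q) = DIM('e)"
proof -
  obtain U x where U: "(U, x) \<in> A" "q \<in> U" by (rule chart_at)
  show ?thesis
    using dim_span_eq_card_independent[OF chart_vec_basis(1)[OF U]] chart_vec_basis(2,3)[OF U]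
    by (simp add: card_image)
qed

end

section \<open>Vector fields and Lie brackets\<close>

context manifold_atlas
begin

text \<open>The coefficients of a tangent vector are its values on the coordinate functions.\<close>

lemma tangent_expansion:
  assumes U: "(U, x) \<in> A" "q \<in> U" and v: "v \<in> tangent_space A q" and f: "smooth_near A q f"
  shows "v f = (\<Sum>b\<in>Basis. v (\<lambda>p. x p \<bullet> b) * frechet_derivative (f \<circ> inv_into U x) (at (x q)) b)"
proof -
  obtain w where w: "v = chart_vec A U x q w" using v tangent_space_eq_range[OF U] by blast
  have lin: "linear (frechet_derivative (f \<circ> inv_into U x) (at (x q)))"
    using smooth_near_differentiable[OF f U] by (rule linear_frechet_derivative)
  have "v f = frechet_derivative (f \<circ> inv_into U x) (at (x q)) (\<Sum>b\<in>Basis. (w \<bullet> b) *\<^sub>R b)"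
    using f by (simp add: w chart_vec_def euclidean_representation)
  also have "\<dots> = (\<Sum>b\<in>Basis. (w \<bullet> b) * frechet_derivative (f \<circ> inv_into U x) (at (x q)) b)"
    by (simp add: linear_sum[OF lin] linear_cmul[OF lin])
  finally show ?thesis by (simp add: w chart_vec_coordinate[OF U])
qed

lemma vfield_tangent: "smooth_vfield_on A S X \<Longrightarrow> p \<in> S \<Longrightarrow> X p \<in> tangent_space A p"
  and vfield_open: "smooth_vfield_on A S X \<Longrightarrow> open S"
  and vfield_smooth: "smooth_vfield_on A S X \<Longrightarrow> V \<subseteq> S \<Longrightarrow> smooth_fun_on A V f \<Longrightarrow> smooth_fun_on A V (\<lambda>p. X p f)"
  unfolding smooth_vfield_on_def by blast+

lemma vfield_subset: "smooth_vfield_on A S X \<Longrightarrow> open T \<Longrightarrow> T \<subseteq> S \<Longrightarrow> smooth_vfield_on A T X"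
  unfolding smooth_vfield_on_def by (meson order_trans subset_iff)

lemma vfield_near:
  assumes "smooth_vfield_on A S X" "q \<in> S" "smooth_near A q f"
  obtains V where "open V" "q \<in> V" "V \<subseteq> S" "smooth_fun_on A V f" "smooth_fun_on A V (\<lambda>p. X p f)"
proof -
  obtain V where V: "q \<in> V" "smooth_fun_on A V f" using assms(3) unfolding smooth_near_def by blast
  have o: "open (V \<inter> S)" using smooth_fun_on_open[OF V(2)] vfield_open[OF assms(1)] by blast
  have "smooth_fun_on A (V \<inter> S) f" by (rule smooth_fun_on_subset[OF V(2) o]) auto
  then show ?thesis using that[OF o] V(1) assms(2) vfield_smooth[OF assms(1)] by blast
qed

text \<open>The product rule for \<open>Y f = \<Sum>\<^sub>b (Y x\<^sub>b) (\<partial>\<^sub>b f)\<close>. Second derivatives of \<open>f\<close> occur only in the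
  first sum, which by Schwarz's theorem does not change when \<open>X\<close> and \<open>Y\<close> are exchanged.\<close>

lemma vfield_vfield_expansion:
  assumes X: "smooth_vfield_on A S X" and Y: "smooth_vfield_on A S Y" and q: "q \<in> S"
    and U: "(U, x) \<in> A" "q \<in> U" and f: "smooth_near A q f"
  defines "F \<equiv> f \<circ> inv_into U x"
  shows "X q (\<lambda>p. Y p f) =
    (\<Sum>b\<in>Basis. \<Sum>a\<in>Basis. Y q (\<lambda>p. x p \<bullet> b) * X q (\<lambda>p. x p \<bullet> a) *
        frechet_derivative (\<lambda>z. frechet_derivative F (at z) b) (at (x q)) a) +
    (\<Sum>b\<in>Basis. X q (\<lambda>p. Y p (\<lambda>p. x p \<bullet> b)) * frechet_derivative F (at (x q)) b)"
proof -
  let ?x = "\<lambda>b p. x p \<bullet> b" and ?D = "\<lambda>F z. frechet_derivative F (at z)"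
  obtain V where V: "open V" "q \<in> V" "V \<subseteq> S" "smooth_fun_on A V f" "smooth_fun_on A V (\<lambda>p. Y p f)"
    using vfield_near[OF Y q f] by blast
  let ?W = "U \<inter> V"
  have W: "open ?W" using chart_open[OF U(1)] V(1) by blast
  have zW: "x q \<in> x ` ?W" using U V by auto
  have FW: "smooth_on (x ` ?W) F" unfolding F_def by (rule smooth_fun_onD[OF V(4) U(1)])
  have xW: "smooth_fun_on A ?W (?x b)" for b
    by (rule smooth_fun_on_subset[OF smooth_fun_on_coordinate[OF U(1)] W]) auto
  have YxW: "smooth_fun_on A ?W (\<lambda>p. Y p (?x b))" for b
    by (rule vfield_smooth[OF Y _ xW]) (use V in auto)
  let ?B = "\<lambda>b. (\<lambda>p. Y p (?x b)) \<circ> inv_into U x"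
  have BW: "smooth_on (x ` ?W) (?B b)" for b
    using smooth_fun_onD[OF YxW U(1)] by (simp add: Int_left_absorb)
  have Yf: "((\<lambda>p. Y p f) \<circ> inv_into U x) z = (\<Sum>b\<in>Basis. ?B b z * ?D F z b)" if "z \<in> x ` ?W" for z
  proof -
    obtain p where p: "p \<in> U" "p \<in> V" "z = x p" using \<open>z \<in> x ` ?W\<close> by blast
    then show ?thesis
      using tangent_expansion[OF U(1) p(1) vfield_tangent[OF Y] smooth_nearI[OF V(4)]] V(3) U(1)
      by (auto simp: F_def)
  qed
  have DYf: "?D ((\<lambda>p. Y p f) \<circ> inv_into U x) (x q) a =
      (\<Sum>b\<in>Basis. Y q (?x b) * ?D (\<lambda>z. ?D F z b) (x q) a + ?D (?B b) (x q) a * ?D F (x q) b)" for a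
  proof -
    have "?D ((\<lambda>p. Y p f) \<circ> inv_into U x) (x q) = ?D (\<lambda>z. \<Sum>b\<in>Basis. ?B b z * ?D F z b) (x q)"
      by (rule frechet_derivative_cong_open[OF chart_image_open[OF U(1) V(1)] zW Yf])
    also have "\<dots> = (\<lambda>a. \<Sum>b\<in>Basis. ?B b (x q) * ?D (\<lambda>z. ?D F z b) (x q) a + ?D (?B b) (x q) a * ?D F (x q) b)"
    proof (rule frechet_derivative_eqI, rule has_derivative_sum, rule has_derivative_mult)
      fix b
      show "(?B b has_derivative ?D (?B b) (x q)) (at (x q))"
        using smooth_on_differentiable[OF BW zW] by (simp add: frechet_derivative_works)
      show "((\<lambda>z. ?D F z b) has_derivative ?D (\<lambda>z. ?D F z b) (x q)) (at (x q))"
        using smooth_on_differentiable[OF smooth_on_frechet_derivative[OF FW] zW]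
        by (simp add: frechet_derivative_works)
    qed
    finally show ?thesis using U by (simp add: o_def)
  qed
  have "X q (\<lambda>p. Y p f) = (\<Sum>a\<in>Basis. X q (?x a) * ?D ((\<lambda>p. Y p f) \<circ> inv_into U x) (x q) a)"
    by (rule tangent_expansion[OF U vfield_tangent[OF X q] smooth_nearI[OF V(5,2)]])
  also have "\<dots> = (\<Sum>a\<in>Basis. \<Sum>b\<in>Basis. Y q (?x b) * X q (?x a) * ?D (\<lambda>z. ?D F z b) (x q) a) +
      (\<Sum>a\<in>Basis. \<Sum>b\<in>Basis. X q (?x a) * ?D (?B b) (x q) a * ?D F (x q) b)"
    unfolding DYf sum_distrib_left sum.distrib[symmetric]
    by (intro sum.cong refl) (simp add: algebra_simps)
  also have "(\<Sum>a\<in>Basis. \<Sum>b\<in>Basis. X q (?x a) * ?D (?B b) (x q) a * ?D F (x q) b) =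
      (\<Sum>b\<in>Basis. (\<Sum>a\<in>Basis. X q (?x a) * ?D (?B b) (x q) a) * ?D F (x q) b)"
    unfolding sum_distrib_right by (rule sum.swap)
  also have "\<dots> = (\<Sum>b\<in>Basis. X q (\<lambda>p. Y p (?x b)) * ?D F (x q) b)"
    using tangent_expansion[OF U vfield_tangent[OF X q] smooth_nearI[OF YxW]] U V by simp
  also have "(\<Sum>a\<in>Basis. \<Sum>b\<in>Basis. Y q (?x b) * X q (?x a) * ?D (\<lambda>z. ?D F z b) (x q) a) =
      (\<Sum>b\<in>Basis. \<Sum>a\<in>Basis. Y q (?x b) * X q (?x a) * ?D (\<lambda>z. ?D F z b) (x q) a)"
    by (rule sum.swap)
  finally show ?thesis .
qed

text \<open>The second derivatives in \<open>X (Y f) - Y (X f)\<close> cancel, and a directional derivative with the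
  coefficients \<open>X (Y x\<^sub>b) - Y (X x\<^sub>b)\<close> is left.\<close>

lemma lie_bracket_tangent:
  assumes X: "smooth_vfield_on A S X" and Y: "smooth_vfield_on A S Y" and q: "q \<in> S"
  shows "lie_bracket A X Y q \<in> tangent_space A q"
proof -
  obtain U x where U: "(U, x) \<in> A" "q \<in> U" by (rule chart_at)
  let ?x = "\<lambda>b p. x p \<bullet> b"
  let ?c = "\<lambda>b. X q (\<lambda>p. Y p (?x b)) - Y q (\<lambda>p. X p (?x b))"
  have "lie_bracket A X Y q = chart_vec A U x q (\<Sum>b\<in>Basis. ?c b *\<^sub>R b)"
  proof
    fix f
    show "lie_bracket A X Y q f = chart_vec A U x q (\<Sum>b\<in>Basis. ?c b *\<^sub>R b) f"
    proof (cases "smooth_near A q f")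
      case True
      let ?F = "f \<circ> inv_into U x"
      let ?DD = "\<lambda>b a. frechet_derivative (\<lambda>z. frechet_derivative ?F (at z) b) (at (x q)) a"
      obtain V where V: "q \<in> V" "smooth_fun_on A V f" using True unfolding smooth_near_def by blast
      have sym: "?DD b a = ?DD a b" for a b
        by (rule frechet_derivative_mixed_commute[OF smooth_fun_onD[OF V(2) U(1)]]) (use U V in auto)
      have "(\<Sum>b\<in>Basis. \<Sum>a\<in>Basis. Y q (?x b) * X q (?x a) * ?DD b a) =
          (\<Sum>b\<in>Basis. \<Sum>a\<in>Basis. X q (?x b) * Y q (?x a) * ?DD b a)"
        by (subst sum.swap) (simp add: sym mult.commute)
      then have "X q (\<lambda>p. Y p f) - Y q (\<lambda>p. X p f) =
          (\<Sum>b\<in>Basis. ?c b * frechet_derivative ?F (at (x q)) b)"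
        unfolding vfield_vfield_expansion[OF X Y q U True] vfield_vfield_expansion[OF Y X q U True]
        by (simp add: sum_subtractf left_diff_distrib)
      moreover have "linear (frechet_derivative ?F (at (x q)))"
        using smooth_near_differentiable[OF True U] by (rule linear_frechet_derivative)
      ultimately show ?thesis
        using True by (simp add: lie_bracket_def chart_vec_def linear_sum linear_cmul)
    qed (simp add: lie_bracket_def chart_vec_def)
  qed
  then show ?thesis using mem_tangent_space U by blast
qed

lemma lie_bracket_smooth:
  assumes X: "smooth_vfield_on A S X" and Y: "smooth_vfield_on A S Y"
  shows "smooth_vfield_on A S (lie_bracket A X Y)"
  unfolding smooth_vfield_on_def
proof (intro conjI ballI allI impI)
  show "open S" by (rule vfield_open[OF X])
  show "lie_bracket A X Y p \<in> tangent_space A p" if "p \<in> S" for p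
    by (rule lie_bracket_tangent[OF X Y that])
  fix V f assume V: "V \<subseteq> S \<and> smooth_fun_on A V f"
  have "smooth_fun_on A V (\<lambda>p. X p (\<lambda>p. Y p f) - Y p (\<lambda>p. X p f))"
    using V vfield_smooth[OF X] vfield_smooth[OF Y] by (intro smooth_fun_on_diff) blast+
  then show "smooth_fun_on A V (\<lambda>p. lie_bracket A X Y p f)"
    by (rule smooth_fun_on_cong) (use V smooth_nearI in \<open>auto simp: lie_bracket_def\<close>)
qed

lemma iter_bracket_smooth:
  assumes "Vs \<noteq> []" "\<And>V. V \<in> set Vs \<Longrightarrow> smooth_vfield_on A S V"
  shows "smooth_vfield_on A S (iter_bracket A Vs)"
  using assms by (induction Vs rule: induct_list012) (auto intro: lie_bracket_smooth)

lemma sections_near_common: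
  assumes "finite \<X>" "\<X> \<subseteq> sections_near A D q"
  obtains S where "open S" "q \<in> S" "\<And>X. X \<in> \<X> \<Longrightarrow> local_section A D S X"
proof -
  have "\<forall>X\<in>\<X>. \<exists>S. q \<in> S \<and> local_section A D S X" using assms(2) unfolding sections_near_def by blast
  then obtain T where T: "\<And>X. X \<in> \<X> \<Longrightarrow> q \<in> T X \<and> local_section A D (T X) X" by metis
  have o: "open (\<Inter>X\<in>\<X>. T X)"
    using assms(1) T vfield_open by (intro open_INT) (auto simp: local_section_def)
  show ?thesis
  proof (rule that[OF o])
    show "q \<in> (\<Inter>X\<in>\<X>. T X)" using T by blast
    show "local_section A D (\<Inter>X\<in>\<X>. T X) X" if "X \<in> \<X>" for X
      using T[OF that] vfield_subset[OF _ o, of "T X" X] that unfolding local_section_def by blast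
  qed
qed

section \<open>Transport of vector fields\<close>

text \<open>A diffeomorphism between open sets together with its inverse. The roles of \<open>\<phi>\<close> and \<open>\<psi>\<close> are
  symmetric, so that every inclusion or implication about \<open>\<phi>\<close> yields its converse by means of \<open>\<psi>\<close>.\<close>

definition diffeo_between :: "('m \<Rightarrow> 'm) \<Rightarrow> 'm set \<Rightarrow> ('m \<Rightarrow> 'm) \<Rightarrow> 'm set \<Rightarrow> bool" where
  "diffeo_between \<phi> U \<psi> U' \<longleftrightarrow> smooth_map_on A U \<phi> \<and> smooth_map_on A U' \<psi> \<and>
     (\<forall>p\<in>U. \<phi> p \<in> U' \<and> \<psi> (\<phi> p) = p) \<and> (\<forall>p\<in>U'. \<psi> p \<in> U \<and> \<phi> (\<psi> p) = p)"

lemma diffeo_between_sym: "diffeo_between \<phi> U \<psi> U' \<Longrightarrow> diffeo_between \<psi> U' \<phi> U"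
  unfolding diffeo_between_def by blast

lemma diffeo_betweenD:
  assumes "diffeo_between \<phi> U \<psi> U'"
  shows "smooth_map_on A U \<phi>" "smooth_map_on A U' \<psi>" "p \<in> U \<Longrightarrow> \<phi> p \<in> U'" "p \<in> U \<Longrightarrow> \<psi> (\<phi> p) = p"
  using assms unfolding diffeo_between_def by blast+

lemma pushforward_inverse:
  assumes d: "diffeo_between \<phi> U \<psi> U'" and q: "q \<in> U" and v: "v \<in> tangent_space A q"
  shows "pushforward A \<psi> (\<phi> q) (pushforward A \<phi> q v) = v"
proof
  fix f
  show "pushforward A \<psi> (\<phi> q) (pushforward A \<phi> q v) f = v f"
  proof (cases "smooth_near A q f")
    case True
    note d' = diffeo_betweenD[OF d]
    have "smooth_near A (\<phi> q) (f \<circ> \<psi>)"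
      by (rule smooth_near_compose[OF d'(2)]) (use d'(3,4) q True in simp_all)
    then have "pushforward A \<psi> (\<phi> q) (pushforward A \<phi> q v) f = v (f \<circ> \<psi> \<circ> \<phi>)"
      using True d'(4)[OF q] by (simp add: pushforward_def)
    also have "\<dots> = v f"
      by (rule tangent_local[OF v smooth_map_on_open[OF d'(1)] q]) (simp add: d'(4))
    finally show ?thesis .
  qed (use tangent_not_smooth[OF v] diffeo_betweenD(4)[OF d q] in \<open>simp add: pushforward_def\<close>)
qed

definition push_field :: "('m \<Rightarrow> 'm) \<Rightarrow> ('m \<Rightarrow> 'm) \<Rightarrow> 'm vfield \<Rightarrow> 'm vfield" where
  "push_field \<phi> \<psi> X p = pushforward A \<phi> (\<psi> p) (X (\<psi> p))"

lemma push_field_at: "diffeo_between \<phi> U \<psi> U' \<Longrightarrow> q \<in> U \<Longrightarrow> push_field \<phi> \<psi> X (\<phi> q) = pushforward A \<phi> q (X q)"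
  by (simp add: push_field_def diffeo_betweenD(4))

lemma push_field_smooth:
  assumes d: "diffeo_between \<phi> U \<psi> U'" and X: "smooth_vfield_on A S X" and S: "S \<subseteq> U"
  shows "smooth_vfield_on A (U' \<inter> \<psi> -` S) (push_field \<phi> \<psi> X)"
  unfolding smooth_vfield_on_def
proof (intro conjI ballI allI impI)
  note d' = diffeo_betweenD[OF d] and e' = diffeo_betweenD[OF diffeo_between_sym[OF d]]
  show "open (U' \<inter> \<psi> -` S)" by (rule smooth_map_on_preimage_open[OF d'(2) vfield_open[OF X]])
  show "push_field \<phi> \<psi> X p \<in> tangent_space A p" if "p \<in> U' \<inter> \<psi> -` S" for p
    using pushforward_tangent[OF d'(1) _ vfield_tangent[OF X], of "\<psi> p"] that S e'(4)[of p]
    by (auto simp: push_field_def)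
  fix V f assume V: "V \<subseteq> U' \<inter> \<psi> -` S \<and> smooth_fun_on A V f"
  have "smooth_fun_on A (U \<inter> \<phi> -` V) (f \<circ> \<phi>)" using V by (intro smooth_fun_on_compose[OF d'(1)]) simp
  moreover have "U \<inter> \<phi> -` V \<subseteq> S" using V d'(4) by auto
  ultimately have "smooth_fun_on A (U \<inter> \<phi> -` V) (\<lambda>p. X p (f \<circ> \<phi>))" by (intro vfield_smooth[OF X])
  then have "smooth_fun_on A (U' \<inter> \<psi> -` (U \<inter> \<phi> -` V)) ((\<lambda>p. X p (f \<circ> \<phi>)) \<circ> \<psi>)"
    by (rule smooth_fun_on_compose[OF d'(2)])
  moreover have "U' \<inter> \<psi> -` (U \<inter> \<phi> -` V) = V" using V e'(3,4) by auto
  ultimately have "smooth_fun_on A V ((\<lambda>p. X p (f \<circ> \<phi>)) \<circ> \<psi>)" by simp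
  then show "smooth_fun_on A V (\<lambda>p. push_field \<phi> \<psi> X p f)"
    by (rule smooth_fun_on_cong) (use V smooth_nearI e'(4) in \<open>auto simp: push_field_def pushforward_def\<close>)
qed

lemma lie_bracket_cong:
  assumes X: "smooth_vfield_on A W X" and Y: "smooth_vfield_on A W Y" and q: "q \<in> W"
    and eq: "\<And>p. p \<in> W \<Longrightarrow> X p = X' p" "\<And>p. p \<in> W \<Longrightarrow> Y p = Y' p"
  shows "lie_bracket A X Y q = lie_bracket A X' Y' q"
proof
  fix f
  have "X q (\<lambda>p. Y p f) = X q (\<lambda>p. Y' p f)"
    by (rule tangent_local[OF vfield_tangent[OF X q] vfield_open[OF X] q]) (simp add: eq)
  moreover have "Y q (\<lambda>p. X p f) = Y q (\<lambda>p. X' p f)"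
    by (rule tangent_local[OF vfield_tangent[OF Y q] vfield_open[OF X] q]) (simp add: eq)
  ultimately show "lie_bracket A X Y q f = lie_bracket A X' Y' q f"
    using eq[OF q] by (simp add: lie_bracket_def)
qed

text \<open>Near \<open>q\<close>, composing \<open>(\<phi>\<^sub>*Y) f\<close> with \<open>\<phi>\<close> gives \<open>Y (f \<circ> \<phi>)\<close>, and \<open>X\<close> sees only this germ.\<close>

lemma pushforward_derivative:
  assumes d: "diffeo_between \<phi> U \<psi> U'" and X: "smooth_vfield_on A S X" and Y: "smooth_vfield_on A S Y"
    and S: "S \<subseteq> U" and q: "q \<in> S" and f: "smooth_near A (\<phi> q) f"
  shows "push_field \<phi> \<psi> X (\<phi> q) (\<lambda>p. push_field \<phi> \<psi> Y p f) = X q (\<lambda>p. Y p (f \<circ> \<phi>))"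
proof -
  note d' = diffeo_betweenD[OF d]
  have qU: "q \<in> U" using q S by blast
  have Y': "smooth_vfield_on A (U' \<inter> \<psi> -` S) (push_field \<phi> \<psi> Y)" by (rule push_field_smooth[OF d Y S])
  have q': "\<phi> q \<in> U' \<inter> \<psi> -` S" using d'(3,4)[OF qU] q by simp
  obtain V where V: "open V" "\<phi> q \<in> V" "V \<subseteq> U' \<inter> \<psi> -` S" "smooth_fun_on A V f"
    "smooth_fun_on A V (\<lambda>p. push_field \<phi> \<psi> Y p f)"
    using vfield_near[OF Y' q' f] by blast
  have "push_field \<phi> \<psi> X (\<phi> q) (\<lambda>p. push_field \<phi> \<psi> Y p f) = X q ((\<lambda>p. push_field \<phi> \<psi> Y p f) \<circ> \<phi>)"
    unfolding push_field_at[OF d qU] using smooth_nearI[OF V(5,2)] by (simp add: pushforward_def)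
  also have "\<dots> = X q (\<lambda>p. Y p (f \<circ> \<phi>))"
  proof (rule tangent_local[OF vfield_tangent[OF X q]])
    show "open (U \<inter> \<phi> -` V)" by (rule smooth_map_on_preimage_open[OF d'(1) V(1)])
    show "q \<in> U \<inter> \<phi> -` V" using qU V(2) by simp
    show "((\<lambda>p. push_field \<phi> \<psi> Y p f) \<circ> \<phi>) p = Y p (f \<circ> \<phi>)" if "p \<in> U \<inter> \<phi> -` V" for p
      using that smooth_nearI[OF V(4)] by (simp add: push_field_at[OF d] pushforward_def)
  qed
  finally show ?thesis .
qed

lemma pushforward_lie_bracket:
  assumes d: "diffeo_between \<phi> U \<psi> U'" and X: "smooth_vfield_on A S X" and Y: "smooth_vfield_on A S Y"
    and S: "S \<subseteq> U" and q: "q \<in> S"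
  shows "pushforward A \<phi> q (lie_bracket A X Y q) = lie_bracket A (push_field \<phi> \<psi> X) (push_field \<phi> \<psi> Y) (\<phi> q)"
proof
  fix f
  show "pushforward A \<phi> q (lie_bracket A X Y q) f = lie_bracket A (push_field \<phi> \<psi> X) (push_field \<phi> \<psi> Y) (\<phi> q) f"
    using smooth_near_compose[OF diffeo_betweenD(1)[OF d], of q f] q S
    by (auto simp: pushforward_def lie_bracket_def
        pushforward_derivative[OF d X Y S q] pushforward_derivative[OF d Y X S q])
qed

text \<open>The induction hypothesis must be available at all points of \<open>S\<close>, as the outer bracket
  differentiates the inner one; \<open>lie_bracket_cong\<close> then replaces the transported inner bracket by the
  bracket of the transported fields.\<close>

lemma pushforward_iter_bracket:
  assumes d: "diffeo_between \<phi> U \<psi> U'" and S: "S \<subseteq> U" and "q \<in> S" and "Vs \<noteq> []"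
    and "\<And>V. V \<in> set Vs \<Longrightarrow> smooth_vfield_on A S V"
  shows "pushforward A \<phi> q (iter_bracket A Vs q) = iter_bracket A (map (push_field \<phi> \<psi>) Vs) (\<phi> q)"
  using assms(3-)
proof (induction Vs arbitrary: q rule: induct_list012)
  case 1
  then show ?case by simp
next
  case (2 X)
  then show ?case using S by (auto simp: push_field_at[OF d])
next
  case (3 X Y Xs)
  let ?Z = "iter_bracket A (Y # Xs)" and ?Z' = "iter_bracket A (map (push_field \<phi> \<psi>) (Y # Xs))"
  let ?W = "U' \<inter> \<psi> -` S"
  have X: "smooth_vfield_on A S X" using 3 by simp
  have Z: "smooth_vfield_on A S ?Z" using 3 by (intro iter_bracket_smooth) auto
  have "push_field \<phi> \<psi> ?Z p = ?Z' p" if "p \<in> ?W" for p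
    using "3.IH"(2)[of "\<psi> p"] "3.prems"(3) that diffeo_betweenD(4)[OF diffeo_between_sym[OF d], of p]
    by (simp add: push_field_def[of _ _ ?Z])
  moreover have "\<phi> q \<in> ?W" using diffeo_betweenD(3,4)[OF d] "3.prems"(1) S by auto
  ultimately have "lie_bracket A (push_field \<phi> \<psi> X) (push_field \<phi> \<psi> ?Z) (\<phi> q) =
      lie_bracket A (push_field \<phi> \<psi> X) ?Z' (\<phi> q)"
    by (intro lie_bracket_cong[OF push_field_smooth[OF d X S] push_field_smooth[OF d Z S]]) auto
  then show ?case using pushforward_lie_bracket[OF d X Z S "3.prems"(1)] by simp
qed

end

section \<open>Isometries preserve the flag\<close>

lemma image_coset:
  assumes "linear T"
  shows "T ` coset W v = coset (T ` W) (T v)"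
  unfolding coset_def by (auto simp: linear_add[OF assms] image_iff) (metis linear_add[OF assms])

lemma image_coset_comb:
  assumes T: "linear T"
  shows "T ` coset_comb W cs As = coset_comb (T ` W) cs (map ((`) T) As)"
proof
  show "T ` coset_comb W cs As \<subseteq> coset_comb (T ` W) cs (map ((`) T) As)"
  proof
    fix y assume "y \<in> T ` coset_comb W cs As"
    then obtain a w where a: "\<forall>j<length As. a j \<in> As ! j" "w \<in> W"
      "y = T ((\<Sum>j<length As. cs ! j *\<^sub>R a j) + w)" unfolding coset_comb_def by blast
    have "y = (\<Sum>j<length (map ((`) T) As). cs ! j *\<^sub>R T (a j)) + T w"
      using a(3) by (simp add: linear_add[OF T] linear_sum[OF T] linear_cmul[OF T])
    then show "y \<in> coset_comb (T ` W) cs (map ((`) T) As)"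
      unfolding coset_comb_def using a(1,2)
      by (intro CollectI exI[of _ "\<lambda>j. T (a j)"] exI[of _ "T w"]) auto
  qed
  show "coset_comb (T ` W) cs (map ((`) T) As) \<subseteq> T ` coset_comb W cs As"
  proof
    fix y assume "y \<in> coset_comb (T ` W) cs (map ((`) T) As)"
    then obtain b w where b: "\<forall>j<length As. b j \<in> T ` (As ! j)" "w \<in> W"
      "y = (\<Sum>j<length As. cs ! j *\<^sub>R b j) + T w" unfolding coset_comb_def by auto
    then obtain a where a: "\<And>j. j < length As \<Longrightarrow> a j \<in> As ! j \<and> b j = T (a j)"
      unfolding image_iff by metis
    have "y = T ((\<Sum>j<length As. cs ! j *\<^sub>R a j) + w)"
      using b(3) a by (simp add: linear_add[OF T] linear_sum[OF T] linear_cmul[OF T])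
    then show "y \<in> T ` coset_comb W cs As"
      unfolding coset_comb_def using a b(2) by blast
  qed
qed

lemma coset_comb_subset:
  assumes V: "subspace V" "W \<subseteq> V" "\<And>B. B \<in> set As \<Longrightarrow> B \<subseteq> V"
  shows "coset_comb W cs As \<subseteq> V"
proof
  fix y assume "y \<in> coset_comb W cs As"
  then obtain a w where a: "\<forall>j<length As. a j \<in> As ! j" "w \<in> W"
    "y = (\<Sum>j<length As. cs ! j *\<^sub>R a j) + w" unfolding coset_comb_def by blast
  have "a j \<in> V" if "j < length As" for j using a(1) V(3)[OF nth_mem[OF that]] that by blast
  then show "y \<in> V" unfolding a(3) using a(2) V(2)
    by (intro subspace_add[OF V(1)] subspace_sum[OF V(1)] subspace_scale[OF V(1)]) auto
qed

locale equiregular_sub_riemannian = manifold_atlas A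
  for A :: "('m::t2_space, 'e::euclidean_space) chart set" +
  fixes D :: "'m \<Rightarrow> 'm tvec set" and g :: "'m \<Rightarrow> 'm tvec \<Rightarrow> 'm tvec \<Rightarrow> real"
  assumes subspace_D: "subspace (D q)"
    and D_tangent: "D q \<subseteq> tangent_space A q"
    and equireg: "equiregular A D"
begin

lemma flag_dim: "dim (flag A D i p) = dim (flag A D i q)"
  using equireg unfolding equiregular_def by metis

lemma subspace_flag: "subspace (flag A D i q)"
  by (cases "(A, D, i)" rule: flag.cases) (auto simp: subspace_D)

lemma flag_tangent: "flag A D i q \<subseteq> tangent_space A q"
proof (induction i arbitrary: q rule: induct_nat_012)
  case 0
  then show ?case using subspace_0[OF subspace_tangent_space] by simp
next
  case 1
  then show ?case using D_tangent by simp
next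
  case (ge2 i)
  have "lie_bracket A X Y q \<in> tangent_space A q"
    if X: "X \<in> sections_near A (flag A D (Suc i)) q" and Y: "Y \<in> sections_near A D q" for X Y
  proof -
    obtain S1 S2 where S: "q \<in> S1" "smooth_vfield_on A S1 X" "q \<in> S2" "smooth_vfield_on A S2 Y"
      using X Y unfolding sections_near_def local_section_def by blast
    have o: "open (S1 \<inter> S2)" using S vfield_open by blast
    show ?thesis
      by (rule lie_bracket_tangent[OF vfield_subset[OF S(2) o] vfield_subset[OF S(4) o]]) (use S in auto)
  qed
  then show ?case
    unfolding flag.simps using ge2(2)[of q] by (intro span_minimal[OF _ subspace_tangent_space]) blast
qed

lemma flag_Suc: "flag A D i q \<subseteq> flag A D (Suc i) q"
  by (cases i) (auto simp: subspace_0[OF subspace_D] intro: span_base)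

lemma flag_mono: "i \<le> j \<Longrightarrow> flag A D i q \<subseteq> flag A D j q"
  by (rule lift_Suc_mono_le[of "\<lambda>i. flag A D i q"]) (rule flag_Suc)

text \<open>Like \<open>diffeo_between\<close>, this is kept symmetric in \<open>\<phi>\<close> and \<open>\<psi>\<close>.\<close>

definition sr_isometry_between :: "('m \<Rightarrow> 'm) \<Rightarrow> 'm set \<Rightarrow> ('m \<Rightarrow> 'm) \<Rightarrow> 'm set \<Rightarrow> bool" where
  "sr_isometry_between \<phi> U \<psi> U' \<longleftrightarrow> diffeo_between \<phi> U \<psi> U' \<and>
     (\<forall>q\<in>U. \<forall>v\<in>D q. pushforward A \<phi> q v \<in> D (\<phi> q)) \<and>
     (\<forall>q\<in>U'. \<forall>v\<in>D q. pushforward A \<psi> q v \<in> D (\<psi> q)) \<and>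
     (\<forall>q\<in>U. \<forall>v\<in>D q. \<forall>w\<in>D q. g (\<phi> q) (pushforward A \<phi> q v) (pushforward A \<phi> q w) = g q v w) \<and>
     (\<forall>q\<in>U'. \<forall>v\<in>D q. \<forall>w\<in>D q. g (\<psi> q) (pushforward A \<psi> q v) (pushforward A \<psi> q w) = g q v w)"

lemma sr_isometry_between_sym: "sr_isometry_between \<phi> U \<psi> U' \<Longrightarrow> sr_isometry_between \<psi> U' \<phi> U"
  unfolding sr_isometry_between_def using diffeo_between_sym by blast

lemma sr_isometry_betweenD:
  assumes "sr_isometry_between \<phi> U \<psi> U'"
  shows "diffeo_between \<phi> U \<psi> U'" "q \<in> U \<Longrightarrow> v \<in> D q \<Longrightarrow> pushforward A \<phi> q v \<in> D (\<phi> q)"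
    "q \<in> U \<Longrightarrow> v \<in> D q \<Longrightarrow> w \<in> D q \<Longrightarrow> g (\<phi> q) (pushforward A \<phi> q v) (pushforward A \<phi> q w) = g q v w"
    "q \<in> U \<Longrightarrow> \<phi> q \<in> U'" "q \<in> U \<Longrightarrow> \<psi> (\<phi> q) = q"
  using assms unfolding sr_isometry_between_def diffeo_between_def by blast+

lemma push_field_section:
  assumes d: "diffeo_between \<phi> U \<psi> U'" and E: "\<And>p. p \<in> U \<Longrightarrow> pushforward A \<phi> p ` E p \<subseteq> E (\<phi> p)"
    and q: "q \<in> U" and X: "X \<in> sections_near A E q"
  shows "push_field \<phi> \<psi> X \<in> sections_near A E (\<phi> q)"
proof -
  obtain S where S: "q \<in> S" "local_section A E S X" using X unfolding sections_near_def by blast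
  let ?S = "S \<inter> U"
  have "smooth_vfield_on A ?S X"
    by (rule vfield_subset[of S])
      (use S(2) vfield_open smooth_map_on_open[OF diffeo_betweenD(1)[OF d]] in \<open>auto simp: local_section_def\<close>)
  then have "smooth_vfield_on A (U' \<inter> \<psi> -` ?S) (push_field \<phi> \<psi> X)" by (rule push_field_smooth[OF d]) simp
  moreover have "push_field \<phi> \<psi> X p \<in> E p" if "p \<in> U' \<inter> \<psi> -` ?S" for p
    using that E[of "\<psi> p"] S(2) diffeo_betweenD(4)[OF diffeo_between_sym[OF d], of p]
    unfolding push_field_def local_section_def by auto
  moreover have "\<phi> q \<in> U' \<inter> \<psi> -` ?S" using diffeo_betweenD(3,4)[OF d q] S(1) q by simp
  ultimately have "local_section A E (U' \<inter> \<psi> -` ?S) (push_field \<phi> \<psi> X)" "\<phi> q \<in> U' \<inter> \<psi> -` ?S"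
    unfolding local_section_def by simp_all
  then show ?thesis unfolding sections_near_def by (intro CollectI exI conjI)
qed

text \<open>Induction on the degree, for all points of \<open>U\<close> at once: a section of \<open>\<D>\<^sup>i\<close> near \<open>q\<close> goes to a
  section of \<open>\<D>\<^sup>i\<close> near \<open>\<phi> q\<close> only if the differentials at all the points near \<open>q\<close> respect \<open>\<D>\<^sup>i\<close>.\<close>

lemma pushforward_flag_subset:
  assumes "sr_isometry_between \<phi> U \<psi> U'" "q \<in> U"
  shows "pushforward A \<phi> q ` flag A D i q \<subseteq> flag A D i (\<phi> q)"
  using assms(2)
proof (induction i arbitrary: q rule: induct_nat_012)
  case 0
  show ?case unfolding flag.simps image_insert image_empty linear_0[OF linear_pushforward] by (rule order_refl)
next
  case 1
  then show ?case using sr_isometry_betweenD(2)[OF assms(1)] by auto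
next
  case (ge2 i)
  note d = sr_isometry_betweenD(1)[OF assms(1)]
  let ?T = "pushforward A \<phi> q"
  let ?B = "\<lambda>q. {lie_bracket A X Y q | X Y. X \<in> sections_near A (flag A D (Suc i)) q \<and> Y \<in> sections_near A D q}"
  have "?T (lie_bracket A X Y q) \<in> ?B (\<phi> q)"
    if X: "X \<in> sections_near A (flag A D (Suc i)) q" and Y: "Y \<in> sections_near A D q" for X Y
  proof -
    obtain S1 S2 where S: "q \<in> S1" "smooth_vfield_on A S1 X" "q \<in> S2" "smooth_vfield_on A S2 Y"
      using X Y unfolding sections_near_def local_section_def by blast
    have o: "open (S1 \<inter> S2 \<inter> U)" using S vfield_open smooth_map_on_open[OF diffeo_betweenD(1)[OF d]] by blast
    have "?T (lie_bracket A X Y q) = lie_bracket A (push_field \<phi> \<psi> X) (push_field \<phi> \<psi> Y) (\<phi> q)"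
      by (rule pushforward_lie_bracket[OF d vfield_subset[OF S(2) o] vfield_subset[OF S(4) o]])
         (use S ge2.prems in auto)
    moreover have "push_field \<phi> \<psi> X \<in> sections_near A (flag A D (Suc i)) (\<phi> q)"
      by (rule push_field_section[OF d _ ge2.prems X]) (rule ge2.IH(2))
    moreover have "push_field \<phi> \<psi> Y \<in> sections_near A D (\<phi> q)"
      by (rule push_field_section[OF d _ ge2.prems Y]) (use sr_isometry_betweenD(2)[OF assms(1)] in auto)
    ultimately show ?thesis by blast
  qed
  then have "?T ` ?B q \<subseteq> ?B (\<phi> q)" by auto
  moreover have "?T ` flag A D (Suc i) q \<subseteq> flag A D (Suc i) (\<phi> q)" by (rule ge2.IH(2)[OF ge2.prems])
  ultimately have "span (?T ` (flag A D (Suc i) q \<union> ?B q)) \<subseteq> span (flag A D (Suc i) (\<phi> q) \<union> ?B (\<phi> q))"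
    unfolding image_Un by (intro span_mono Un_mono)
  then show ?case by (simp add: linear_span_image[OF linear_pushforward])
qed

lemma pushforward_image_inverse:
  assumes "sr_isometry_between \<phi> U \<psi> U'" "q \<in> U" "Y \<subseteq> tangent_space A q"
  shows "pushforward A \<psi> (\<phi> q) ` pushforward A \<phi> q ` Y = Y"
proof -
  have "(\<lambda>v. pushforward A \<psi> (\<phi> q) (pushforward A \<phi> q v)) ` Y = (\<lambda>v. v) ` Y"
    by (rule image_cong[OF refl])
       (use pushforward_inverse[OF sr_isometry_betweenD(1)[OF assms(1)] assms(2)] assms(3) in blast)
  then show ?thesis by (simp add: image_image)
qed

lemma pushforward_image_eq:
  assumes iso: "sr_isometry_between \<phi> U \<psi> U'" and q: "q \<in> U"
    and T: "E (\<phi> q) \<subseteq> tangent_space A (\<phi> q)"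
    and E: "pushforward A \<phi> q ` E q \<subseteq> E (\<phi> q)" "pushforward A \<psi> (\<phi> q) ` E (\<phi> q) \<subseteq> E (\<psi> (\<phi> q))"
  shows "pushforward A \<phi> q ` E q = E (\<phi> q)"
proof
  note q' = sr_isometry_betweenD(4,5)[OF iso q]
  have "E (\<phi> q) = pushforward A \<phi> (\<psi> (\<phi> q)) ` pushforward A \<psi> (\<phi> q) ` E (\<phi> q)"
    using pushforward_image_inverse[OF sr_isometry_between_sym[OF iso] q'(1) T] by simp
  then show "E (\<phi> q) \<subseteq> pushforward A \<phi> q ` E q" using E(2) unfolding q'(2) by blast
qed (rule E(1))

lemma pushforward_flag:
  assumes iso: "sr_isometry_between \<phi> U \<psi> U'" and q: "q \<in> U"
  shows "pushforward A \<phi> q ` flag A D i q = flag A D i (\<phi> q)"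
  by (rule pushforward_image_eq[where E = "flag A D i", OF iso q flag_tangent])
     (rule pushforward_flag_subset[OF iso q]
        pushforward_flag_subset[OF sr_isometry_between_sym[OF iso] sr_isometry_betweenD(4)[OF iso q]])+

lemma pushforward_tangent_space:
  assumes iso: "sr_isometry_between \<phi> U \<psi> U'" and q: "q \<in> U"
  shows "pushforward A \<phi> q ` tangent_space A q = tangent_space A (\<phi> q)"
proof (rule pushforward_image_eq[where E = "tangent_space A", OF iso q order_refl])
  note d = diffeo_betweenD[OF sr_isometry_betweenD(1)[OF iso]]
  show "pushforward A \<phi> q ` tangent_space A q \<subseteq> tangent_space A (\<phi> q)"
    using pushforward_tangent[OF d(1) q] by blast
  show "pushforward A \<psi> (\<phi> q) ` tangent_space A (\<phi> q) \<subseteq> tangent_space A (\<psi> (\<phi> q))"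
    using pushforward_tangent[OF d(2) d(3)[OF q]] by blast
qed

lemma inj_on_pushforward:
  assumes iso: "sr_isometry_between \<phi> U \<psi> U'" and q: "q \<in> U"
  shows "inj_on (pushforward A \<phi> q) (tangent_space A q)"
  by (rule inj_on_inverseI) (rule pushforward_inverse[OF sr_isometry_betweenD(1)[OF iso] q])

section \<open>Isometries preserve Popp's construction\<close>

definition push_tensor :: "('m \<Rightarrow> 'm) \<Rightarrow> 'm \<Rightarrow> 'm tensor \<Rightarrow> 'm tensor" where
  "push_tensor \<phi> q = map (\<lambda>(c, vs). (c, map (pushforward A \<phi> q) vs))"

text \<open>The transported local sections extend the transported vectors, and by naturality their
  iterated brackets are the transported iterated brackets.\<close>

lemma popp_pi_push:
  assumes iso: "sr_isometry_between \<phi> U \<psi> U'" and q: "q \<in> U" and i: "i \<ge> 1" and s: "popp_pi A D q i s Y"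
  shows "popp_pi A D (\<phi> q) i (push_tensor \<phi> q s) (pushforward A \<phi> q ` Y)"
proof -
  note d = sr_isometry_betweenD(1)[OF iso]
  let ?T = "pushforward A \<phi> q" and ?p = "push_field \<phi> \<psi>"
  obtain Ss where Ss: "\<And>c Vs. (c, Vs) \<in> set Ss \<Longrightarrow> length Vs = i \<and> set Vs \<subseteq> sections_near A D q"
    "s = map (\<lambda>(c, Vs). (c, map (\<lambda>V. V q) Vs)) Ss"
    "Y = coset (flag A D (i - 1) q) (\<Sum>(c, Vs)\<leftarrow>Ss. c *\<^sub>R iter_bracket A Vs q)"
    using s unfolding popp_pi_def by blast
  let ?Ss = "map (\<lambda>(c, Vs). (c, map ?p Vs)) Ss"
  have ib: "?T (iter_bracket A Vs q) = iter_bracket A (map ?p Vs) (\<phi> q)" if cVs: "(c, Vs) \<in> set Ss" for c Vs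
  proof -
    obtain S where S: "open S" "q \<in> S" "\<And>V. V \<in> set Vs \<Longrightarrow> local_section A D S V"
      using sections_near_common[of "set Vs" D q] Ss(1)[OF cVs] by auto
    have o: "open (S \<inter> U)" using S(1) smooth_map_on_open[OF diffeo_betweenD(1)[OF d]] by blast
    show ?thesis
    proof (rule pushforward_iter_bracket[OF d, of "S \<inter> U"])
      show "smooth_vfield_on A (S \<inter> U) V" if "V \<in> set Vs" for V
        using vfield_subset[OF _ o, of S V] S(3)[OF that] by (simp add: local_section_def)
    qed (use S(2) q i Ss(1)[OF cVs] in auto)
  qed
  have "?T (\<Sum>(c, Vs)\<leftarrow>Ss. c *\<^sub>R iter_bracket A Vs q) = (\<Sum>(c, Vs)\<leftarrow>?Ss. c *\<^sub>R iter_bracket A Vs (\<phi> q))"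
    using ib
  proof (induction Ss)
    case Nil
    then show ?case by (simp only: list.map sum_list.Nil linear_0[OF linear_pushforward])
  next
    case (Cons a Ss)
    obtain c Vs where a: "a = (c, Vs)" by (cases a)
    have "?T (iter_bracket A Vs q) = iter_bracket A (map ?p Vs) (\<phi> q)"
      by (rule Cons.prems[of c]) (simp add: a)
    moreover have "?T (\<Sum>(c, Vs)\<leftarrow>Ss. c *\<^sub>R iter_bracket A Vs q) =
        (\<Sum>(c, Vs)\<leftarrow>map (\<lambda>(c, Vs). (c, map ?p Vs)) Ss. c *\<^sub>R iter_bracket A Vs (\<phi> q))"
      by (rule Cons.IH) (rule Cons.prems, rule list.set_intros(2))
    ultimately show ?case
      by (simp only: a list.map prod.case sum_list.Cons linear_add[OF linear_pushforward]
          linear_cmul[OF linear_pushforward])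
  qed
  then have "?T ` Y = coset (flag A D (i - 1) (\<phi> q)) (\<Sum>(c, Vs)\<leftarrow>?Ss. c *\<^sub>R iter_bracket A Vs (\<phi> q))"
    unfolding Ss(3) by (simp only: image_coset[OF linear_pushforward] pushforward_flag[OF iso q])
  moreover have "push_tensor \<phi> q s = map (\<lambda>(c, Vs). (c, map (\<lambda>V. V (\<phi> q)) Vs)) ?Ss"
    unfolding Ss(2) push_tensor_def by (auto simp: push_field_at[OF d q])
  moreover have "\<forall>(c, Vs)\<in>set ?Ss. length Vs = i \<and> set Vs \<subseteq> sections_near A D (\<phi> q)"
    using Ss(1) push_field_section[OF d _ q, of D] sr_isometry_betweenD(2)[OF iso] by fastforce
  ultimately show ?thesis unfolding popp_pi_def by blast
qed

lemma tensor_norm_push: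
  assumes iso: "sr_isometry_between \<phi> U \<psi> U'" and q: "q \<in> U" and s: "popp_pi A D q i s Y"
  shows "tensor_norm g (\<phi> q) i (push_tensor \<phi> q s) = tensor_norm g q i s"
proof -
  have mem: "length vs = i \<and> set vs \<subseteq> D q" if cvs: "(c, vs) \<in> set s" for c vs
  proof -
    obtain Ss where Ss: "\<forall>(c, Vs)\<in>set Ss. length Vs = i \<and> set Vs \<subseteq> sections_near A D q"
      "s = map (\<lambda>(c, Vs). (c, map (\<lambda>V. V q) Vs)) Ss" using s unfolding popp_pi_def by blast
    then obtain Vs where "(c, Vs) \<in> set Ss" "vs = map (\<lambda>V. V q) Vs" using cvs by auto
    then have "length Vs = i" "set Vs \<subseteq> sections_near A D q" "vs = map (\<lambda>V. V q) Vs" using Ss(1) by auto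
    then show ?thesis by (auto simp: sections_near_def local_section_def)
  qed
  have "(\<Prod>j<i. g (\<phi> q) (map (pushforward A \<phi> q) vs ! j) (map (pushforward A \<phi> q) ws ! j)) =
      (\<Prod>j<i. g q (vs ! j) (ws ! j))" if "(c, vs) \<in> set s" "(d, ws) \<in> set s" for c d vs ws
  proof (rule prod.cong[OF refl])
    fix j assume "j \<in> {..<i}"
    then have j: "j < length vs" "j < length ws" using mem that by auto
    then have "vs ! j \<in> D q" "ws ! j \<in> D q" using mem that nth_mem by blast+
    then show "g (\<phi> q) (map (pushforward A \<phi> q) vs ! j) (map (pushforward A \<phi> q) ws ! j) = g q (vs ! j) (ws ! j)"
      using j sr_isometry_betweenD(3)[OF iso q] by simp
  qed
  then have "tensor_inner g (\<phi> q) i (push_tensor \<phi> q s) (push_tensor \<phi> q s) = tensor_inner g q i s s"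
    unfolding tensor_inner_def push_tensor_def map_map
    by (intro arg_cong[of _ _ sum_list] map_cong refl) (auto intro!: arg_cong[of _ _ sum_list] map_cong)
  then show ?thesis by (simp add: tensor_norm_def)
qed

text \<open>Transport by \<open>\<phi>\<close> and back by \<open>\<psi>\<close> shows that the same norms are attained by the tensors over \<open>Y\<close>
  and by those over its image, so the two minima agree.\<close>

lemma quot_norm_push:
  assumes iso: "sr_isometry_between \<phi> U \<psi> U'" and q: "q \<in> U" and i: "i \<ge> 1" and Y: "Y \<subseteq> tangent_space A q"
  shows "quot_norm A D g (\<phi> q) i (pushforward A \<phi> q ` Y) = quot_norm A D g q i Y"
proof -
  have "(\<exists>s. popp_pi A D (\<phi> q) i s (pushforward A \<phi> q ` Y) \<and> r = tensor_norm g (\<phi> q) i s) \<longleftrightarrow>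
      (\<exists>s. popp_pi A D q i s Y \<and> r = tensor_norm g q i s)" for r
  proof
    assume "\<exists>s. popp_pi A D q i s Y \<and> r = tensor_norm g q i s"
    then show "\<exists>s. popp_pi A D (\<phi> q) i s (pushforward A \<phi> q ` Y) \<and> r = tensor_norm g (\<phi> q) i s"
      using popp_pi_push[OF iso q i] tensor_norm_push[OF iso q] by metis
  next
    note iso' = sr_isometry_between_sym[OF iso] and q' = sr_isometry_betweenD(4)[OF iso q]
    assume "\<exists>s. popp_pi A D (\<phi> q) i s (pushforward A \<phi> q ` Y) \<and> r = tensor_norm g (\<phi> q) i s"
    then have "\<exists>s. popp_pi A D (\<psi> (\<phi> q)) i s (pushforward A \<psi> (\<phi> q) ` pushforward A \<phi> q ` Y) \<and>
        r = tensor_norm g (\<psi> (\<phi> q)) i s"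
      using popp_pi_push[OF iso' q' i] tensor_norm_push[OF iso' q'] by metis
    then show "\<exists>s. popp_pi A D q i s Y \<and> r = tensor_norm g q i s"
      unfolding pushforward_image_inverse[OF iso q Y] sr_isometry_betweenD(5)[OF iso q] .
  qed
  then show ?thesis unfolding quot_norm_def by simp
qed

lemma flag_quot_tangent: "Y \<in> flag_quot A D q i \<Longrightarrow> Y \<subseteq> tangent_space A q"
  unfolding flag_quot_def coset_def using flag_tangent subspace_add[OF subspace_tangent_space] by blast

lemma flag_quot_push:
  assumes iso: "sr_isometry_between \<phi> U \<psi> U'" and q: "q \<in> U" and Y: "Y \<in> flag_quot A D q i"
  shows "pushforward A \<phi> q ` Y \<in> flag_quot A D (\<phi> q) i"
  using Y unfolding flag_quot_def pushforward_flag[OF iso q, symmetric]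
  by (auto simp: image_coset[OF linear_pushforward])

lemma quot_inner_push:
  assumes iso: "sr_isometry_between \<phi> U \<psi> U'" and q: "q \<in> U" and i: "i \<ge> 1"
    and Y: "Y \<in> flag_quot A D q i" and Z: "Z \<in> flag_quot A D q i"
  shows "quot_inner A D g (\<phi> q) i (pushforward A \<phi> q ` Y) (pushforward A \<phi> q ` Z) = quot_inner A D g q i Y Z"
proof -
  have "quot_norm A D g (\<phi> q) i (coset_comb (flag A D (i - 1) (\<phi> q)) cs
        [pushforward A \<phi> q ` Y, pushforward A \<phi> q ` Z]) =
      quot_norm A D g q i (coset_comb (flag A D (i - 1) q) cs [Y, Z])" for cs
    using quot_norm_push[OF iso q i coset_comb_subset[OF subspace_tangent_space flag_tangent], of "[Y, Z]" "i - 1" cs]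
      flag_quot_tangent[OF Y] flag_quot_tangent[OF Z]
    by (auto simp: image_coset_comb[OF linear_pushforward] pushforward_flag[OF iso q])
  then show ?thesis unfolding quot_inner_def by simp
qed

definition gr_push :: "('m \<Rightarrow> 'm) \<Rightarrow> 'm \<Rightarrow> 'm gr_elem \<Rightarrow> 'm gr_elem" where
  "gr_push \<phi> q Y = (\<lambda>i\<in>{1..sr_step A D}. pushforward A \<phi> q ` Y i)"

lemma gr_push_mem:
  assumes "sr_isometry_between \<phi> U \<psi> U'" "q \<in> U" "Y \<in> gr A D q"
  shows "gr_push \<phi> q Y \<in> gr A D (\<phi> q)"
  using assms(3) flag_quot_push[OF assms(1,2)] unfolding gr_def gr_push_def by auto

lemma gr_push_inverse:
  assumes "sr_isometry_between \<phi> U \<psi> U'" "q \<in> U" "Y \<in> gr A D q"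
  shows "gr_push \<psi> (\<phi> q) (gr_push \<phi> q Y) = Y"
proof
  fix i
  have Y: "Y \<in> (\<Pi>\<^sub>E i\<in>{1..sr_step A D}. flag_quot A D q i)" using assms(3) unfolding gr_def .
  show "gr_push \<psi> (\<phi> q) (gr_push \<phi> q Y) i = Y i"
  proof (cases "i \<in> {1..sr_step A D}")
    case True
    then show ?thesis
      using pushforward_image_inverse[OF assms(1,2) flag_quot_tangent[OF PiE_mem[OF Y True]]]
      by (simp add: gr_push_def)
  qed (use PiE_arb[OF Y] in \<open>auto simp: gr_push_def\<close>)
qed

lemma gr_push_comb:
  assumes "sr_isometry_between \<phi> U \<psi> U'" "q \<in> U"
  shows "gr_push \<phi> q (gr_comb A D q cs Ys) = gr_comb A D (\<phi> q) cs (map (gr_push \<phi> q) Ys)"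
proof
  fix i
  show "gr_push \<phi> q (gr_comb A D q cs Ys) i = gr_comb A D (\<phi> q) cs (map (gr_push \<phi> q) Ys) i"
    by (simp add: gr_push_def gr_comb_def image_coset_comb[OF linear_pushforward] pushforward_flag[OF assms] o_def)
qed

lemma gr_inner_push:
  assumes "sr_isometry_between \<phi> U \<psi> U'" "q \<in> U" "Y \<in> gr A D q" "Z \<in> gr A D q"
  shows "gr_inner A D g (\<phi> q) (gr_push \<phi> q Y) (gr_push \<phi> q Z) = gr_inner A D g q Y Z"
  unfolding gr_inner_def
proof (rule sum.cong[OF refl])
  fix i assume i: "i \<in> {1..sr_step A D}"
  have "Y i \<in> flag_quot A D q i" "Z i \<in> flag_quot A D q i" using assms(3,4) i unfolding gr_def by auto
  then show "quot_inner A D g (\<phi> q) i (gr_push \<phi> q Y i) (gr_push \<phi> q Z i) = quot_inner A D g q i (Y i) (Z i)"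
    using quot_inner_push[OF assms(1,2)] i by (simp add: gr_push_def)
qed

lemma gr_orthonormal_basis_push:
  assumes iso: "sr_isometry_between \<phi> U \<psi> U'" and q: "q \<in> U" and es: "gr_orthonormal_basis A D g q es"
  shows "gr_orthonormal_basis A D g (\<phi> q) (map (gr_push \<phi> q) es)"
proof -
  note iso' = sr_isometry_between_sym[OF iso] and q' = sr_isometry_betweenD(4,5)[OF iso q]
  note es' = es[unfolded gr_orthonormal_basis_def]
  have "\<exists>cs. length cs = DIM('e) \<and> Y = gr_comb A D (\<phi> q) cs (map (gr_push \<phi> q) es)"
    if Y: "Y \<in> gr A D (\<phi> q)" for Y
  proof -
    have "gr_push \<psi> (\<phi> q) Y \<in> gr A D q" using gr_push_mem[OF iso' q'(1) Y] q'(2) by simp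
    then obtain cs where cs: "length cs = DIM('e)" "gr_push \<psi> (\<phi> q) Y = gr_comb A D q cs es" using es' by blast
    have "Y = gr_push \<phi> q (gr_push \<psi> (\<phi> q) Y)" using gr_push_inverse[OF iso' q'(1) Y] q'(2) by simp
    then show ?thesis using cs gr_push_comb[OF iso q] by auto
  qed
  moreover have "gr_inner A D g (\<phi> q) (map (gr_push \<phi> q) es ! j) (map (gr_push \<phi> q) es ! l) = (if j = l then 1 else 0)"
    if "j < DIM('e)" "l < DIM('e)" for j l
  proof -
    have "es ! j \<in> gr A D q" "es ! l \<in> gr A D q" using es' that nth_mem by fastforce+
    then show ?thesis using that es' gr_inner_push[OF iso q] by simp
  qed
  moreover have "set (map (gr_push \<phi> q) es) \<subseteq> gr A D (\<phi> q)" using es' gr_push_mem[OF iso q] by auto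
  ultimately show ?thesis using es' unfolding gr_orthonormal_basis_def by simp
qed

text \<open>The dual of the transported basis consists of the transported functionals, which are pulled
  back along the inverse \<open>\<psi>\<close>.\<close>

lemma gr_dual_basis_push:
  assumes iso: "sr_isometry_between \<phi> U \<psi> U'" and q: "q \<in> U" and es: "set es \<subseteq> gr A D q"
    and \<nu>: "gr_dual_basis A D q es \<nu>s"
  shows "gr_dual_basis A D (\<phi> q) (map (gr_push \<phi> q) es) (map (\<lambda>\<nu>. \<nu> \<circ> gr_push \<psi> (\<phi> q)) \<nu>s)"
proof -
  note iso' = sr_isometry_between_sym[OF iso] and q' = sr_isometry_betweenD(4,5)[OF iso q]
  have "gr_linear A D (\<phi> q) (\<nu> \<circ> gr_push \<psi> (\<phi> q))" if "gr_linear A D q \<nu>" for \<nu>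
    using that gr_push_mem[OF iso' q'(1)] gr_push_comb[OF iso' q'(1)] unfolding gr_linear_def q'(2) by simp
  moreover have "gr_push \<psi> (\<phi> q) (gr_push \<phi> q (es ! l)) = es ! l" if "l < length es" for l
    using that es nth_mem by (intro gr_push_inverse[OF iso q]) blast
  ultimately show ?thesis using \<nu> unfolding gr_dual_basis_def by auto
qed

lemma wedge_push:
  assumes iso: "sr_isometry_between \<phi> U \<psi> U'" and q: "q \<in> U" and Ys: "set Ys \<subseteq> gr A D q" "length Ys = length \<nu>s"
  shows "wedge (map (\<lambda>\<nu>. \<nu> \<circ> gr_push \<psi> (\<phi> q)) \<nu>s) (map (gr_push \<phi> q) Ys) = wedge \<nu>s Ys"
proof -
  have "(map (\<lambda>\<nu>. \<nu> \<circ> gr_push \<psi> (\<phi> q)) \<nu>s ! \<sigma> j) (map (gr_push \<phi> q) Ys ! j) = (\<nu>s ! \<sigma> j) (Ys ! j)"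
    if "\<sigma> permutes {..<length \<nu>s}" "j < length \<nu>s" for \<sigma> j
  proof -
    have "\<sigma> j < length \<nu>s" using permutes_in_image[OF that(1)] that(2) by simp
    moreover have "gr_push \<psi> (\<phi> q) (gr_push \<phi> q (Ys ! j)) = Ys ! j"
      using that(2) Ys by (intro gr_push_inverse[OF iso q]) (auto dest: nth_mem)
    ultimately show ?thesis using that(2) Ys(2) by simp
  qed
  then show ?thesis unfolding wedge_def by (auto intro!: sum.cong prod.cong)
qed

lemma popp_mu_push:
  assumes iso: "sr_isometry_between \<phi> U \<psi> U'" and q: "q \<in> U" and \<mu>: "popp_mu A D g q \<mu>"
  obtains \<mu>' where "popp_mu A D g (\<phi> q) \<mu>'"
    "\<And>Ys. set Ys \<subseteq> gr A D q \<Longrightarrow> length Ys = DIM('e) \<Longrightarrow> \<mu>' (map (gr_push \<phi> q) Ys) = \<mu> Ys"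
proof -
  obtain es \<nu>s where es: "gr_orthonormal_basis A D g q es" "gr_dual_basis A D q es \<nu>s" "\<mu> = wedge \<nu>s"
    using \<mu> unfolding popp_mu_def by blast
  have mem: "set es \<subseteq> gr A D q" and len: "length \<nu>s = DIM('e)"
    using es unfolding gr_orthonormal_basis_def gr_dual_basis_def by auto
  show ?thesis
  proof (rule that)
    show "popp_mu A D g (\<phi> q) (wedge (map (\<lambda>\<nu>. \<nu> \<circ> gr_push \<psi> (\<phi> q)) \<nu>s))"
      unfolding popp_mu_def
      using gr_orthonormal_basis_push[OF iso q es(1)] gr_dual_basis_push[OF iso q mem es(2)] by blast
  qed (use wedge_push[OF iso q] es(3) len in simp)
qed

lemma theta_hat_push:
  assumes iso: "sr_isometry_between \<phi> U \<psi> U'" and q: "q \<in> U"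
  shows "theta_hat A D (\<phi> q) (map (pushforward A \<phi> q) vs) = map (gr_push \<phi> q) (theta_hat A D q vs)"
  unfolding theta_hat_def gr_push_def
  by (auto simp: fun_eq_iff restrict_def image_coset[OF linear_pushforward] pushforward_flag[OF iso q]
      flag_dim[of _ "\<phi> q" q] linear_0[OF linear_pushforward])

lemma adapted_basis_push:
  assumes iso: "sr_isometry_between \<phi> U \<psi> U'" and q: "q \<in> U" and vs: "adapted_basis A D q vs"
  shows "adapted_basis A D (\<phi> q) (map (pushforward A \<phi> q) vs)"
proof -
  note vs' = vs[unfolded adapted_basis_def]
  have inj: "inj_on (pushforward A \<phi> q) (span (set vs))" using inj_on_pushforward[OF iso q] vs' by simp
  then have "inj_on (pushforward A \<phi> q) (set vs)" by (rule inj_on_subset[OF _ span_superset])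
  moreover have "independent (pushforward A \<phi> q ` set vs)"
    using linear_independent_injective_image[OF linear_pushforward _ inj] vs' by blast
  ultimately show ?thesis
    using vs' unfolding adapted_basis_def
    by (simp add: distinct_map take_map linear_span_image[OF linear_pushforward]
        pushforward_tangent_space[OF iso q] pushforward_flag[OF iso q] flag_dim[of _ "\<phi> q" q])
qed

lemma theta_hat_mem:
  assumes vs: "adapted_basis A D q vs"
  shows "set (theta_hat A D q vs) \<subseteq> gr A D q"
proof -
  have "vs ! l \<in> flag A D i q" if "l < length vs" "l < dim (flag A D i q)" for l i
  proof -
    have "vs ! l \<in> set (take (dim (flag A D i q)) vs)" using that by (auto simp: in_set_conv_nth)
    then show ?thesis using vs span_base unfolding adapted_basis_def by metis
  qed
  then show ?thesis
    using subspace_0[OF subspace_flag] by (auto simp: theta_hat_def gr_def flag_quot_def)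
qed

text \<open>Up to sign, \<open>P\<close> at \<open>\<phi> q\<close> can be computed from any orthonormal basis, in particular from the
  transport of one at \<open>q\<close>. The two signs in the definition of Popp's volume combine to \<open>\<epsilon>\<close>.\<close>

lemma popp_volume_push:
  assumes P: "popp_volume A D g P" and iso: "sr_isometry_between \<phi> U \<psi> U'" and q: "q \<in> U"
  obtains \<epsilon> where "\<epsilon> \<in> {1, -1}"
    "\<And>vs. adapted_basis A D q vs \<Longrightarrow> P (\<phi> q) (map (pushforward A \<phi> q) vs) = \<epsilon> * P q vs"
proof -
  obtain \<mu> where \<mu>: "popp_mu A D g q \<mu>" using P unfolding popp_volume_def by blast
  obtain \<mu>' where \<mu>': "popp_mu A D g (\<phi> q) \<mu>'"
    "\<And>Ys. set Ys \<subseteq> gr A D q \<Longrightarrow> length Ys = DIM('e) \<Longrightarrow> \<mu>' (map (gr_push \<phi> q) Ys) = \<mu> Ys"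
    using popp_mu_push[OF iso q \<mu>] by blast
  obtain \<epsilon> where \<epsilon>: "\<epsilon> \<in> {1, -1}" "\<And>vs. adapted_basis A D q vs \<Longrightarrow> P q vs = \<epsilon> * \<mu> (theta_hat A D q vs)"
    using P \<mu> unfolding popp_volume_def by meson
  obtain \<epsilon>' where \<epsilon>': "\<epsilon>' \<in> {1, -1}"
    "\<And>vs. adapted_basis A D (\<phi> q) vs \<Longrightarrow> P (\<phi> q) vs = \<epsilon>' * \<mu>' (theta_hat A D (\<phi> q) vs)"
    using P \<mu>'(1) unfolding popp_volume_def by meson
  show ?thesis
  proof (rule that[of "\<epsilon>' * \<epsilon>"])
    show "\<epsilon>' * \<epsilon> \<in> {1, -1}" using \<epsilon>(1) \<epsilon>'(1) by auto
    fix vs assume vs: "adapted_basis A D q vs"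
    have "length (theta_hat A D q vs) = DIM('e)" using vs by (simp add: theta_hat_def adapted_basis_def)
    then have "P (\<phi> q) (map (pushforward A \<phi> q) vs) = \<epsilon>' * \<mu> (theta_hat A D q vs)"
      using \<epsilon>'(2)[OF adapted_basis_push[OF iso q vs]] \<mu>'(2)[OF theta_hat_mem[OF vs]]
      by (simp add: theta_hat_push[OF iso q])
    then show "P (\<phi> q) (map (pushforward A \<phi> q) vs) = \<epsilon>' * \<epsilon> * P q vs"
      using \<epsilon>(1) \<epsilon>(2)[OF vs] by auto
  qed
qed

end

section \<open>Alternating forms\<close>

definition alternating_form :: "'v::real_vector set \<Rightarrow> nat \<Rightarrow> ('v list \<Rightarrow> real) \<Rightarrow> bool" where
  "alternating_form V n \<omega> \<longleftrightarrow>
     (\<forall>vs. length vs = n \<and> set vs \<subseteq> V \<longrightarrow>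
        (\<forall>i<n. \<forall>u\<in>V. \<forall>w\<in>V. \<forall>a b. \<omega> (vs[i := a *\<^sub>R u + b *\<^sub>R w]) = a * \<omega> (vs[i := u]) + b * \<omega> (vs[i := w])) \<and>
        (\<forall>i<n. \<forall>j<n. i \<noteq> j \<and> vs ! i = vs ! j \<longrightarrow> \<omega> vs = 0))"

lemma alternating_form_linear:
  assumes "alternating_form V n \<omega>" "length vs = n" "set vs \<subseteq> V" "i < n" "u \<in> V" "w \<in> V"
  shows "\<omega> (vs[i := a *\<^sub>R u + b *\<^sub>R w]) = a * \<omega> (vs[i := u]) + b * \<omega> (vs[i := w])"
  using assms unfolding alternating_form_def by blast

lemma alternating_form_repeat:
  assumes "alternating_form V n \<omega>" "length vs = n" "set vs \<subseteq> V" "i < n" "j < n" "i \<noteq> j" "vs ! i = vs ! j"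
  shows "\<omega> vs = 0"
  using assms unfolding alternating_form_def by blast

lemma alternating_form_sum:
  assumes \<omega>: "alternating_form V n \<omega>" and V: "subspace V" and vs: "length vs = n" "set vs \<subseteq> V" "i < n"
    and I: "finite I" "\<And>l. l \<in> I \<Longrightarrow> u l \<in> V"
  shows "\<omega> (vs[i := \<Sum>l\<in>I. c l *\<^sub>R u l]) = (\<Sum>l\<in>I. c l * \<omega> (vs[i := u l]))"
  using I
proof (induction I)
  case empty
  then show ?case
    using alternating_form_linear[OF \<omega> vs, of 0 0 0 0] subspace_0[OF V] by simp
next
  case (insert l I)
  have "\<omega> (vs[i := c l *\<^sub>R u l + 1 *\<^sub>R (\<Sum>l\<in>I. c l *\<^sub>R u l)]) =
      c l * \<omega> (vs[i := u l]) + 1 * \<omega> (vs[i := \<Sum>l\<in>I. c l *\<^sub>R u l])"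
    using insert.prems by (intro alternating_form_linear[OF \<omega> vs] subspace_sum[OF V] subspace_scale[OF V]) auto
  then show ?case using insert by simp
qed

text \<open>Expand \<open>0 = \<omega> (\<dots>, x + y, \<dots>, x + y, \<dots>)\<close>.\<close>

lemma alternating_form_swap:
  assumes \<omega>: "alternating_form V n \<omega>" and V: "subspace V" and vs: "length vs = n" "set vs \<subseteq> V"
    and ab: "a < n" "b < n" "a \<noteq> b"
  shows "\<omega> (vs[a := vs ! b, b := vs ! a]) = - \<omega> vs"
proof -
  let ?x = "vs ! a" and ?y = "vs ! b"
  have V': "?x \<in> V" "?y \<in> V" "?x + ?y \<in> V" using vs ab subspace_add[OF V] by (auto dest!: nth_mem)
  have mem: "set (vs[i := u]) \<subseteq> V" if "u \<in> V" for i u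
    using set_update_subset_insert[of vs i u] vs(2) that by blast
  have split: "\<omega> (us[i := ?x + ?y]) = \<omega> (us[i := ?x]) + \<omega> (us[i := ?y])"
    if "length us = n" "set us \<subseteq> V" "i < n" for us i
    using alternating_form_linear[OF \<omega> that V'(1,2), of 1 1] by simp
  have eq0: "\<omega> (vs[a := u, b := u]) = 0" if "u \<in> V" for u
    using that ab vs mem[OF that] set_update_subset_insert[of "vs[a := u]" b u]
    by (intro alternating_form_repeat[OF \<omega>, of _ a b]) auto
  have upd: "vs[a := u, b := ?y] = vs[a := u]" for u
    using ab(3) by (metis list_update_id list_update_swap)
  have "0 = \<omega> (vs[a := ?x + ?y, b := ?x + ?y])" using eq0[OF V'(3)] by simp
  also have "\<dots> = \<omega> (vs[a := ?x + ?y, b := ?x]) + \<omega> (vs[a := ?x + ?y, b := ?y])"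
    using vs ab mem[OF V'(3)] by (intro split) auto
  also have "\<omega> (vs[a := ?x + ?y, b := ?x]) = \<omega> (vs[b := ?x, a := ?x + ?y])"
    using ab by (simp add: list_update_swap)
  also have "\<dots> = \<omega> (vs[a := ?x, b := ?x]) + \<omega> (vs[a := ?y, b := ?x])"
    using split[of "vs[b := ?x]" a] vs ab mem[OF V'(1)] by (simp add: list_update_swap)
  also have "\<omega> (vs[a := ?x + ?y, b := ?y]) = \<omega> (vs[b := ?y, a := ?x + ?y])"
    using ab by (simp add: list_update_swap)
  also have "\<dots> = \<omega> (vs[a := ?x, b := ?y]) + \<omega> (vs[a := ?y, b := ?y])"
    using split[of "vs[b := ?y]" a] vs ab mem[OF V'(2)] by (simp add: list_update_swap upd)
  finally show ?thesis using eq0[OF V'(1)] eq0[OF V'(2)] by simp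
qed

text \<open>A permutation is a product of transpositions, each of which changes the sign.\<close>

lemma alternating_form_permute:
  assumes \<omega>: "alternating_form V n \<omega>" and V: "subspace V" and p: "p permutes {..<n}"
    and vs: "length vs = n" "set vs \<subseteq> V" and nz: "\<omega> vs \<noteq> 0"
  shows "\<omega> (permute_list p vs) \<noteq> 0"
  using p finite_lessThan vs nz
proof (induction arbitrary: vs rule: permutes_induct)
  case id
  then show ?case by simp
next
  case (swap a b p)
  let ?us = "permute_list (Transposition.transpose a b) vs"
  have us: "?us = vs[a := vs ! b, b := vs ! a]"
    using swap by (intro nth_equalityI) (auto simp: permute_list_def nth_list_update transpose_def)
  have "permute_list (Transposition.transpose a b \<circ> p) vs = permute_list p ?us"
    using swap by (intro permute_list_compose) auto
  moreover have "\<omega> (permute_list p ?us) \<noteq> 0"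
  proof (rule swap.IH)
    show "length ?us = n" using swap.prems by simp
    show "set ?us \<subseteq> V" using swap by (simp add: permutes_swap_id)
    show "\<omega> ?us \<noteq> 0" unfolding us using swap alternating_form_swap[OF \<omega> V, of vs a b] by simp
  qed
  ultimately show ?case by (simp only: not_False_eq_True)
qed

lemma span_list:
  assumes "v \<in> span (set vs)"
  shows "\<exists>c. v = (\<Sum>l<length vs. c l *\<^sub>R vs ! l)"
proof -
  have "span (set vs) \<subseteq> {v. \<exists>c. v = (\<Sum>l<length vs. c l *\<^sub>R vs ! l)}" (is "_ \<subseteq> ?S")
  proof (rule span_minimal)
    show "set vs \<subseteq> ?S"
    proof
      fix v assume "v \<in> set vs"
      then obtain k where k: "k < length vs" "v = vs ! k" by (auto simp: in_set_conv_nth)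
      have "(\<Sum>l<length vs. (if l = k then 1 else 0) *\<^sub>R vs ! l) = (\<Sum>l<length vs. if l = k then vs ! l else 0)"
        by (intro sum.cong) auto
      also have "\<dots> = v" using k by simp
      finally show "v \<in> ?S" by (intro CollectI exI[of _ "\<lambda>l. if l = k then 1 else 0"]) simp
    qed
    show "subspace ?S"
    proof (rule subspaceI)
      show "0 \<in> ?S" by (intro CollectI exI[of _ "\<lambda>l. 0"]) simp
      show "u + w \<in> ?S" if uw: "u \<in> ?S" "w \<in> ?S" for u w
      proof -
        obtain c d where "u = (\<Sum>l<length vs. c l *\<^sub>R vs ! l)" "w = (\<Sum>l<length vs. d l *\<^sub>R vs ! l)"
          using uw by blast
        then show ?thesis
          by (intro CollectI exI[of _ "\<lambda>l. c l + d l"]) (simp only: scaleR_left_distrib sum.distrib)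
      qed
      show "r *\<^sub>R u \<in> ?S" if ru: "u \<in> ?S" for r u
      proof -
        obtain c where "u = (\<Sum>l<length vs. c l *\<^sub>R vs ! l)" using ru by blast
        then show ?thesis
          by (intro CollectI exI[of _ "\<lambda>l. r * c l"]) (simp only: scaleR_right.sum scaleR_scaleR)
      qed
    qed
  qed
  then show ?thesis using assms by blast
qed

text \<open>If \<open>\<omega> ws \<noteq> 0\<close>, then the entries of \<open>ws\<close> can be replaced one after the other by entries of \<open>vs\<close>
  without making \<open>\<omega>\<close> vanish: expand the entry in the spanning family and keep a nonzero term. The
  resulting tuple has no repetition, so it is a permutation of \<open>vs\<close>, which contradicts \<open>\<omega> vs = 0\<close>.\<close>

lemma alternating_form_eq_0:
  assumes \<omega>: "alternating_form V n \<omega>" and V: "subspace V"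
    and vs: "length vs = n" "span (set vs) = V" "\<omega> vs = 0" and ws: "length ws = n" "set ws \<subseteq> V"
  shows "\<omega> ws = 0"
proof (rule ccontr)
  assume nz: "\<omega> ws \<noteq> 0"
  have vsV: "set vs \<subseteq> V" using vs(2) span_superset by blast
  have "\<exists>us. length us = n \<and> set us \<subseteq> V \<and> (\<forall>i<k. us ! i \<in> set vs) \<and> \<omega> us \<noteq> 0" if "k \<le> n" for k
    using that
  proof (induction k)
    case 0
    then show ?case using ws nz by auto
  next
    case (Suc k)
    then obtain us where us: "length us = n" "set us \<subseteq> V" "\<forall>i<k. us ! i \<in> set vs" "\<omega> us \<noteq> 0" by auto
    have k: "k < n" using Suc.prems by simp
    have "us ! k \<in> span (set vs)" using us k vs(2) nth_mem by blast
    then obtain c where "us ! k = (\<Sum>l<length vs. c l *\<^sub>R vs ! l)" using span_list by blast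
    then have "\<omega> us = \<omega> (us[k := \<Sum>l<length vs. c l *\<^sub>R vs ! l])" by (metis list_update_id)
    also have "\<dots> = (\<Sum>l<length vs. c l * \<omega> (us[k := vs ! l]))"
      using vsV by (intro alternating_form_sum[OF \<omega> V us(1,2) k]) auto
    finally obtain l where l: "l < length vs" "\<omega> (us[k := vs ! l]) \<noteq> 0"
      using us(4) by (metis (no_types, lifting) lessThan_iff mult_zero_right sum.neutral)
    have "set (us[k := vs ! l]) \<subseteq> V"
      using set_update_subset_insert[of us k "vs ! l"] us(2) l(1) vsV nth_mem by blast
    then show ?case
      using us l k by (intro exI[of _ "us[k := vs ! l]"]) (auto simp: nth_list_update less_Suc_eq)
  qed
  then obtain us where us: "length us = n" "set us \<subseteq> V" "\<forall>i<n. us ! i \<in> set vs" "\<omega> us \<noteq> 0" by blast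
  have dist: "distinct us"
    using alternating_form_repeat[OF \<omega> us(1,2)] us(1,4) unfolding distinct_conv_nth by blast
  moreover have "set us \<subseteq> set vs" using us(1,3) by (auto simp: in_set_conv_nth)
  moreover have "card (set us) = n" using dist us(1) by (simp add: distinct_card)
  ultimately have "set us = set vs" using card_length[of vs] vs(1) by (intro card_subset_eq) (auto intro: antisym card_mono)
  moreover from this have "distinct vs" using \<open>card (set us) = n\<close> vs(1) by (simp add: card_distinct)
  ultimately have "mset vs = mset us" using dist set_eq_iff_mset_eq_distinct by metis
  then obtain p where "p permutes {..<length us}" "permute_list p us = vs" by (rule mset_eq_permutation)
  then show False using alternating_form_permute[OF \<omega> V _ us(1,2,4)] us(1) vs(3) by auto
qed

text \<open>The form \<open>\<beta> vs \<cdot> \<alpha> - \<alpha> vs \<cdot> \<beta>\<close> vanishes on \<open>vs\<close>, hence everywhere.\<close>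

lemma alternating_form_ratio:
  assumes \<alpha>: "alternating_form V n \<alpha>" and \<beta>: "alternating_form V n \<beta>" and V: "subspace V"
    and vs: "length vs = n" "span (set vs) = V" "\<beta> vs \<noteq> 0" and ws: "length ws = n" "set ws \<subseteq> V"
  shows "\<alpha> ws = \<alpha> vs / \<beta> vs * \<beta> ws"
proof -
  have "alternating_form V n (\<lambda>us. \<beta> vs * \<alpha> us - \<alpha> vs * \<beta> us)"
    unfolding alternating_form_def
    using alternating_form_linear[OF \<alpha>] alternating_form_linear[OF \<beta>]
      alternating_form_repeat[OF \<alpha>] alternating_form_repeat[OF \<beta>]
    by (auto simp: algebra_simps)
  from alternating_form_eq_0[OF this V vs(1,2) _ ws] show ?thesis using vs(3) by (simp add: field_simps)
qed

section \<open>Adapted bases\<close>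

lemma extend_to_basis:
  assumes B: "finite B" "W \<subseteq> span B" and W: "subspace W"
    and vs: "distinct vs" "independent (set vs)" "set vs \<subseteq> W"
  obtains ws where "distinct (vs @ ws)" "independent (set (vs @ ws))" "span (set (vs @ ws)) = W"
    "length (vs @ ws) = dim W"
proof -
  obtain C where C: "set vs \<subseteq> C" "C \<subseteq> W" "independent C" "W \<subseteq> span C"
    using maximal_independent_subset_extend[OF vs(3,2)] by blast
  have "finite C" using independent_span_bound[OF B(1) C(3)] C(2) B(2) by blast
  then obtain ws where ws: "set ws = C - set vs" "distinct ws" using finite_distinct_list[of "C - set vs"] by auto
  have sC: "set (vs @ ws) = C" using ws C(1) by auto
  have d: "distinct (vs @ ws)" using ws vs(1) by auto
  have sp: "span C = W" using C W by (metis span_minimal subset_antisym)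
  moreover have "length (vs @ ws) = dim W"
    using dim_eq_card[of C W] distinct_card[OF d] sC sp C(3) span_eq_iff[of W] W by metis
  ultimately show ?thesis using that d C(3) sC by metis
qed

lemma dim_subset_finite:
  assumes "finite B" "W \<subseteq> span B" "subspace V" "subspace W" "V \<subseteq> W"
  shows "dim V \<le> dim W"
proof -
  obtain vs where vs: "distinct vs" "independent (set vs)" "span (set vs) = V" "length vs = dim V"
  proof (rule extend_to_basis[OF assms(1) _ assms(3), of "[]"])
    show "V \<subseteq> span B" using assms by blast
  qed (simp_all add: independent_empty)
  have "set vs \<subseteq> W" using vs(3) assms(5) span_superset by blast
  then obtain ws where "length (vs @ ws) = dim W"
    using extend_to_basis[OF assms(1,2,4) vs(1,2)] by blast
  then show ?thesis using vs(4) by simp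
qed

lemma subspace_dim_equal_finite:
  assumes "finite B" "W \<subseteq> span B" "subspace V" "subspace W" "V \<subseteq> W" "dim V = dim W"
  shows "V = W"
proof -
  obtain vs where vs: "distinct vs" "independent (set vs)" "span (set vs) = V" "length vs = dim V"
  proof (rule extend_to_basis[OF assms(1) _ assms(3), of "[]"])
    show "V \<subseteq> span B" using assms by blast
  qed (simp_all add: independent_empty)
  have "set vs \<subseteq> W" using vs(3) assms(5) span_superset by blast
  then obtain ws where "length (vs @ ws) = dim W" "span (set (vs @ ws)) = W"
    using extend_to_basis[OF assms(1,2,4) vs(1,2)] by blast
  then show ?thesis using vs(3,4) assms(6) by simp
qed

context manifold_atlas
begin

lemma finite_tangent_basis: obtains B where "finite B" "tangent_space A q = span B"
proof -
  obtain U x where U: "(U, x) \<in> A" "q \<in> U" by (rule chart_at)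
  show ?thesis by (rule that[of "chart_vec A U x q ` Basis"]) (simp_all add: chart_vec_basis(2)[OF U])
qed

end

context equiregular_sub_riemannian
begin

lemma flag_dim_mono:
  assumes "i \<le> j"
  shows "dim (flag A D i q) \<le> dim (flag A D j q)"
proof -
  obtain B where B: "finite B" "tangent_space A q = span B" by (rule finite_tangent_basis)
  show ?thesis
    by (rule dim_subset_finite[OF B(1) _ subspace_flag subspace_flag flag_mono[OF assms]])
       (use flag_tangent B(2) in blast)
qed

lemma flag_dim_le: "dim (flag A D i q) \<le> DIM('e)"
proof -
  obtain B where B: "finite B" "tangent_space A q = span B" by (rule finite_tangent_basis)
  show ?thesis
    using dim_subset_finite[OF B(1) _ subspace_flag subspace_tangent_space flag_tangent] B(2)
    by (simp add: dim_tangent_space)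
qed

text \<open>Extend a basis of each member of the flag to a basis of the next one.\<close>

lemma adapted_basis_upto:
  "\<exists>vs. distinct vs \<and> independent (set vs) \<and> length vs = dim (flag A D i q) \<and>
     (\<forall>j\<le>i. span (set (take (dim (flag A D j q)) vs)) = flag A D j q)"
proof (induction i)
  case 0
  have "dim {0 :: 'm tvec} = 0" using dim_eq_card[of "{}" "{0 :: 'm tvec}"] independent_empty by simp
  then show ?case by (intro exI[of _ "[]"]) (simp add: independent_empty)
next
  case (Suc i)
  obtain B where B: "finite B" "tangent_space A q = span B" by (rule finite_tangent_basis)
  obtain vs where vs: "distinct vs" "independent (set vs)" "length vs = dim (flag A D i q)"
    "\<And>j. j \<le> i \<Longrightarrow> span (set (take (dim (flag A D j q)) vs)) = flag A D j q" using Suc by blast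
  have "set vs \<subseteq> flag A D i q" using vs(4)[of i] vs(3) span_superset[of "set vs"] by simp
  then have "set vs \<subseteq> flag A D (Suc i) q" using flag_Suc by blast
  then obtain ws where ws: "distinct (vs @ ws)" "independent (set (vs @ ws))"
    "span (set (vs @ ws)) = flag A D (Suc i) q" "length (vs @ ws) = dim (flag A D (Suc i) q)"
    using extend_to_basis[OF B(1) _ subspace_flag vs(1,2)] flag_tangent B(2) by blast
  have "span (set (take (dim (flag A D j q)) (vs @ ws))) = flag A D j q" if "j \<le> Suc i" for j
  proof (cases "j = Suc i")
    case True
    then show ?thesis using ws(3) by (simp add: ws(4)[symmetric])
  next
    case False
    then have "j \<le> i" using that by simp
    then show ?thesis using vs(3) vs(4)[of j] flag_dim_mono[of j i q] by simp
  qed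
  then show ?case using ws by blast
qed

text \<open>The dimensions of the flag increase and are bounded, so the flag is constant from some degree
  \<open>N\<close> on. A basis which is adapted up to degree \<open>N\<close> is adapted in all degrees, also after it has been
  completed to a basis of the tangent space.\<close>

lemma adapted_basis_exists: "\<exists>vs. adapted_basis A D q vs"
proof -
  obtain B where B: "finite B" "tangent_space A q = span B" by (rule finite_tangent_basis)
  obtain N where N: "\<And>i. dim (flag A D i q) \<le> dim (flag A D N q)"
    using ex_has_greatest_nat[of "\<lambda>_. True" 0 "\<lambda>i. dim (flag A D i q)" "Suc DIM('e)"]
    le_imp_less_Suc[OF flag_dim_le] by auto
  have N': "flag A D i q = flag A D N q" if "N \<le> i" for i
    using subspace_dim_equal_finite[OF B(1) _ subspace_flag subspace_flag flag_mono[OF that, of q]]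
      flag_tangent[of i q] B(2) N[of i] flag_dim_mono[OF that, of q] by (simp add: antisym)
  obtain vs where vs: "distinct vs" "independent (set vs)" "length vs = dim (flag A D N q)"
    "\<And>j. j \<le> N \<Longrightarrow> span (set (take (dim (flag A D j q)) vs)) = flag A D j q"
    using adapted_basis_upto by blast
  have "set vs \<subseteq> flag A D N q" using vs(4)[of N] vs(3) span_superset[of "set vs"] by simp
  then have "set vs \<subseteq> tangent_space A q" using flag_tangent by blast
  then obtain ws where ws: "distinct (vs @ ws)" "independent (set (vs @ ws))"
    "span (set (vs @ ws)) = tangent_space A q" "length (vs @ ws) = dim (tangent_space A q)"
    using extend_to_basis[OF B(1) _ subspace_tangent_space vs(1,2)] B(2) by blast
  have "span (set (take (dim (flag A D i q)) (vs @ ws))) = flag A D i q" for i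
  proof (cases "i \<le> N")
    case True
    then show ?thesis using vs(3) vs(4)[OF True] flag_dim_mono[OF True, of q] by simp
  next
    case False
    then show ?thesis using vs(3) vs(4)[of N] N'[of i] by simp
  qed
  then show ?thesis using ws unfolding adapted_basis_def dim_tangent_space by blast
qed

end

section \<open>Popp's volume does not vanish\<close>

lemma coset_eqI:
  assumes W: "subspace W" and ab: "a - b \<in> W"
  shows "coset W a = coset W b"
proof -
  have "coset W a \<subseteq> coset W b" if "a - b \<in> W" for a b
  proof
    fix y assume "y \<in> coset W a"
    then obtain w where "w \<in> W" "y = a + w" unfolding coset_def by blast
    then have "(a - b) + w \<in> W" "y = b + ((a - b) + w)" using subspace_add[OF W that, of w] by simp_all
    then show "y \<in> coset W b" unfolding coset_def by blast
  qed
  moreover have "b - a \<in> W" using subspace_neg[OF W ab] by simp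
  ultimately show ?thesis using ab by blast
qed

lemma coset_comb_cosets:
  assumes W: "subspace W"
  shows "coset_comb W cs (map (coset W) us) = coset W (\<Sum>j<length us. cs ! j *\<^sub>R us ! j)"
proof
  show "coset_comb W cs (map (coset W) us) \<subseteq> coset W (\<Sum>j<length us. cs ! j *\<^sub>R us ! j)"
  proof
    fix y assume "y \<in> coset_comb W cs (map (coset W) us)"
    then obtain a w where a: "\<forall>j<length us. a j \<in> coset W (us ! j)" "w \<in> W"
      "y = (\<Sum>j<length us. cs ! j *\<^sub>R a j) + w" unfolding coset_comb_def by auto
    from a(1) have "\<forall>j. \<exists>v. j < length us \<longrightarrow> v \<in> W \<and> a j = us ! j + v" unfolding coset_def by blast
    then obtain v where v: "\<And>j. j < length us \<Longrightarrow> v j \<in> W \<and> a j = us ! j + v j" by metis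
    have "(\<Sum>j<length us. cs ! j *\<^sub>R a j) = (\<Sum>j<length us. cs ! j *\<^sub>R us ! j + cs ! j *\<^sub>R v j)"
      using v by (intro sum.cong) (auto simp: scaleR_right_distrib)
    then have "y = (\<Sum>j<length us. cs ! j *\<^sub>R us ! j) + ((\<Sum>j<length us. cs ! j *\<^sub>R v j) + w)"
      unfolding a(3) by (simp only: sum.distrib add.assoc)
    moreover have "(\<Sum>j<length us. cs ! j *\<^sub>R v j) + w \<in> W"
      using v a(2) by (intro subspace_add[OF W] subspace_sum[OF W] subspace_scale[OF W]) auto
    ultimately show "y \<in> coset W (\<Sum>j<length us. cs ! j *\<^sub>R us ! j)" unfolding coset_def by blast
  qed
  have "us ! j \<in> coset W (us ! j)" for j
    unfolding coset_def using subspace_0[OF W] by (intro CollectI exI[of _ 0]) simp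
  then show "coset W (\<Sum>j<length us. cs ! j *\<^sub>R us ! j) \<subseteq> coset_comb W cs (map (coset W) us)"
    unfolding coset_comb_def coset_def[of _ "sum _ _"] by fastforce
qed

context equiregular_sub_riemannian
begin

text \<open>The element of the graded space with representatives \<open>y i\<close>. Linear combinations of cosets become
  linear combinations of representatives.\<close>

definition gr_of :: "'m \<Rightarrow> (nat \<Rightarrow> 'm tvec) \<Rightarrow> 'm gr_elem" where
  "gr_of q y = (\<lambda>i\<in>{1..sr_step A D}. coset (flag A D (i - 1) q) (y i))"

lemma gr_of_mem: "(\<And>i. y i \<in> flag A D i q) \<Longrightarrow> gr_of q y \<in> gr A D q"
  by (auto simp: gr_of_def gr_def flag_quot_def)

lemma gr_of_surj:
  assumes Y: "Y \<in> gr A D q"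
  obtains y where "\<And>i. y i \<in> flag A D i q" "Y = gr_of q y"
proof -
  have PiE: "Y \<in> (\<Pi>\<^sub>E i\<in>{1..sr_step A D}. flag_quot A D q i)" using Y unfolding gr_def .
  have "\<exists>v. v \<in> flag A D i q \<and> (i \<in> {1..sr_step A D} \<longrightarrow> Y i = coset (flag A D (i - 1) q) v)" for i
    using PiE_mem[OF PiE, of i] subspace_0[OF subspace_flag, of i q] unfolding flag_quot_def by blast
  then obtain y where y: "\<And>i. y i \<in> flag A D i q"
    "\<And>i. i \<in> {1..sr_step A D} \<Longrightarrow> Y i = coset (flag A D (i - 1) q) (y i)" by metis
  have "Y = gr_of q y"
  proof
    show "Y i = gr_of q y i" for i using y(2)[of i] PiE_arb[OF PiE, of i] by (auto simp: gr_of_def)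
  qed
  then show ?thesis using that y(1) by blast
qed

lemma gr_comb_gr_of:
  "gr_comb A D q cs (map (gr_of q) ys) = gr_of q (\<lambda>i. \<Sum>j<length ys. cs ! j *\<^sub>R (ys ! j) i)"
proof
  fix i
  show "gr_comb A D q cs (map (gr_of q) ys) i = gr_of q (\<lambda>i. \<Sum>j<length ys. cs ! j *\<^sub>R (ys ! j) i) i"
  proof (cases "i \<in> {1..sr_step A D}")
    case True
    let ?W = "flag A D (i - 1) q"
    have "map (\<lambda>Y. Y i) (map (gr_of q) ys) = map (coset ?W) (map (\<lambda>y. y i) ys)"
      using True by (simp add: gr_of_def)
    then have "gr_comb A D q cs (map (gr_of q) ys) i = coset_comb ?W cs (map (coset ?W) (map (\<lambda>y. y i) ys))"
      using True unfolding gr_comb_def by (simp only: restrict_apply if_True)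
    also have "\<dots> = coset ?W (\<Sum>j<length (map (\<lambda>y. y i) ys). cs ! j *\<^sub>R (map (\<lambda>y. y i) ys) ! j)"
      by (rule coset_comb_cosets[OF subspace_flag])
    also have "(\<Sum>j<length (map (\<lambda>y. y i) ys). cs ! j *\<^sub>R (map (\<lambda>y. y i) ys) ! j) = (\<Sum>j<length ys. cs ! j *\<^sub>R (ys ! j) i)"
      by (intro sum.cong) auto
    finally show ?thesis
      using True unfolding gr_of_def[of q "\<lambda>i. \<Sum>j<length ys. cs ! j *\<^sub>R (ys ! j) i"] by simp
  qed (simp only: gr_comb_def gr_of_def restrict_apply if_False)
qed

text \<open>Linearity is assumed for combinations of two elements; on representatives it extends to
  finite sums by induction.\<close>

lemma gr_linear_comb:
  assumes \<nu>: "gr_linear A D q \<nu>" and Ys: "set Ys \<subseteq> gr A D q"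
  shows "\<nu> (gr_comb A D q cs Ys) = (\<Sum>j<length Ys. cs ! j * \<nu> (Ys ! j))"
proof -
  have "\<forall>Y\<in>set Ys. \<exists>y. (\<forall>i. y i \<in> flag A D i q) \<and> Y = gr_of q y" using Ys gr_of_surj by blast
  then obtain y where y: "\<And>Y i. Y \<in> set Ys \<Longrightarrow> y Y i \<in> flag A D i q" "\<And>Y. Y \<in> set Ys \<Longrightarrow> Y = gr_of q (y Y)"
    by metis
  define ys where "ys = map y Ys"
  have ys: "Ys = map (gr_of q) ys" "length ys = length Ys"
    using y(2) by (simp_all add: ys_def map_idI[symmetric])
  have fam: "(ys ! j) i \<in> flag A D i q" if "j < length Ys" for j i using y(1) that by (simp add: ys_def)
  let ?L = "\<lambda>y. \<nu> (gr_of q y)"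
  have lin: "?L (\<lambda>i. a *\<^sub>R y i + b *\<^sub>R z i) = a * ?L y + b * ?L z"
    if "\<And>i. y i \<in> flag A D i q" "\<And>i. z i \<in> flag A D i q" for y z a b
  proof -
    have "\<nu> (gr_comb A D q [a, b] [gr_of q y, gr_of q z]) = a * ?L y + b * ?L z"
      using \<nu> gr_of_mem[OF that(1)] gr_of_mem[OF that(2)] unfolding gr_linear_def by blast
    moreover have "gr_comb A D q [a, b] [gr_of q y, gr_of q z] = gr_of q (\<lambda>i. a *\<^sub>R y i + b *\<^sub>R z i)"
      using gr_comb_gr_of[of q "[a, b]" "[y, z]"] by (simp add: lessThan_Suc add.commute)
    ultimately show ?thesis by simp
  qed
  have zero: "?L (\<lambda>i. 0) = 0"
    using lin[of "\<lambda>i. 0" "\<lambda>i. 0" 0 0] subspace_0[OF subspace_flag] by simp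
  have "?L (\<lambda>i. \<Sum>j<k. cs ! j *\<^sub>R (ys ! j) i) = (\<Sum>j<k. cs ! j * ?L (ys ! j))" if "k \<le> length Ys" for k
    using that
  proof (induction k)
    case 0
    show ?case by (simp only: lessThan_0 sum.empty zero)
  next
    case (Suc k)
    have "?L (\<lambda>i. 1 *\<^sub>R (\<Sum>j<k. cs ! j *\<^sub>R (ys ! j) i) + cs ! k *\<^sub>R (ys ! k) i) =
        1 * ?L (\<lambda>i. \<Sum>j<k. cs ! j *\<^sub>R (ys ! j) i) + cs ! k * ?L (ys ! k)"
      using Suc.prems fam by (intro lin subspace_sum[OF subspace_flag] subspace_scale[OF subspace_flag]) auto
    moreover have "?L (\<lambda>i. \<Sum>j<k. cs ! j *\<^sub>R (ys ! j) i) = (\<Sum>j<k. cs ! j * ?L (ys ! j))"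
      using Suc by simp
    ultimately show ?case by (simp only: sum.lessThan_Suc scaleR_one mult_1)
  qed
  from this[of "length Ys"] show ?thesis
    unfolding ys(1) gr_comb_gr_of by (simp add: ys(2))
qed

lemma theta_hat_gr_of:
  "theta_hat A D q vs = map (gr_of q) (map (\<lambda>l i. if dim (flag A D (i - 1) q) \<le> l \<and> l < dim (flag A D i q)
     then vs ! l else 0) [0..<length vs])"
  unfolding theta_hat_def gr_of_def by simp

text \<open>Write the component in degree \<open>i\<close> of an element of the graded space in terms of the first \<open>d\<^sub>i\<close>
  basis vectors, where \<open>d\<^sub>i = dim \<D>\<^sup>i\<close>. The first \<open>d\<^sub>i\<^sub>-\<^sub>1\<close> of them vanish in the quotient. The others form a block
  of indices; the blocks of different degrees are disjoint, so the coefficients found in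
  the different degrees can be put together to one list.\<close>

lemma theta_hat_spans:
  assumes vs: "adapted_basis A D q vs" and Y: "Y \<in> gr A D q"
  obtains cs where "length cs = DIM('e)" "Y = gr_comb A D q cs (theta_hat A D q vs)"
proof -
  let ?d = "\<lambda>i. dim (flag A D i q)"
  note vs' = vs[unfolded adapted_basis_def]
  obtain y where y: "\<And>i. y i \<in> flag A D i q" "Y = gr_of q y" using gr_of_surj[OF Y] by blast
  have "\<exists>c. y i = (\<Sum>l<?d i. c l *\<^sub>R vs ! l)" for i
  proof -
    have "length (take (?d i) vs) = ?d i" using vs' flag_dim_le[of i q] by simp
    moreover have "y i \<in> span (set (take (?d i) vs))" using vs' y(1) by simp
    ultimately have "\<exists>c. y i = (\<Sum>l<?d i. c l *\<^sub>R take (?d i) vs ! l)"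
      using span_list[of "y i" "take (?d i) vs"] by simp
    then show ?thesis by simp
  qed
  then obtain c where c: "\<And>i. y i = (\<Sum>l<?d i. c i l *\<^sub>R vs ! l)" by metis
  \<comment> \<open>The degree of the block which contains the index \<open>l\<close>.\<close>
  define deg where "deg l = (LEAST i. l < ?d i)" for l
  have deg: "deg l = i" if "?d (i - 1) \<le> l" "l < ?d i" for l i
    unfolding deg_def
  proof (rule Least_equality)
    show "l < ?d i" by (rule that(2))
    fix j assume "l < ?d j"
    then show "i \<le> j" using flag_dim_mono[of j "i - 1" q] that(1) by (cases "j \<le> i - 1") auto
  qed
  define cs where "cs = map (\<lambda>l. c (deg l) l) [0..<DIM('e)]"
  let ?z = "\<lambda>l i. if ?d (i - 1) \<le> l \<and> l < ?d i then vs ! l else 0"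
  have "gr_comb A D q cs (theta_hat A D q vs) = gr_of q (\<lambda>i. \<Sum>l<DIM('e). cs ! l *\<^sub>R ?z l i)"
    unfolding theta_hat_gr_of gr_comb_gr_of using vs' by (intro arg_cong[of _ _ "gr_of q"] ext sum.cong) auto
  also have "\<dots> = gr_of q y"
    unfolding gr_of_def
  proof (rule restrict_ext)
    fix i
    have "(\<Sum>l<DIM('e). cs ! l *\<^sub>R ?z l i) = (\<Sum>l\<in>{?d (i - 1)..<?d i}. c i l *\<^sub>R vs ! l)"
      using flag_dim_le[of i q] deg
      by (intro sum.mono_neutral_cong_right) (auto simp: cs_def)
    moreover have "y i = (\<Sum>l<?d (i - 1). c i l *\<^sub>R vs ! l) + (\<Sum>l\<in>{?d (i - 1)..<?d i}. c i l *\<^sub>R vs ! l)"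
      unfolding c[of i] using flag_dim_mono[of "i - 1" i q]
      by (subst sum.union_disjoint[symmetric]) (auto intro!: sum.cong)
    ultimately have "(\<Sum>l<DIM('e). cs ! l *\<^sub>R ?z l i) - y i = - (\<Sum>l<?d (i - 1). c i l *\<^sub>R vs ! l)"
      by simp
    moreover have "(\<Sum>l<?d (i - 1). c i l *\<^sub>R vs ! l) \<in> flag A D (i - 1) q"
    proof (intro subspace_sum[OF subspace_flag] subspace_scale[OF subspace_flag])
      fix l assume "l \<in> {..<?d (i - 1)}"
      then have "vs ! l \<in> set (take (?d (i - 1)) vs)"
        using vs' flag_dim_le[of "i - 1" q] by (auto simp: in_set_conv_nth)
      then show "vs ! l \<in> flag A D (i - 1) q" using vs' span_base by metis
    qed
    ultimately show "coset (flag A D (i - 1) q) (\<Sum>l<DIM('e). cs ! l *\<^sub>R ?z l i) = coset (flag A D (i - 1) q) (y i)"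
      by (intro coset_eqI[OF subspace_flag]) (simp only: subspace_neg[OF subspace_flag])
  qed
  finally show ?thesis using that[of cs] y(2) by (simp add: cs_def)
qed

text \<open>Expand the orthonormal basis in the classes of the adapted basis, with coefficient matrix \<open>M\<close>, and
  let \<open>N\<close> be the matrix of the values of the dual basis on these classes. Duality says \<open>M N = 1\<close>, so
  \<open>det N \<noteq> 0\<close>, and \<open>det N\<close> is the value of the wedge product.\<close>

lemma popp_mu_nonzero:
  assumes \<mu>: "popp_mu A D g q \<mu>" and vs: "adapted_basis A D q vs"
  shows "\<mu> (theta_hat A D q vs) \<noteq> 0"
proof -
  let ?n = "DIM('e)" and ?\<theta> = "theta_hat A D q vs"
  obtain es \<nu>s where es: "gr_orthonormal_basis A D g q es" "gr_dual_basis A D q es \<nu>s" "\<mu> = wedge \<nu>s"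
    using \<mu> unfolding popp_mu_def by blast
  have len: "length es = ?n" "length \<nu>s = ?n" "length ?\<theta> = ?n"
    using es vs by (auto simp: gr_orthonormal_basis_def gr_dual_basis_def adapted_basis_def theta_hat_def)
  have "\<exists>cs. es ! m = gr_comb A D q cs ?\<theta>" if "m < ?n" for m
  proof -
    have "es ! m \<in> gr A D q" using es(1) that by (auto simp: gr_orthonormal_basis_def)
    then show ?thesis using theta_hat_spans[OF vs] by metis
  qed
  then obtain C where C: "\<And>m. m < ?n \<Longrightarrow> es ! m = gr_comb A D q (C m) ?\<theta>" by metis
  define M where "M = Matrix.mat ?n ?n (\<lambda>(m, l). C m ! l)"
  define N where "N = Matrix.mat ?n ?n (\<lambda>(l, j). (\<nu>s ! j) (?\<theta> ! l))"
  have "M * N = 1\<^sub>m ?n"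
  proof (rule eq_matI)
    fix m j assume "m < dim_row (1\<^sub>m ?n)" "j < dim_col (1\<^sub>m ?n)"
    then have mj: "m < ?n" "j < ?n" by auto
    have "gr_linear A D q (\<nu>s ! j)" using es(2) mj len by (auto simp: gr_dual_basis_def)
    then have "(\<nu>s ! j) (es ! m) = (\<Sum>l<?n. C m ! l * (\<nu>s ! j) (?\<theta> ! l))"
      using gr_linear_comb[OF _ theta_hat_mem[OF vs], of "\<nu>s ! j" "C m"] C[OF mj(1)] len(3) by simp
    moreover have "(M * N) $$ (m, j) = (\<Sum>l<?n. C m ! l * (\<nu>s ! j) (?\<theta> ! l))"
      using mj by (simp add: M_def N_def scalar_prod_def atLeast0LessThan)
    ultimately show "(M * N) $$ (m, j) = 1\<^sub>m ?n $$ (m, j)"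
      using es(2) mj len by (auto simp: gr_dual_basis_def)
  qed (simp_all add: M_def N_def)
  moreover have "Determinant.det (M * N) = Determinant.det M * Determinant.det N"
    by (rule det_mult[of _ ?n]) (simp_all add: M_def N_def)
  ultimately have "Determinant.det N \<noteq> 0" by auto
  moreover have "Determinant.det N = wedge \<nu>s ?\<theta>"
  proof -
    have "Determinant.det N = (\<Sum>p | p permutes {..<?n}. signof p * (\<Prod>i<?n. N $$ (i, p i)))"
      unfolding Determinant.det_def by (simp add: N_def atLeast0LessThan)
    also have "\<dots> = wedge \<nu>s ?\<theta>"
      unfolding wedge_def len
    proof (intro sum.cong refl arg_cong2[of _ _ _ _ "(*)"] prod.cong)
      fix p i assume "p \<in> {p. p permutes {..<?n}}" "i \<in> {..<?n}"
      then show "N $$ (i, p i) = (\<nu>s ! p i) (?\<theta> ! i)"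
        using permutes_in_image[of p "{..<?n}" i] by (simp add: N_def)
    qed
    finally show ?thesis .
  qed
  ultimately show ?thesis using es(3) by simp
qed

lemma popp_volume_nonzero:
  assumes "popp_volume A D g P" "adapted_basis A D q vs"
  shows "P q vs \<noteq> 0"
proof -
  obtain \<mu> where \<mu>: "popp_mu A D g q \<mu>" using assms(1) unfolding popp_volume_def by blast
  then obtain \<epsilon> where "\<epsilon> \<in> {1, -1::real}" "P q vs = \<epsilon> * \<mu> (theta_hat A D q vs)"
    using assms unfolding popp_volume_def by meson
  then show ?thesis using popp_mu_nonzero[OF \<mu> assms(2)] by auto
qed

lemma popp_volume_form:
  assumes "popp_volume A D g P"
  shows "volume_form A P"
proof -
  have "\<exists>vs\<in>tangent_tuples A q. P q vs \<noteq> 0" for q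
  proof -
    obtain vs where vs: "adapted_basis A D q vs" using adapted_basis_exists by blast
    then have "vs \<in> tangent_tuples A q"
      using span_superset[of "set vs"] by (simp add: adapted_basis_def tangent_tuples_def)
    then show ?thesis using popp_volume_nonzero[OF assms vs] by blast
  qed
  then show ?thesis using assms unfolding volume_form_def popp_volume_def by blast
qed

end

section \<open>Ratios and pullbacks of forms of top degree\<close>

context manifold_atlas
begin

lemma chart_vec_field_smooth:
  assumes U: "(U, x) \<in> A"
  shows "smooth_vfield_on A U (\<lambda>p. chart_vec A U x p e)"
  unfolding smooth_vfield_on_def
proof (intro conjI ballI allI impI)
  show "open U" by (rule chart_open[OF U])
  show "chart_vec A U x p e \<in> tangent_space A p" if "p \<in> U" for p
    using mem_tangent_space U that by blast
  fix V f assume V: "V \<subseteq> U \<and> smooth_fun_on A V f"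
  show "smooth_fun_on A V (\<lambda>p. chart_vec A U x p e f)"
  proof (rule smooth_fun_onI_local)
    fix q assume q: "q \<in> V"
    have "smooth_on (x ` (U \<inter> V)) (\<lambda>z. frechet_derivative (f \<circ> inv_into U x) (at z) e)"
      using V U by (intro smooth_on_frechet_derivative smooth_fun_onD) auto
    then have "smooth_on (x ` (U \<inter> V)) ((\<lambda>p. chart_vec A U x p e f) \<circ> inv_into U x)"
      by (rule smooth_on_cong) (use U V smooth_nearI in \<open>auto simp: chart_vec_def\<close>)
    then show "\<exists>U' x' W. (U', x') \<in> A \<and> q \<in> U' \<and> q \<in> W \<and> open W \<and> W \<subseteq> V \<and>
        smooth_on (x' ` (U' \<inter> W)) ((\<lambda>p. chart_vec A U x p e f) \<circ> inv_into U' x')"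
      using U V q smooth_fun_on_open[of V f] by (intro exI[of _ U] exI[of _ x] exI[of _ V]) auto
  qed
qed

lemma smooth_formD:
  assumes "smooth_form A \<omega>"
  shows "vs \<in> tangent_tuples A q \<Longrightarrow> i < DIM('e) \<Longrightarrow> u \<in> tangent_space A q \<Longrightarrow> w \<in> tangent_space A q \<Longrightarrow>
      \<omega> q (vs[i := a *\<^sub>R u + b *\<^sub>R w]) = a * \<omega> q (vs[i := u]) + b * \<omega> q (vs[i := w])"
    and "vs \<in> tangent_tuples A q \<Longrightarrow> i < DIM('e) \<Longrightarrow> j < DIM('e) \<Longrightarrow> i \<noteq> j \<Longrightarrow> vs ! i = vs ! j \<Longrightarrow> \<omega> q vs = 0"
    and "open S \<Longrightarrow> length Xs = DIM('e) \<Longrightarrow> (\<And>X. X \<in> set Xs \<Longrightarrow> smooth_vfield_on A S X) \<Longrightarrow>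
      smooth_fun_on A S (\<lambda>p. \<omega> p (map (\<lambda>X. X p) Xs))"
  using assms[unfolded smooth_form_def, THEN conjunct1, rule_format]
    assms[unfolded smooth_form_def, THEN conjunct2, THEN conjunct1, rule_format, OF _ _ _ conjI]
    assms[unfolded smooth_form_def, THEN conjunct2, THEN conjunct2, rule_format, OF conjI, OF _ conjI]
  by simp_all

lemma smooth_formI:
  assumes "\<And>q vs i u w a b. vs \<in> tangent_tuples A q \<Longrightarrow> i < DIM('e) \<Longrightarrow> u \<in> tangent_space A q \<Longrightarrow>
      w \<in> tangent_space A q \<Longrightarrow> \<omega> q (vs[i := a *\<^sub>R u + b *\<^sub>R w]) = a * \<omega> q (vs[i := u]) + b * \<omega> q (vs[i := w])"
    and "\<And>q vs i j. vs \<in> tangent_tuples A q \<Longrightarrow> i < DIM('e) \<Longrightarrow> j < DIM('e) \<Longrightarrow> i \<noteq> j \<Longrightarrow>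
      vs ! i = vs ! j \<Longrightarrow> \<omega> q vs = 0"
    and "\<And>S Xs. open S \<Longrightarrow> length Xs = DIM('e) \<Longrightarrow> (\<And>X. X \<in> set Xs \<Longrightarrow> smooth_vfield_on A S X) \<Longrightarrow>
      smooth_fun_on A S (\<lambda>p. \<omega> p (map (\<lambda>X. X p) Xs))"
  shows "smooth_form A \<omega>"
  unfolding smooth_form_def using assms by (intro conjI allI ballI impI) simp_all

lemma smooth_form_alternating:
  assumes "smooth_form A \<omega>"
  shows "alternating_form (tangent_space A q) DIM('e) (\<omega> q)"
  unfolding alternating_form_def
proof (intro allI impI conjI ballI; (elim conjE)?)
  fix vs i u w a b
  assume vs: "length vs = DIM('e)" "set vs \<subseteq> tangent_space A q" and i: "i < DIM('e)"
  have tup: "vs \<in> tangent_tuples A q" using vs by (simp add: tangent_tuples_def)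
  show "\<omega> q (vs[i := a *\<^sub>R u + b *\<^sub>R w]) = a * \<omega> q (vs[i := u]) + b * \<omega> q (vs[i := w])"
    if "u \<in> tangent_space A q" "w \<in> tangent_space A q"
    by (rule smooth_formD(1)[OF assms tup i that])
  show "\<omega> q vs = 0" if "j < DIM('e)" "i \<noteq> j" "vs ! i = vs ! j" for j
    by (rule smooth_formD(2)[OF assms tup i that])
qed

text \<open>At a point, forms of top degree are proportional. Near a point, the factor is the quotient of the
  values on a frame of coordinate fields, so it is continuous.\<close>

lemma smooth_form_ratio:
  assumes \<alpha>: "smooth_form A \<alpha>" and \<beta>: "volume_form A \<beta>"
  obtains r where "continuous_on UNIV r" "\<And>q vs. vs \<in> tangent_tuples A q \<Longrightarrow> \<alpha> q vs = r q * \<beta> q vs"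
proof -
  \<comment> \<open>The coordinate frame \<open>fr U x p\<close> lists the standard basis in a fixed order.\<close>
  obtain bs :: "'e list" where bs: "set bs = Basis" "distinct bs" using finite_distinct_list[OF finite_Basis] by blast
  have len: "length bs = DIM('e)" using bs distinct_card by metis
  define fr where "fr U x p = map (chart_vec A U x p) bs" for U x p
  have \<beta>': "smooth_form A \<beta>" using \<beta> unfolding volume_form_def by blast
  have fr: "length (fr U x p) = DIM('e)" "span (set (fr U x p)) = tangent_space A p"
    if "(U, x) \<in> A" "p \<in> U" for U x p
    using chart_vec_basis(2)[OF that] bs(1) len by (simp_all add: fr_def)
  have nz: "\<beta> p (fr U x p) \<noteq> 0" if U: "(U, x) \<in> A" "p \<in> U" for U x p
  proof
    assume "\<beta> p (fr U x p) = 0"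
    then have "\<beta> p vs = 0" if "vs \<in> tangent_tuples A p" for vs
      using that alternating_form_eq_0[OF smooth_form_alternating[OF \<beta>'] subspace_tangent_space fr[OF U]]
      unfolding tangent_tuples_def by simp
    then show False using \<beta> unfolding volume_form_def by blast
  qed
  have ratio: "\<alpha> p vs = \<alpha> p (fr U x p) / \<beta> p (fr U x p) * \<beta> p vs"
    if "(U, x) \<in> A" "p \<in> U" "vs \<in> tangent_tuples A p" for U x p vs
    using that(3) alternating_form_ratio[OF smooth_form_alternating[OF \<alpha>] smooth_form_alternating[OF \<beta>']
        subspace_tangent_space fr[OF that(1,2)] nz[OF that(1,2)]]
    unfolding tangent_tuples_def by simp
  have "\<exists>U x. (U, x) \<in> A \<and> q \<in> U" for q by (rule chart_at[of q]) blast
  then obtain U x where Ux: "\<And>q. (U q, x q) \<in> A \<and> q \<in> U q" by metis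
  define r where "r q = \<alpha> q (fr (U q) (x q) q) / \<beta> q (fr (U q) (x q) q)" for q
  have r: "\<alpha> q vs = r q * \<beta> q vs" if "vs \<in> tangent_tuples A q" for q vs
    unfolding r_def using ratio Ux that by blast
  have "continuous_on UNIV r"
  proof (rule continuous_at_imp_continuous_on, rule ballI)
    fix q
    obtain V y where V: "(V, y) \<in> A" "q \<in> V" by (rule chart_at)
    let ?Xs = "map (\<lambda>e p. chart_vec A V y p e) bs"
    have Xs: "map (\<lambda>X. X p) ?Xs = fr V y p" for p by (simp add: fr_def)
    have "continuous_on V (\<lambda>p. \<omega> p (fr V y p))" if "smooth_form A \<omega>" for \<omega>
    proof -
      have "smooth_fun_on A V (\<lambda>p. \<omega> p (map (\<lambda>X. X p) ?Xs))"
        by (rule smooth_formD(3)[OF that chart_open[OF V(1)]]) (use len chart_vec_field_smooth[OF V(1)] in auto)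
      then show ?thesis unfolding Xs by (rule smooth_fun_on_continuous)
    qed
    then have "continuous_on V (\<lambda>p. \<alpha> p (fr V y p) / \<beta> p (fr V y p))"
      using \<alpha> \<beta>' nz[OF V(1)] by (intro continuous_on_divide) auto
    then have "continuous_on V r"
    proof (rule continuous_on_eq)
      fix p assume p: "p \<in> V"
      have "fr V y p \<in> tangent_tuples A p"
        using fr[OF V(1) p] span_superset unfolding tangent_tuples_def by blast
      from r[OF this] show "\<alpha> p (fr V y p) / \<beta> p (fr V y p) = r p" using nz[OF V(1) p] by simp
    qed
    then show "isCont r q" using V chart_open[OF V(1)] by (simp add: continuous_on_eq_continuous_at)
  qed
  then show ?thesis using that r by blast
qed

lemma local_diffeo_between:
  assumes "local_diffeo A \<phi>"
  obtains U where "q \<in> U" "diffeo_between \<phi> U (inv_into U \<phi>) (\<phi> ` U)"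
proof -
  obtain U where "q \<in> U" "inj_on \<phi> U" "smooth_map_on A U \<phi>" "smooth_map_on A (\<phi> ` U) (inv_into U \<phi>)"
    using assms unfolding local_diffeo_def by blast
  then show ?thesis by (intro that[of U]) (auto simp: diffeo_between_def)
qed

lemma diffeo_imp_local_diffeo:
  assumes "diffeo A \<phi>"
  shows "local_diffeo A \<phi>"
  unfolding local_diffeo_def
proof
  fix q
  have "inj \<phi>" "range \<phi> = UNIV" using assms unfolding diffeo_def bij_def by auto
  then show "\<exists>U. q \<in> U \<and> inj_on \<phi> U \<and> smooth_map_on A U \<phi> \<and> smooth_map_on A (\<phi> ` U) (inv_into U \<phi>)"
    using assms unfolding diffeo_def by (intro exI[of _ UNIV]) auto
qed

text \<open>For smoothness, transport the vector fields by \<open>\<phi>\<close>, evaluate the form on them near \<open>\<phi> q\<close>, and compose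
  the resulting smooth function with \<open>\<phi>\<close>.\<close>

lemma smooth_form_pullback:
  assumes \<phi>: "local_diffeo A \<phi>" and \<omega>: "smooth_form A \<omega>"
  shows "smooth_form A (pullback A \<phi> \<omega>)"
proof -
  have tan: "pushforward A \<phi> q v \<in> tangent_space A (\<phi> q)" if "v \<in> tangent_space A q" for q v
  proof -
    obtain U where "q \<in> U" "diffeo_between \<phi> U (inv_into U \<phi>) (\<phi> ` U)" by (rule local_diffeo_between[OF \<phi>])
    then show ?thesis using pushforward_tangent diffeo_betweenD(1) that by blast
  qed
  have tup: "map (pushforward A \<phi> q) vs \<in> tangent_tuples A (\<phi> q)" if "vs \<in> tangent_tuples A q" for q vs
    using that tan unfolding tangent_tuples_def by auto
  show ?thesis
  proof (rule smooth_formI)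
    show "pullback A \<phi> \<omega> q (vs[i := a *\<^sub>R u + b *\<^sub>R w]) =
        a * pullback A \<phi> \<omega> q (vs[i := u]) + b * pullback A \<phi> \<omega> q (vs[i := w])"
      if "vs \<in> tangent_tuples A q" "i < DIM('e)" "u \<in> tangent_space A q" "w \<in> tangent_space A q" for q vs i u w a b
      unfolding pullback_def map_update linear_add[OF linear_pushforward] linear_cmul[OF linear_pushforward]
      by (rule smooth_formD(1)[OF \<omega> tup[OF that(1)] that(2) tan[OF that(3)] tan[OF that(4)]])
    show "pullback A \<phi> \<omega> q vs = 0"
      if "vs \<in> tangent_tuples A q" "i < DIM('e)" "j < DIM('e)" "i \<noteq> j" "vs ! i = vs ! j" for q vs i j
    proof -
      have "map (pushforward A \<phi> q) vs ! i = map (pushforward A \<phi> q) vs ! j"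
        using that by (simp add: tangent_tuples_def)
      then show ?thesis
        unfolding pullback_def by (rule smooth_formD(2)[OF \<omega> tup[OF that(1)] that(2,3,4)])
    qed
    show "smooth_fun_on A S (\<lambda>p. pullback A \<phi> \<omega> p (map (\<lambda>X. X p) Xs))"
      if S: "open S" "length Xs = DIM('e)" "\<And>X. X \<in> set Xs \<Longrightarrow> smooth_vfield_on A S X" for S Xs
    proof (rule smooth_fun_on_locally)
      fix q assume q: "q \<in> S"
      obtain U where U: "q \<in> U" "diffeo_between \<phi> U (inv_into U \<phi>) (\<phi> ` U)" by (rule local_diffeo_between[OF \<phi>])
      let ?\<psi> = "inv_into U \<phi>"
      let ?W = "S \<inter> U" and ?p = "push_field \<phi> ?\<psi>"
      let ?W' = "\<phi> ` U \<inter> ?\<psi> -` ?W"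
      note d = diffeo_betweenD[OF U(2)]
      have W: "open ?W" using S(1) smooth_map_on_open[OF d(1)] by blast
      have "smooth_vfield_on A ?W' (?p X)" if "X \<in> set Xs" for X
        by (rule push_field_smooth[OF U(2) vfield_subset[OF S(3)[OF that] W]]) auto
      then have "smooth_fun_on A ?W' (\<lambda>p. \<omega> p (map (\<lambda>X. X p) (map ?p Xs)))"
        by (intro smooth_formD(3)[OF \<omega> smooth_map_on_preimage_open[OF d(2) W]]) (use S(2) in auto)
      then have "smooth_fun_on A (U \<inter> \<phi> -` ?W') ((\<lambda>p. \<omega> p (map (\<lambda>X. X p) (map ?p Xs))) \<circ> \<phi>)"
        by (rule smooth_fun_on_compose[OF d(1)])
      moreover have "U \<inter> \<phi> -` ?W' = ?W"
      proof (rule Set.set_eqI)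
        show "x \<in> U \<inter> \<phi> -` ?W' \<longleftrightarrow> x \<in> ?W" for x
          using d(3,4)[of x] by (cases "x \<in> U") simp_all
      qed
      ultimately have "smooth_fun_on A ?W ((\<lambda>p. \<omega> p (map (\<lambda>X. X p) (map ?p Xs))) \<circ> \<phi>)" by simp
      then have "smooth_fun_on A ?W (\<lambda>p. pullback A \<phi> \<omega> p (map (\<lambda>X. X p) Xs))"
        by (rule smooth_fun_on_cong) (auto simp: pullback_def push_field_at[OF U(2)] o_def)
      then show "\<exists>W. q \<in> W \<and> W \<subseteq> S \<and> smooth_fun_on A W (\<lambda>p. pullback A \<phi> \<omega> p (map (\<lambda>X. X p) Xs))"
        using q U(1) by (intro exI[of _ ?W]) auto
    qed
  qed
qed

end

section \<open>The sign\<close>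

context equiregular_sub_riemannian
begin

text \<open>Vectors in \<open>D p\<close> with \<open>p \<in> U'\<close> come from \<open>D (\<psi> p)\<close>, because \<open>\<phi>\<close> maps \<open>D\<close> onto \<open>D\<close>. So \<open>\<psi>\<close> inherits
  both properties of an isometry from \<open>\<phi>\<close>.\<close>

lemma sr_isometric_between:
  assumes iso: "sr_isometric A D g \<phi>" and d: "diffeo_between \<phi> U \<psi> U'"
  shows "sr_isometry_between \<phi> U \<psi> U'"
proof -
  have D: "pushforward A \<phi> q ` D q = D (\<phi> q)"
    and g: "v \<in> D q \<Longrightarrow> w \<in> D q \<Longrightarrow> g (\<phi> q) (pushforward A \<phi> q v) (pushforward A \<phi> q w) = g q v w" for q v w
    using iso unfolding sr_isometric_def by auto
  have inv: "\<exists>w\<in>D (\<psi> p). v = pushforward A \<phi> (\<psi> p) w \<and> pushforward A \<psi> p v = w" if pv: "p \<in> U'" "v \<in> D p" for p v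
  proof -
    note p = diffeo_betweenD(3,4)[OF diffeo_between_sym[OF d] pv(1)]
    obtain w where w: "w \<in> D (\<psi> p)" "v = pushforward A \<phi> (\<psi> p) w" using D[of "\<psi> p"] pv(2) p(2) by auto
    moreover have "w \<in> tangent_space A (\<psi> p)" using w(1) D_tangent by blast
    ultimately show ?thesis using pushforward_inverse[OF d p(1)] p(2) by auto
  qed
  have "g (\<psi> p) (pushforward A \<psi> p v) (pushforward A \<psi> p w) = g p v w" if p: "p \<in> U'" "v \<in> D p" "w \<in> D p" for p v w
  proof -
    obtain v' w' where "v' \<in> D (\<psi> p)" "v = pushforward A \<phi> (\<psi> p) v'" "pushforward A \<psi> p v = v'"
      "w' \<in> D (\<psi> p)" "w = pushforward A \<phi> (\<psi> p) w'" "pushforward A \<psi> p w = w'"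
      using inv[OF p(1,2)] inv[OF p(1,3)] by blast
    then show ?thesis
      using g[of v' "\<psi> p" w'] diffeo_betweenD(4)[OF diffeo_between_sym[OF d] p(1)] by simp
  qed
  moreover have "pushforward A \<phi> q v \<in> D (\<phi> q)" if "v \<in> D q" for q v using D[of q] that by blast
  moreover have "pushforward A \<psi> p v \<in> D (\<psi> p)" if "p \<in> U'" "v \<in> D p" for p v using inv[OF that] by auto
  ultimately show ?thesis unfolding sr_isometry_between_def using d g by simp
qed

text \<open>The continuous factor between \<open>\<phi>\<^sup>*P\<close> and \<open>P\<close> is \<open>1\<close> or \<open>-1\<close> at every point, as seen on an adapted
  basis, hence constant by connectedness.\<close>

lemma pullback_popp_volume:
  assumes P: "popp_volume A D g P" and \<phi>: "local_diffeo A \<phi>" and iso: "sr_isometric A D g \<phi>"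
    and conn: "connected (UNIV :: 'm set)"
  obtains s where "s \<in> {1, -1}" "\<And>q vs. vs \<in> tangent_tuples A q \<Longrightarrow> pullback A \<phi> P q vs = s * P q vs"
proof -
  have "smooth_form A P" using P unfolding popp_volume_def by blast
  then obtain r where r: "continuous_on UNIV r"
    "\<And>q vs. vs \<in> tangent_tuples A q \<Longrightarrow> pullback A \<phi> P q vs = r q * P q vs"
    using smooth_form_ratio[OF smooth_form_pullback[OF \<phi>] popp_volume_form[OF P]] by blast
  have sgn: "r q \<in> {1, -1}" for q
  proof -
    obtain U where U: "q \<in> U" "diffeo_between \<phi> U (inv_into U \<phi>) (\<phi> ` U)" by (rule local_diffeo_between[OF \<phi>])
    obtain \<epsilon> where \<epsilon>: "\<epsilon> \<in> {1, -1}"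
      "\<And>vs. adapted_basis A D q vs \<Longrightarrow> P (\<phi> q) (map (pushforward A \<phi> q) vs) = \<epsilon> * P q vs"
      using popp_volume_push[OF P sr_isometric_between[OF iso U(2)] U(1)] by blast
    obtain vs where vs: "adapted_basis A D q vs" using adapted_basis_exists by blast
    then have "vs \<in> tangent_tuples A q"
      using span_superset[of "set vs"] by (simp add: adapted_basis_def tangent_tuples_def)
    then have "r q * P q vs = \<epsilon> * P q vs" using r(2) \<epsilon>(2)[OF vs] by (simp add: pullback_def)
    then show ?thesis using popp_volume_nonzero[OF P vs] \<epsilon>(1) by simp
  qed
  have "finite (range r)" by (rule finite_subset[of _ "{1, -1}"]) (use sgn in auto)
  then have "r constant_on UNIV" by (rule continuous_finite_range_constant[OF conn r(1)])
  then obtain s where "\<And>q. r q = s" unfolding constant_on_def by blast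
  then show ?thesis using that[of s] r(2) sgn by auto
qed

end

lemma continuous_nonzero_same_sign:
  fixes h :: "'a::topological_space \<Rightarrow> real"
  assumes "connected (UNIV :: 'a set)" "continuous_on UNIV h" "\<And>p. h p \<noteq> 0"
  shows "0 < h p * h q"
proof (rule ccontr)
  assume "\<not> 0 < h p * h q"
  then have "h p * h q < 0" using assms(3) by (simp add: not_less order.not_eq_order_implies_strict)
  then have "0 \<in> {h p..h q} \<union> {h q..h p}" by (auto simp: mult_less_0_iff)
  moreover have "{h p..h q} \<union> {h q..h p} \<subseteq> range h"
    using connected_contains_Icc[OF connected_continuous_image[OF assms(2,1)]] by blast
  ultimately show False using assms(3) by (metis rangeE subsetD)
qed

theorem proposition5:
  fixes A :: "('m::{t2_space,second_countable_topology}, 'e::euclidean_space) chart set"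
    and D :: "'m \<Rightarrow> 'm tvec set"
    and g :: "'m \<Rightarrow> 'm tvec \<Rightarrow> 'm tvec \<Rightarrow> real"
    and k :: nat
    and P :: "'m form"
    and \<phi> :: "'m \<Rightarrow> 'm"
  assumes "sub_riemannian_manifold A k D g"
    and "equiregular A D"
    and "popp_volume A D g P"
    and "sr_isometry A D g \<phi> \<or> sr_local_isometry A D g \<phi>"
  shows "(orientation_preserving A \<phi> \<longrightarrow> volume_preserving A P \<phi>) \<and>
         (\<not> orientation_preserving A \<phi> \<longrightarrow> same_form A (pullback A \<phi> P) (\<lambda>q vs. - P q vs))"
proof -
  interpret equiregular_sub_riemannian A D g
    using assms(1,2) unfolding sub_riemannian_manifold_def distribution_def
    by unfold_locales auto
  note P = assms(3)
  have conn: "connected (UNIV :: 'm set)" using assms(1) unfolding sub_riemannian_manifold_def by blast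
  have \<phi>: "local_diffeo A \<phi>" and iso: "sr_isometric A D g \<phi>"
    using assms(4) diffeo_imp_local_diffeo unfolding sr_isometry_def sr_local_isometry_def by auto
  obtain s where s: "s \<in> {1, -1}"
    "\<And>q vs. vs \<in> tangent_tuples A q \<Longrightarrow> pullback A \<phi> P q vs = s * P q vs"
    using pullback_popp_volume[OF P \<phi> iso conn] by blast
  have P': "volume_form A P" by (rule popp_volume_form[OF P])
  have "s = 1" if op: "orientation_preserving A \<phi>"
  proof -
    obtain \<omega> where \<omega>: "volume_form A \<omega>"
      "\<And>q. \<exists>c>0. \<forall>vs\<in>tangent_tuples A q. pullback A \<phi> \<omega> q vs = c * \<omega> q vs"
      using op unfolding orientation_preserving_def by blast
    obtain h where h: "continuous_on UNIV h" "\<And>q vs. vs \<in> tangent_tuples A q \<Longrightarrow> P q vs = h q * \<omega> q vs"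
      using smooth_form_ratio[OF _ \<omega>(1)] P' unfolding volume_form_def by blast
    \<comment> \<open>\<open>h\<close> has constant sign, and \<open>\<phi>\<^sup>*P = s P\<close>, \<open>\<phi>\<^sup>*\<omega> = c \<omega>\<close> give \<open>s h(q) = c h(\<phi> q)\<close> with \<open>c > 0\<close>.\<close>
    have "h q \<noteq> 0" for q using P' h(2) unfolding volume_form_def by (metis mult_zero_left)
    then have same: "0 < h p * h q" for p q by (rule continuous_nonzero_same_sign[OF conn h(1)])
    fix q :: 'm
    obtain c where c: "c > 0" "\<And>vs. vs \<in> tangent_tuples A q \<Longrightarrow> pullback A \<phi> \<omega> q vs = c * \<omega> q vs"
      using \<omega>(2) by blast
    obtain vs where vs: "vs \<in> tangent_tuples A q" "\<omega> q vs \<noteq> 0" using \<omega>(1) unfolding volume_form_def by blast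
    obtain U where U: "q \<in> U" "diffeo_between \<phi> U (inv_into U \<phi>) (\<phi> ` U)" by (rule local_diffeo_between[OF \<phi>])
    have tup: "map (pushforward A \<phi> q) vs \<in> tangent_tuples A (\<phi> q)"
      using vs(1) pushforward_tangent[OF diffeo_betweenD(1)[OF U(2)] U(1)] unfolding tangent_tuples_def by auto
    have "s * (h q * \<omega> q vs) = pullback A \<phi> P q vs" using s(2)[OF vs(1)] h(2)[OF vs(1)] by simp
    also have "\<dots> = h (\<phi> q) * \<omega> (\<phi> q) (map (pushforward A \<phi> q) vs)"
      unfolding pullback_def by (rule h(2)[OF tup])
    also have "\<omega> (\<phi> q) (map (pushforward A \<phi> q) vs) = c * \<omega> q vs"
      using c(2)[OF vs(1)] unfolding pullback_def .
    finally have "(s * h q) * \<omega> q vs = (h (\<phi> q) * c) * \<omega> q vs" by simp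
    then have "s * h q = h (\<phi> q) * c" using vs(2) by simp
    then have "s * (h q * h q) = c * (h (\<phi> q) * h q)" by (simp add: algebra_simps)
    moreover have "0 < c * (h (\<phi> q) * h q)" using c(1) same by (rule mult_pos_pos)
    ultimately have "0 < s * (h q * h q)" by (simp only:)
    then have "0 < s" using same[of q q] zero_less_mult_pos2 by blast
    then show "s = 1" using s(1) by auto
  qed
  moreover have "s = - 1" if "\<not> orientation_preserving A \<phi>"
  proof (rule ccontr)
    assume "s \<noteq> - 1"
    then have "s = 1" using s(1) by simp
    \<comment> \<open>\<open>P\<close> itself is a volume form with \<open>\<phi>\<^sup>*P = P\<close>.\<close>
    then have "orientation_preserving A \<phi>"
      unfolding orientation_preserving_def using P' s(2) by (intro exI[of _ P]) (auto intro!: exI[of _ 1])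
    then show False using that by blast
  qed
  ultimately show ?thesis
    using s(2) \<phi> unfolding volume_preserving_def same_form_def by auto
qed

end
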